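(* Let $W=W(n,p)$ be the number of isolated vertices in the Erdős–Rényi random graph $G(n,p)$ (on $n$ vertices, each edge present independently with probability $p=p(n)$), and let $\mu_n=\mathbb{E}W$, $\sigma_n^2=\mathrm{Var}(W)$. (i) If $\lim_{n\to\infty}(\log(n)-np)=\infty$ and either $\lim_{n\to\infty}np=\infty$ or $\lim_{n\to\infty}np=c>0$, then $\sigma_n^2\asymp ne^{-np}$ and \[ d_{\mathrm{loc}}\bigl(\mathcal{L}(W),\mathrm{TP}(\mu_n,\sigma_n^2)\bigr)=O(\sigma_n^{-3/2}). \] (ii) If $\lim_{n\to\infty}np=0$ and $\lim_{n\to\infty}n^2p=\infty$, then $\sigma_n^2\asymp n^2p$ and \[ d_{\mathrm{loc}}\bigl(\mathcal{L}(W),\mathrm{TP}(\mu_n,\sigma_n^2)\bigr)=O\bigl(\sigma_n^{-1}(np^{3/4})^{-1}\bigr),\qquad d_{\mathrm{loc}}^{(2)}\bigl(\mathcal{L}(W),\mathrm{TP}(\mu_n,\sigma_n^2)\bigr)=O(\sigma_n^{-3/2}). \]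
   Context: For $f:\mathbb{Z}\to\mathbb{R}$, $\|f\|_\infty=\sup|f(i)|$ and $\Delta f(j)=f(j+1)-f(j)$. For an integer-supported law with distribution function $F(j)=\mathbb{P}[X\le j]$ and positive integer $m$, $\bar F^m(j)=\frac{F(j)+\dots+F(j-m+1)}{m}$. For two such laws with distribution functions $F,G$: $d_{\mathrm{loc}}^{(m)}(F,G)=\|\Delta\bar F^m-\Delta\bar G^m\|_\infty$ and $d_{\mathrm{loc}}=d_{\mathrm{loc}}^{(1)}$. Translated Poisson: for $\mu\in\mathbb{R}$, $s^2>0$, $Z\sim\mathrm{TP}(\mu,s^2)$ means $Z-\lfloor\mu-s^2\rfloor\sim\mathrm{Po}(s^2+\gamma)$ with $\gamma=\mu-s^2-\lfloor\mu-s^2\rfloor$. *)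

theory Defs
  imports Complex_Main "HOL-Library.Landau_Symbols"
begin

text \<open>Vertices are 0..n-1; a potential edge is a pair (i,j) with i < j < n.
  A graph is a set of such pairs.\<close>

definition er_pairs :: "nat \<Rightarrow> (nat \<times> nat) set" where
  "er_pairs n = {(i, j). i < j \<and> j < n}"

definition num_isolated :: "nat \<Rightarrow> (nat \<times> nat) set \<Rightarrow> nat" where
  "num_isolated n E = card {v. v < n \<and> \<not> (\<exists>(i, j)\<in>E. i = v \<or> j = v)}"

definition er_prob :: "nat \<Rightarrow> real \<Rightarrow> (nat \<times> nat) set \<Rightarrow> real" where
  "er_prob n p E = p ^ card E * (1 - p) ^ (card (er_pairs n) - card E)"

definition W_pmf :: "nat \<Rightarrow> real \<Rightarrow> int \<Rightarrow> real" where
  "W_pmf n p k = (\<Sum>E \<in> Pow (er_pairs n). if int (num_isolated n E) = k then er_prob n p E else 0)"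

definition W_cdf :: "nat \<Rightarrow> real \<Rightarrow> int \<Rightarrow> real" where
  "W_cdf n p j = (\<Sum>E \<in> Pow (er_pairs n). if int (num_isolated n E) \<le> j then er_prob n p E else 0)"

definition W_mean :: "nat \<Rightarrow> real \<Rightarrow> real" where
  "W_mean n p = (\<Sum>E \<in> Pow (er_pairs n). real (num_isolated n E) * er_prob n p E)"

definition W_var :: "nat \<Rightarrow> real \<Rightarrow> real" where
  "W_var n p = (\<Sum>E \<in> Pow (er_pairs n). (real (num_isolated n E) - W_mean n p)^2 * er_prob n p E)"

definition poisson_cdf :: "real \<Rightarrow> int \<Rightarrow> real" where
  "poisson_cdf lam j = (if j < 0 then 0 else (\<Sum>k\<le>nat j. exp (- lam) * lam ^ k / fact k))"

text \<open>Z ~ TP(mu, s2): Z - floor(mu - s2) ~ Po(s2 + gamma), gamma = mu - s2 - floor(mu - s2).\<close>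
definition TP_cdf :: "real \<Rightarrow> real \<Rightarrow> int \<Rightarrow> real" where
  "TP_cdf mu s2 j =
     (let a = \<lfloor>mu - s2\<rfloor>; g = mu - s2 - of_int a in poisson_cdf (s2 + g) (j - a))"

definition Delta :: "(int \<Rightarrow> real) \<Rightarrow> int \<Rightarrow> real" where
  "Delta f j = f (j + 1) - f j"

definition smooth_cdf :: "nat \<Rightarrow> (int \<Rightarrow> real) \<Rightarrow> int \<Rightarrow> real" where
  "smooth_cdf m F j = (\<Sum>i<m. F (j - int i)) / real m"

definition d_loc_m :: "nat \<Rightarrow> (int \<Rightarrow> real) \<Rightarrow> (int \<Rightarrow> real) \<Rightarrow> real" where
  "d_loc_m m F G = (SUP j. \<bar>Delta (smooth_cdf m F) j - Delta (smooth_cdf m G) j\<bar>)"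

abbreviation d_loc :: "(int \<Rightarrow> real) \<Rightarrow> (int \<Rightarrow> real) \<Rightarrow> real" where
  "d_loc \<equiv> d_loc_m 1"

end

theory Submission
  imports Defs "HOL-Probability.Characteristic_Functions"
begin

text \<open>With \<open>q = 1 - p\<close>, a set of \<open>k\<close> vertices is isolated with probability
  \<open>q ^ (k * (n - k) + (k choose 2))\<close>, so the generating function of \<open>W\<close> is
  \<open>\<Sum>k. (n choose k) * q ^ (k * (n - k) + (k choose 2)) * (z - 1) ^ k\<close>.

  The generating functions for \<open>n\<close> and \<open>n + 1\<close> vertices satisfy two recursions, which say that the
  characteristic function of \<open>W\<close> solves the Gaussian equation
  \<open>\<phi>' t = (\<i> * \<mu> - \<sigma>\<^sup>2 * t) * \<phi> t\<close> up to an error \<open>O(\<sigma>\<^sup>2 * t\<^sup>2)\<close>. The translated Poisson law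
  does so as well, hence the two characteristic functions differ by \<open>O(t\<^sup>2 + \<sigma>\<^sup>2 * \<bar>t\<bar> ^ 3)\<close>.

  The exponent being quadratic in \<open>k\<close>, the generating function is a Gaussian integral of
  \<open>(1 + (z - 1) * exp u) ^ n\<close>. Bounding the integrand gives the decay
  \<open>exp (- c * \<sigma>\<^sup>2 * (1 - cos t))\<close>, up to a term that matters only near \<open>t = pi\<close> and comes from the
  nearly constant parity of \<open>W\<close> in sparse graphs, and up to \<open>O(\<sigma> powr (- 3 / 2))\<close>.

  Fourier inversion and the geometric mean of the bounds for small and for large \<open>t\<close> then
  give the rate.\<close>

subsection \<open>The generating function\<close>

text \<open>The Gaussian mixture is only formal. With \<open>v = - ln (1 - p)\<close> and
  \<open>m = (n - 1 / 2) * v\<close> the variable \<open>u\<close> has mean \<open>- m\<close> and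
  variance \<open>v\<close>, and for \<open>u > 0\<close> the factor
  \<open>1 + (z - 1) * exp u\<close> can exceed 1 in modulus before it is raised to the power
  \<open>n\<close>. Modulus times density can then have a second peak near \<open>u = m\<close>, the
  mirror image of the first. The first peak gives decay in \<open>1 - cos t\<close>. The mirror peak
  decays in \<open>1 + cos t\<close>, and at \<open>t = pi\<close> it keeps only a factor of the
  form \<open>exp (- c * n ^ 3 * p ^ 2)\<close> in the sparse case. This is the parity effect: if
  all components have at most two vertices, then \<open>n - W\<close> is even. The smallest
  components that break this are paths with two edges, of which about
  \<open>n ^ 3 * p ^ 2 / 2\<close> are expected. Hence the weaker rate for single masses in sparse
  graphs, and its repair by averaging neighbours. Neither bound on the difference of characteristic
  functions suffices alone: one grows with \<open>t\<close>, the other is of order 1 at 0. The root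
  of their product is at most a constant times \<open>V powr (- 1 / 4) / (1 + V * t ^ 2)\<close>,
  where \<open>V\<close> is the variance, and this integrates to \<open>V powr (- 3 / 4)\<close>
  without a cutoff point.\<close>

lemma choose_two_add: "(a + b) choose 2 = (a choose 2) + a * b + (b choose 2)"
  by (induction a) (simp_all add: numeral_2_eq_2)

lemma card_increasing_pairs:
  assumes "finite (X :: nat set)"
  shows "card {(i, j). i < j \<and> i \<in> X \<and> j \<in> X} = card X choose 2"
proof -
  have "bij_betw (\<lambda>(i, j). {i, j}) {(i, j). i < j \<and> i \<in> X \<and> j \<in> X} {A. A \<subseteq> X \<and> card A = 2}"
    unfolding bij_betw_def
  proof
    show "inj_on (\<lambda>(i, j). {i, j}) {(i, j). i < j \<and> i \<in> X \<and> j \<in> X}"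
      by (auto simp: inj_on_def doubleton_eq_iff)
    show "(\<lambda>(i, j). {i, j}) ` {(i, j). i < j \<and> i \<in> X \<and> j \<in> X} = {A. A \<subseteq> X \<and> card A = 2}"
    proof (intro equalityI subsetI)
      fix A assume "A \<in> {A. A \<subseteq> X \<and> card A = 2}"
      then obtain x y where xy: "A = {x, y}" "x \<noteq> y" "x \<in> X" "y \<in> X"
        by (auto simp: card_2_iff)
      then have "A = (\<lambda>(i, j). {i, j}) (min x y, max x y)" "(min x y, max x y) \<in> {(i, j). i < j \<and> i \<in> X \<and> j \<in> X}"
        by (auto simp: min_def max_def)
      then show "A \<in> (\<lambda>(i, j). {i, j}) ` {(i, j). i < j \<and> i \<in> X \<and> j \<in> X}"
        by blast
    qed auto
  qed
  then show ?thesis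
    using n_subsets[OF assms] by (simp add: bij_betw_same_card)
qed

section \<open>Edges touching a vertex set, and the probability that the set is isolated\<close>

lemma er_pairs_alt: "er_pairs n = {(i, j). i < j \<and> i \<in> {..<n} \<and> j \<in> {..<n}}"
  by (auto simp: er_pairs_def)

lemma finite_er_pairs [simp]: "finite (er_pairs n)"
  by (rule finite_subset[of _ "{..<n} \<times> {..<n}"]) (auto simp: er_pairs_alt)

lemma card_er_pairs: "card (er_pairs n) = n choose 2"
  unfolding er_pairs_alt by (subst card_increasing_pairs) auto

definition touching :: "nat \<Rightarrow> nat set \<Rightarrow> (nat \<times> nat) set" where
  "touching n S = {(i, j) \<in> er_pairs n. i \<in> S \<or> j \<in> S}"

definition touch_count :: "nat \<Rightarrow> nat \<Rightarrow> nat" where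
  "touch_count n k = k * (n - k) + (k choose 2)"

lemma touch_count_Suc_Suc: "k \<le> n \<Longrightarrow> touch_count (Suc n) (Suc k) = touch_count n k + n"
  by (elim less_eqE) (simp add: touch_count_def numeral_2_eq_2 algebra_simps)

lemma touch_count_0 [simp]: "touch_count n 0 = 0"
  by (simp add: touch_count_def numeral_2_eq_2)

lemma touch_count_Suc: "k \<le> n \<Longrightarrow> touch_count (Suc n) k = touch_count n k + k"
  by (simp add: touch_count_def Suc_diff_le)

lemma card_touching:
  assumes "S \<subseteq> {..<n}"
  shows "card (touching n S) = touch_count n (card S)"
proof -
  have fS: "finite S" and kn: "card S \<le> n"
    using assms finite_subset card_mono[OF _ assms] by auto
  let ?R = "{(i, j). i < j \<and> i \<in> {..<n} - S \<and> j \<in> {..<n} - S}"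
  have "touching n S = er_pairs n - ?R" and "?R \<subseteq> er_pairs n"
    by (auto simp: touching_def er_pairs_def)
  then have "card (touching n S) = card (er_pairs n) - card ?R"
    using finite_subset[OF _ finite_er_pairs] by (simp add: card_Diff_subset)
  also have "card ?R = (n - card S) choose 2"
    by (subst card_increasing_pairs) (use assms fS in \<open>auto simp: card_Diff_subset\<close>)
  also have "card (er_pairs n) - (n - card S choose 2) = touch_count n (card S)"
    using choose_two_add[of "card S" "n - card S"] kn by (simp add: card_er_pairs touch_count_def)
  finally show ?thesis .
qed

definition isolated_set :: "nat \<Rightarrow> (nat \<times> nat) set \<Rightarrow> nat set" where
  "isolated_set n E = {v. v < n \<and> \<not> (\<exists>(i, j)\<in>E. i = v \<or> j = v)}"

lemma num_isolated_eq: "num_isolated n E = card (isolated_set n E)"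
  by (simp add: num_isolated_def isolated_set_def)

lemma isolated_set_subset: "isolated_set n E \<subseteq> {..<n}"
  by (auto simp: isolated_set_def)

lemma finite_isolated_set [simp]: "finite (isolated_set n E)"
  using isolated_set_subset finite_subset by blast

lemma num_isolated_le: "num_isolated n E \<le> n"
  unfolding num_isolated_eq using card_mono[OF _ isolated_set_subset] by force

lemma subset_isolated_set_iff:
  assumes "E \<subseteq> er_pairs n" "S \<subseteq> {..<n}"
  shows "S \<subseteq> isolated_set n E \<longleftrightarrow> E \<subseteq> er_pairs n - touching n S"
  using assms unfolding isolated_set_def touching_def by fastforce

lemma sum_Pow_binomial_weights:
  assumes "finite A"
  shows "(\<Sum>E\<in>Pow A. p ^ card E * (1 - p) ^ (card A - card E)) = (1 :: real)"
proof -
  have "(\<Sum>E\<in>Pow A. p ^ card E * (1 - p) ^ (card A - card E)) =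
        (\<Sum>E\<in>Pow A. (\<Prod>i\<in>E. p) * (\<Prod>i\<in>A - E. 1 - p))"
    using assms by (intro sum.cong) (auto simp: card_Diff_subset finite_subset)
  also have "\<dots> = 1"
    using assms by (subst prod_add[symmetric]) auto
  finally show ?thesis .
qed

lemma prob_subset_isolated:
  assumes "S \<subseteq> {..<n}"
  shows "(\<Sum>E | E \<subseteq> er_pairs n \<and> S \<subseteq> isolated_set n E. er_prob n p E) = (1 - p) ^ touch_count n (card S)"
proof -
  let ?A = "er_pairs n - touching n S"
  have sub: "touching n S \<subseteq> er_pairs n"
    by (auto simp: touching_def)
  have cA: "card ?A = card (er_pairs n) - card (touching n S)"
    and le: "card (touching n S) \<le> card (er_pairs n)"
    using sub finite_subset[OF sub] by (auto simp: card_Diff_subset intro: card_mono)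
  have "{E. E \<subseteq> er_pairs n \<and> S \<subseteq> isolated_set n E} = Pow ?A"
    using subset_isolated_set_iff[OF _ assms] by blast
  then have "(\<Sum>E | E \<subseteq> er_pairs n \<and> S \<subseteq> isolated_set n E. er_prob n p E) = (\<Sum>E\<in>Pow ?A. er_prob n p E)"
    by simp
  also have "\<dots> = (\<Sum>E\<in>Pow ?A. (1 - p) ^ card (touching n S) * (p ^ card E * (1 - p) ^ (card ?A - card E)))"
  proof (intro sum.cong refl)
    fix E assume "E \<in> Pow ?A"
    then have "card E \<le> card ?A"
      by (intro card_mono) auto
    then have "card (er_pairs n) - card E = card (touching n S) + (card ?A - card E)"
      using cA le by simp
    then show "er_prob n p E = (1 - p) ^ card (touching n S) * (p ^ card E * (1 - p) ^ (card ?A - card E))"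
      by (simp add: er_prob_def power_add)
  qed
  also have "\<dots> = (1 - p) ^ card (touching n S)"
    by (subst sum_distrib_left[symmetric], subst sum_Pow_binomial_weights) auto
  finally show ?thesis
    using card_touching[OF assms] by simp
qed

lemma sum_Pow_by_card:
  fixes f :: "nat \<Rightarrow> 'a :: comm_semiring_1"
  assumes "finite A"
  shows "(\<Sum>S\<in>Pow A. f (card S)) = (\<Sum>k\<le>card A. of_nat (card A choose k) * f k)"
proof -
  have "(\<Sum>S\<in>Pow A. f (card S)) = (\<Sum>k\<le>card A. \<Sum>S | S \<in> Pow A \<and> card S = k. f (card S))"
    using assms by (intro sum.group[symmetric]) (auto intro: card_mono)
  also have "\<dots> = (\<Sum>k\<le>card A. of_nat (card A choose k) * f k)"
  proof (intro sum.cong refl)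
    fix k
    have "(\<Sum>S | S \<in> Pow A \<and> card S = k. f (card S)) = (\<Sum>S | S \<in> Pow A \<and> card S = k. f k)"
      by (intro sum.cong) auto
    then show "(\<Sum>S | S \<in> Pow A \<and> card S = k. f (card S)) = of_nat (card A choose k) * f k"
      using n_subsets[OF assms, of k] by simp
  qed
  finally show ?thesis .
qed

section \<open>Generating functions and their recursions\<close>

definition iso_prob :: "nat \<Rightarrow> real \<Rightarrow> nat \<Rightarrow> real" where
  "iso_prob n p k = W_pmf n p (int k)"

lemma iso_prob_alt: "iso_prob n p k = (\<Sum>E | E \<in> Pow (er_pairs n) \<and> num_isolated n E = k. er_prob n p E)"
  unfolding iso_prob_def W_pmf_def by (subst sum.inter_filter) auto

lemma expectation_num_isolated:
  fixes f :: "nat \<Rightarrow> 'a :: real_algebra_1"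
  shows "(\<Sum>E\<in>Pow (er_pairs n). of_real (er_prob n p E) * f (num_isolated n E)) =
         (\<Sum>k\<le>n. of_real (iso_prob n p k) * f k)"
proof -
  have "(\<Sum>E\<in>Pow (er_pairs n). of_real (er_prob n p E) * f (num_isolated n E)) =
        (\<Sum>k\<le>n. \<Sum>E | E \<in> Pow (er_pairs n) \<and> num_isolated n E = k. of_real (er_prob n p E) * f (num_isolated n E))"
    by (intro sum.group[symmetric]) (auto intro: num_isolated_le)
  also have "\<dots> = (\<Sum>k\<le>n. of_real (iso_prob n p k) * f k)"
    unfolding iso_prob_alt of_real_sum sum_distrib_right by (intro sum.cong) auto
  finally show ?thesis .
qed

text \<open>With \<open>q = 1 - p\<close> the coefficient of \<open>y ^ k\<close> is the binomial
  moment of order \<open>k\<close>, the expected number of \<open>k\<close>-sets of isolated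
  vertices; the variable \<open>y\<close> stands for \<open>z - 1\<close>.\<close>

definition fact_gf :: "nat \<Rightarrow> real \<Rightarrow> complex \<Rightarrow> complex" where
  "fact_gf n q y = (\<Sum>k\<le>n. of_nat (n choose k) * of_real (q ^ touch_count n k) * y ^ k)"

definition iso_gf :: "nat \<Rightarrow> real \<Rightarrow> complex \<Rightarrow> complex" where
  "iso_gf n p z = (\<Sum>k\<le>n. of_real (iso_prob n p k) * z ^ k)"

text \<open>Expanding \<open>(1 + y) ^ card I\<close> over the subsets of the isolated set
  \<open>I\<close> and exchanging the sums over graphs and vertex sets leaves only the probabilities
  that given sets are isolated.\<close>

lemma iso_gf_eq_fact_gf: "iso_gf n p (1 + y) = fact_gf n (1 - p) y"
proof -
  let ?P = "Pow (er_pairs n)" and ?V = "Pow {..<n}"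
  have expand: "(1 + y) ^ card A = (\<Sum>S\<in>Pow A. y ^ card S)" if "finite A" for A :: "nat set"
    using prod_add[OF that, of "\<lambda>_. y" "\<lambda>_. 1"] by (simp add: add.commute)
  have "iso_gf n p (1 + y) = (\<Sum>E\<in>?P. of_real (er_prob n p E) * (1 + y) ^ num_isolated n E)"
    unfolding iso_gf_def by (rule expectation_num_isolated[symmetric])
  also have "\<dots> = (\<Sum>E\<in>?P. \<Sum>S\<in>Pow (isolated_set n E). of_real (er_prob n p E) * y ^ card S)"
    by (simp add: num_isolated_eq expand sum_distrib_left)
  also have "\<dots> = (\<Sum>E\<in>?P. \<Sum>S | S \<in> ?V \<and> S \<subseteq> isolated_set n E. of_real (er_prob n p E) * y ^ card S)"
    using isolated_set_subset by (intro sum.cong refl arg_cong2[where f = sum]) blast+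
  also have "\<dots> = (\<Sum>S\<in>?V. \<Sum>E | E \<in> ?P \<and> S \<subseteq> isolated_set n E. of_real (er_prob n p E) * y ^ card S)"
    by (rule sum.swap_restrict) auto
  also have "\<dots> = (\<Sum>S\<in>?V. of_real ((1 - p) ^ touch_count n (card S)) * y ^ card S)"
    by (intro sum.cong refl, subst prob_subset_isolated[symmetric])
       (auto simp: sum_distrib_right)
  also have "\<dots> = fact_gf n (1 - p) y"
    by (subst sum_Pow_by_card) (auto simp: fact_gf_def mult.assoc)
  finally show ?thesis .
qed

text \<open>Split the vertex sets by whether they contain the added vertex. If not, each of the
  \<open>k\<close> chosen vertices must avoid one more edge, which rescales \<open>y\<close> by
  \<open>q\<close>; if so, the added vertex must avoid all \<open>n\<close> edges.\<close>

lemma fact_gf_Suc: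
  "fact_gf (Suc n) q y = fact_gf n q (of_real q * y) + of_real (q ^ n) * y * fact_gf n q y"
proof -
  define c where "c k = of_nat (n choose k) * of_real (q ^ touch_count n k) * y ^ k" for k
  have "fact_gf (Suc n) q y = 1 + (\<Sum>k\<le>n. of_nat (Suc n choose Suc k) * of_real (q ^ touch_count (Suc n) (Suc k)) * y ^ Suc k)"
    unfolding fact_gf_def by (subst sum.atMost_Suc_shift) simp
  also have "(\<Sum>k\<le>n. of_nat (Suc n choose Suc k) * of_real (q ^ touch_count (Suc n) (Suc k)) * y ^ Suc k) =
    (\<Sum>k\<le>n. of_nat (n choose Suc k) * of_real (q ^ touch_count (Suc n) (Suc k)) * y ^ Suc k) +
    of_real (q ^ n) * y * (\<Sum>k\<le>n. c k)"
    unfolding sum_distrib_left sum.distrib[symmetric]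
    by (intro sum.cong refl) (simp add: c_def touch_count_Suc_Suc power_add algebra_simps)
  also have "1 + ((\<Sum>k\<le>n. of_nat (n choose Suc k) * of_real (q ^ touch_count (Suc n) (Suc k)) * y ^ Suc k) +
    of_real (q ^ n) * y * (\<Sum>k\<le>n. c k)) =
    (\<Sum>k\<le>Suc n. of_nat (n choose k) * of_real (q ^ touch_count (Suc n) k) * y ^ k) + of_real (q ^ n) * y * fact_gf n q y"
    by (subst sum.atMost_Suc_shift) (simp add: fact_gf_def c_def)
  also have "(\<Sum>k\<le>Suc n. of_nat (n choose k) * of_real (q ^ touch_count (Suc n) k) * y ^ k) = fact_gf n q (of_real q * y)"
    unfolding fact_gf_def sum.atMost_Suc
    by (auto simp: touch_count_Suc power_add power_mult_distrib binomial_eq_0 intro!: sum.cong)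
  finally show ?thesis .
qed

text \<open>Differentiation marks one isolated vertex: there are \<open>Suc n\<close> choices, it
  avoids \<open>n\<close> edges with probability \<open>q ^ n\<close>, and what remains is a random
  graph on \<open>n\<close> vertices.\<close>

lemma fact_gf_has_field_derivative:
  "(fact_gf (Suc n) q has_field_derivative of_nat (Suc n) * of_real (q ^ n) * fact_gf n q y) (at y)"
proof -
  have "((\<lambda>y. \<Sum>k\<le>Suc n. of_nat (Suc n choose k) * of_real (q ^ touch_count (Suc n) k) * y ^ k) has_field_derivative
    (\<Sum>k\<le>Suc n. of_nat (Suc n choose k) * of_real (q ^ touch_count (Suc n) k) * (of_nat k * y ^ (k - 1)))) (at y)"
    by (intro DERIV_sum DERIV_cmult) (auto intro!: derivative_eq_intros)
  moreover have "(\<Sum>k\<le>Suc n. of_nat (Suc n choose k) * of_real (q ^ touch_count (Suc n) k) * (of_nat k * y ^ (k - 1)))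
     = of_nat (Suc n) * of_real (q ^ n) * fact_gf n q y"
    unfolding fact_gf_def sum_distrib_left
  proof (subst sum.atMost_Suc_shift, simp only: of_nat_0 mult_zero_left mult_zero_right add_0, intro sum.cong refl)
    fix k assume "k \<in> {..n}"
    have "complex_of_nat (Suc n choose Suc k) * of_nat (Suc k) = of_nat (Suc n) * of_nat (n choose k)"
      by (metis Suc_times_binomial_eq mult.commute of_nat_mult)
    then show "complex_of_nat (Suc n choose Suc k) * of_real (q ^ touch_count (Suc n) (Suc k)) * (of_nat (Suc k) * y ^ (Suc k - 1)) =
      of_nat (Suc n) * of_real (q ^ n) * (of_nat (n choose k) * of_real (q ^ touch_count n k) * y ^ k)"
      using \<open>k \<in> {..n}\<close> touch_count_Suc_Suc[of k n]
      by (simp add: power_add mult_ac del: binomial_Suc_Suc of_nat_Suc)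
  qed
  ultimately show ?thesis
    unfolding fact_gf_def[abs_def] by simp
qed

lemma iso_gf_alt: "iso_gf n p z = fact_gf n (1 - p) (z - 1)"
  using iso_gf_eq_fact_gf[of n p "z - 1"] by simp

text \<open>The added vertex hits each isolated vertex independently with probability
  \<open>p\<close>, which gives the argument \<open>p + (1 - p) * z\<close>. The second term
  corrects for the event that it has no edge at all and is isolated itself.\<close>

lemma iso_gf_Suc:
  "iso_gf (Suc n) p z = iso_gf n p (of_real p + of_real (1 - p) * z) + of_real ((1 - p) ^ n) * (z - 1) * iso_gf n p z"
  unfolding iso_gf_alt fact_gf_Suc by (simp add: algebra_simps)

lemma iso_gf_has_field_derivative:
  "(iso_gf (Suc n) p has_field_derivative of_nat (Suc n) * of_real ((1 - p) ^ n) * iso_gf n p z) (at z)"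
  unfolding iso_gf_alt[abs_def]
  by (rule DERIV_cong, rule DERIV_chain2[OF fact_gf_has_field_derivative]) (auto intro!: derivative_eq_intros)

subsection \<open>The characteristic function near the origin\<close>

lemma norm_cis_minus_1: "norm (cis x - 1) \<le> \<bar>x\<bar>"
  using iexp_approx1[of x 0] by (simp add: cis_conv_exp)

lemma norm_cis_minus_1_minus: "norm (cis x - 1 - \<i> * of_real x) \<le> x\<^sup>2 / 2"
  using iexp_approx1[of x 1] by (simp add: cis_conv_exp numeral_2_eq_2 algebra_simps)

lemma iso_prob_nonneg: "0 \<le> p \<Longrightarrow> p \<le> 1 \<Longrightarrow> 0 \<le> iso_prob n p k"
  unfolding iso_prob_alt by (intro sum_nonneg) (simp add: er_prob_def)

lemma iso_gf_1 [simp]: "iso_gf n p 1 = 1"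
proof -
  have "(\<Sum>k\<le>n. complex_of_nat (n choose k) * of_real ((1 - p) ^ touch_count n k) * 0 ^ k) =
        (\<Sum>k\<in>{0}. complex_of_nat (n choose k) * of_real ((1 - p) ^ touch_count n k) * 0 ^ k)"
    by (rule sum.mono_neutral_right) auto
  then show ?thesis
    by (simp add: iso_gf_alt fact_gf_def)
qed

lemma sum_iso_prob: "(\<Sum>k\<le>n. iso_prob n p k) = 1"
proof -
  have "complex_of_real (\<Sum>k\<le>n. iso_prob n p k) = of_real 1"
    using iso_gf_1[of n p] unfolding iso_gf_def by simp
  then show ?thesis
    by (simp only: of_real_eq_iff)
qed

section \<open>Mean and variance\<close>

definition iso_mean :: "nat \<Rightarrow> real \<Rightarrow> real" where
  "iso_mean n p = real n * (1 - p) ^ (n - 1)"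

lemma iso_mean_0 [simp]: "iso_mean 0 p = 0"
  by (simp add: iso_mean_def)

lemma iso_mean_Suc: "iso_mean (Suc n) p = real (Suc n) * (1 - p) ^ n"
  by (simp add: iso_mean_def)

lemma iso_gf_has_field_derivative':
  "(iso_gf n p has_field_derivative (\<Sum>k\<le>n. of_real (iso_prob n p k) * (of_nat k * z ^ (k - 1)))) (at z)"
  unfolding iso_gf_def[abs_def]
  by (intro DERIV_sum DERIV_cmult) (auto intro!: derivative_eq_intros)

lemma iso_gf_derivative_eq:
  "(\<Sum>k\<le>Suc n. of_real (iso_prob (Suc n) p k) * (of_nat k * z ^ (k - 1))) =
   of_real (iso_mean (Suc n) p) * iso_gf n p z"
  using DERIV_unique[OF iso_gf_has_field_derivative' iso_gf_has_field_derivative]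
  by (simp add: iso_mean_Suc)

lemma expectation_iso: "(\<Sum>k\<le>n. iso_prob n p k * real k) = iso_mean n p"
proof (cases n)
  case (Suc m)
  have "complex_of_real (\<Sum>k\<le>n. iso_prob n p k * real k) = of_real (iso_mean n p)"
    using iso_gf_derivative_eq[of m p 1] by (simp add: Suc del: sum.atMost_Suc)
  then show ?thesis
    by (simp only: of_real_eq_iff)
qed simp

text \<open>The derivative of the generating function is again a generating function, on one vertex
  less, so the second derivative at 1 is a product of two means.\<close>

lemma expectation_iso_falling:
  "(\<Sum>k\<le>n. iso_prob n p k * (real k * (real k - 1))) = iso_mean n p * iso_mean (n - 1) p"
proof (cases n)
  case (Suc m)
  have "((\<lambda>z :: complex. \<Sum>k\<le>n. of_real (iso_prob n p k) * (of_nat k * z ^ (k - 1))) has_field_derivative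
     (\<Sum>k\<le>n. of_real (iso_prob n p k) * (of_nat k * (of_nat (k - 1) * 1 ^ (k - 1 - 1))))) (at 1)"
    by (intro DERIV_sum DERIV_cmult) (auto intro!: derivative_eq_intros)
  moreover have "((\<lambda>z :: complex. \<Sum>k\<le>n. of_real (iso_prob n p k) * (of_nat k * z ^ (k - 1))) has_field_derivative
      of_real (iso_mean n p) * (\<Sum>k\<le>m. of_real (iso_prob m p k) * (of_nat k * 1 ^ (k - 1)))) (at 1)"
    unfolding Suc iso_gf_derivative_eq by (rule DERIV_cmult[OF iso_gf_has_field_derivative'])
  ultimately have "(\<Sum>k\<le>n. of_real (iso_prob n p k) * (of_nat k * (of_nat (k - 1) * 1 ^ (k - 1 - 1)))) =
      complex_of_real (iso_mean n p) * (\<Sum>k\<le>m. of_real (iso_prob m p k) * (of_nat k * 1 ^ (k - 1)))"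
    by (rule DERIV_unique)
  then have "complex_of_real (\<Sum>k\<le>n. iso_prob n p k * (real k * real (k - 1))) =
      of_real (iso_mean n p * (\<Sum>k\<le>m. iso_prob m p k * real k))"
    by (simp del: of_nat_diff)
  then have "(\<Sum>k\<le>n. iso_prob n p k * (real k * real (k - 1))) = iso_mean n p * iso_mean m p"
    by (simp only: of_real_eq_iff expectation_iso)
  moreover have "real k * real (k - 1) = real k * (real k - 1)" for k
    by (cases k) auto
  ultimately show ?thesis
    by (simp only: Suc diff_Suc_1)
qed simp

lemma W_mean_eq: "W_mean n p = iso_mean n p"
  using expectation_num_isolated[of n p "\<lambda>k. real k"] expectation_iso[of n p]
  by (simp add: W_mean_def mult.commute)

lemma W_var_eq_sum: "W_var n p = (\<Sum>k\<le>n. iso_prob n p k * (real k - iso_mean n p)\<^sup>2)"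
  using expectation_num_isolated[of n p "\<lambda>k. (real k - iso_mean n p)\<^sup>2"]
  by (simp add: W_var_def W_mean_eq mult.commute)

lemma second_moment_iso: "(\<Sum>k\<le>n. iso_prob n p k * (real k)\<^sup>2) = W_var n p + (iso_mean n p)\<^sup>2"
proof -
  have "W_var n p = (\<Sum>k\<le>n. iso_prob n p k * (real k)\<^sup>2 - 2 * iso_mean n p * (iso_prob n p k * real k) +
      (iso_mean n p)\<^sup>2 * iso_prob n p k)"
    unfolding W_var_eq_sum by (intro sum.cong refl) (simp add: power2_eq_square algebra_simps)
  also have "\<dots> = (\<Sum>k\<le>n. iso_prob n p k * (real k)\<^sup>2) - 2 * iso_mean n p * iso_mean n p + (iso_mean n p)\<^sup>2"
    by (simp only: sum.distrib sum_subtractf sum_distrib_left[symmetric] expectation_iso sum_iso_prob)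
  finally show ?thesis
    by (simp add: power2_eq_square)
qed

text \<open>The variance is put in this form because the second factor is exactly the first-order
  coefficient that the two recursions produce in \<open>iso_chf_ode\<close>.\<close>

lemma W_var_Suc:
  "W_var (Suc n) p = iso_mean (Suc n) p * (1 - (1 - p) ^ n + p * iso_mean n p)"
proof -
  have "(\<Sum>k\<le>Suc n. iso_prob (Suc n) p k * (real k)\<^sup>2) =
      (\<Sum>k\<le>Suc n. iso_prob (Suc n) p k * (real k * (real k - 1)) + iso_prob (Suc n) p k * real k)"
    by (intro sum.cong refl) (simp add: power2_eq_square algebra_simps)
  also have "\<dots> = iso_mean (Suc n) p * iso_mean n p + iso_mean (Suc n) p"
    by (simp only: sum.distrib expectation_iso expectation_iso_falling) simp
  finally have "W_var (Suc n) p = iso_mean (Suc n) p * (1 + iso_mean n p - iso_mean (Suc n) p)"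
    unfolding second_moment_iso by (simp add: power2_eq_square algebra_simps)
  also have "iso_mean n p - iso_mean (Suc n) p = p * iso_mean n p - (1 - p) ^ n"
    by (cases n) (auto simp: iso_mean_def algebra_simps)
  then have "1 + iso_mean n p - iso_mean (Suc n) p = 1 - (1 - p) ^ n + p * iso_mean n p"
    by simp
  finally show ?thesis .
qed

lemma W_var_0 [simp]: "W_var 0 p = 0"
  by (simp add: W_var_eq_sum)

lemma W_var_nonneg: "0 \<le> p \<Longrightarrow> p \<le> 1 \<Longrightarrow> 0 \<le> W_var n p"
  unfolding W_var_eq_sum by (intro sum_nonneg) (simp add: iso_prob_nonneg)

lemma iso_mean_nonneg: "p \<le> 1 \<Longrightarrow> 0 \<le> iso_mean n p"
  by (simp add: iso_mean_def)

text \<open>The left side is the probability that a binomial variable with parameters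
  \<open>n\<close> and \<open>p\<close> equals 1. The induction bounds it by the probability that
  the variable is positive.\<close>

lemma p_iso_mean_le_1:
  assumes "0 \<le> p" "p \<le> 1"
  shows "p * iso_mean n p \<le> 1"
proof -
  have "p * (real n * (1 - p) ^ (n - 1)) \<le> 1 - (1 - p) ^ n"
  proof (induction n)
    case (Suc n)
    have "p * (real (Suc n) * (1 - p) ^ n) = (1 - p) * (p * (real n * (1 - p) ^ (n - 1))) + p * (1 - p) ^ n"
      by (cases n) (simp_all add: algebra_simps)
    also have "\<dots> \<le> (1 - p) * (1 - (1 - p) ^ n) + p * 1"
      using assms by (intro add_mono mult_left_mono Suc power_le_one) auto
    also have "\<dots> = 1 - (1 - p) ^ Suc n"
      by (simp add: algebra_simps)
    finally show ?case
      by simp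
  qed simp
  then show ?thesis
    using assms unfolding iso_mean_def by (smt (verit) zero_le_power)
qed

text \<open>The recursions relate \<open>n\<close> and \<open>Suc n\<close> vertices, so the error
  terms contain the variance for \<open>n\<close>. As \<open>p \<le> 1 / 2\<close>, one factor
  \<open>1 - p\<close> more costs at most 2; this is paid once in the mean and once in the second
  factor.\<close>

lemma W_var_le_Suc:
  assumes "0 \<le> p" "p \<le> 1 / 2"
  shows "W_var n p \<le> 4 * W_var (Suc n) p"
proof (cases n)
  case 0
  then show ?thesis
    using W_var_nonneg[of p 1] assms by simp
next
  case (Suc k)
  have half: "x \<le> 2 * ((1 - p) * x)" if "0 \<le> x" for x
    using mult_right_mono[of 1 "2 * (1 - p)" x] assms that by (simp add: algebra_simps)
  have a: "iso_mean n p \<le> 2 * iso_mean (Suc n) p"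
  proof -
    have "real (Suc k) * (1 - p) ^ k \<le> real (Suc (Suc k)) * (1 - p) ^ k"
      using assms by (intro mult_right_mono) auto
    also have "\<dots> \<le> 2 * ((1 - p) * (real (Suc (Suc k)) * (1 - p) ^ k))"
      using assms by (intro half) auto
    finally show ?thesis
      by (simp add: Suc iso_mean_Suc mult_ac)
  qed
  have b: "iso_mean k p \<le> 2 * iso_mean n p"
  proof (cases k)
    case 0
    then show ?thesis
      using iso_mean_nonneg[of p n] assms by simp
  next
    case (Suc l)
    have "real (Suc l) * (1 - p) ^ l \<le> real (Suc (Suc l)) * (1 - p) ^ l"
      using assms by (intro mult_right_mono) auto
    also have "\<dots> \<le> 2 * ((1 - p) * (real (Suc (Suc l)) * (1 - p) ^ l))"
      using assms by (intro half) auto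
    finally show ?thesis
      by (simp add: Suc \<open>n = Suc k\<close> iso_mean_Suc mult_ac)
  qed
  have c: "(1 - p) ^ n \<le> (1 - p) ^ k" "(1 - p) ^ k \<le> 1" "(1 - p) ^ n \<le> 1"
    using assms power_le_one[of "1 - p"] Suc by (auto intro!: power_decreasing simp del: power_Suc)
  have d: "p * iso_mean k p \<le> p * (2 * iso_mean n p)" "0 \<le> p * iso_mean k p"
    using b assms iso_mean_nonneg[of p] by (auto intro!: mult_left_mono)
  have e: "0 \<le> 1 - (1 - p) ^ k + p * iso_mean k p"
    using c d by linarith
  have "W_var n p = iso_mean n p * (1 - (1 - p) ^ k + p * iso_mean k p)"
    unfolding Suc by (rule W_var_Suc)
  also have "\<dots> \<le> (2 * iso_mean (Suc n) p) * (2 * (1 - (1 - p) ^ n + p * iso_mean n p))"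
    using a c d assms iso_mean_nonneg[of p] by (intro mult_mono e) (auto simp: algebra_simps)
  finally show ?thesis
    by (simp add: W_var_Suc algebra_simps)
qed

section \<open>The approximate Gaussian equation for W\<close>

text \<open>Since \<open>1 + e\<close> lies in the unit disc, its powers do not grow and the Taylor
  errors are polynomial in \<open>k\<close>. Averaging over \<open>k = W\<close> then turns them
  into first and second moments.\<close>

lemma norm_one_plus_power_le:
  fixes e :: complex
  assumes "norm (1 + e) \<le> 1"
  shows "norm ((1 + e) ^ k - 1) \<le> real k * norm e"
    and "norm ((1 + e) ^ k - 1 - of_nat k * e) \<le> (real k)\<^sup>2 / 2 * (norm e)\<^sup>2"
proof -
  have A: "norm ((1 + e) ^ k - 1) \<le> real k * norm e" for k
  proof (induction k)
    case (Suc k)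
    have "(1 + e) ^ Suc k - 1 = (1 + e) * ((1 + e) ^ k - 1) + e"
      by (simp add: algebra_simps)
    also have "norm \<dots> \<le> norm (1 + e) * norm ((1 + e) ^ k - 1) + norm e"
      by (metis norm_mult norm_triangle_ineq)
    also have "\<dots> \<le> 1 * (real k * norm e) + norm e"
      using assms Suc by (intro add_mono mult_mono) auto
    finally show ?case
      by (simp add: algebra_simps)
  qed simp
  show "norm ((1 + e) ^ k - 1) \<le> real k * norm e"
    by (rule A)
  show "norm ((1 + e) ^ k - 1 - of_nat k * e) \<le> (real k)\<^sup>2 / 2 * (norm e)\<^sup>2"
  proof (induction k)
    case (Suc k)
    have "(1 + e) ^ Suc k - 1 - of_nat (Suc k) * e = ((1 + e) ^ k - 1 - of_nat k * e) + e * ((1 + e) ^ k - 1)"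
      by (simp add: algebra_simps)
    also have "norm \<dots> \<le> (real k)\<^sup>2 / 2 * (norm e)\<^sup>2 + norm e * (real k * norm e)"
      using A[of k] Suc unfolding norm_mult[symmetric]
      by (intro order.trans[OF norm_triangle_ineq] add_mono) (auto simp: norm_mult intro: mult_left_mono)
    also have "\<dots> = ((real k)\<^sup>2 + 2 * real k) / 2 * (norm e)\<^sup>2"
      by (simp add: power2_eq_square algebra_simps)
    also have "\<dots> \<le> (real (Suc k))\<^sup>2 / 2 * (norm e)\<^sup>2"
      by (intro mult_right_mono) (auto simp: power2_eq_square algebra_simps)
    finally show ?case .
  qed simp
qed

definition iso_chf :: "nat \<Rightarrow> real \<Rightarrow> real \<Rightarrow> complex" where
  "iso_chf n p t = iso_gf n p (cis t)"

lemma iso_chf_eq_sum: "iso_chf n p t = (\<Sum>k\<le>n. of_real (iso_prob n p k) * cis (real k * t))"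
  by (simp add: iso_chf_def iso_gf_def Complex.DeMoivre)

lemma norm_iso_sum_le:
  assumes "0 \<le> p" "p \<le> 1" "\<And>k. k \<le> n \<Longrightarrow> norm (f k :: complex) \<le> g k"
  shows "norm (\<Sum>k\<le>n. of_real (iso_prob n p k) * f k) \<le> (\<Sum>k\<le>n. iso_prob n p k * g k)"
proof (rule sum_norm_le)
  fix k assume "k \<in> {..n}"
  then show "norm (of_real (iso_prob n p k) * f k) \<le> iso_prob n p k * g k"
    using assms iso_prob_nonneg[of p n k] by (auto simp: norm_mult intro!: mult_left_mono)
qed

lemma norm_iso_chf_le_1:
  assumes "0 \<le> p" "p \<le> 1"
  shows "norm (iso_chf n p t) \<le> 1"
  using norm_iso_sum_le[OF assms, of n "\<lambda>k. cis (real k * t)" "\<lambda>_. 1"]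
  by (simp add: iso_chf_eq_sum sum_iso_prob)

lemma iso_chf_has_vector_derivative:
  "(iso_chf (Suc n) p has_vector_derivative
     \<i> * of_real (iso_mean (Suc n) p) * (cis t * iso_chf n p t)) (at t)"
proof -
  have "(cis has_vector_derivative (\<i> * cis t)) (at t)"
    using has_derivative_cis[of "\<lambda>x. x" "\<lambda>x. x" t UNIV] by (simp add: has_vector_derivative_def)
  then have "((iso_gf (Suc n) p \<circ> cis) has_vector_derivative
      (\<i> * cis t) * (of_nat (Suc n) * of_real ((1 - p) ^ n) * iso_gf n p (cis t))) (at t)"
    by (rule field_vector_diff_chain_at) (rule iso_gf_has_field_derivative)
  then show ?thesis
    by (simp add: iso_chf_def[abs_def] comp_def iso_mean_Suc mult_ac)
qed

text \<open>The difference is the covariance of \<open>W\<close> and \<open>cis (W * t)\<close>. As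
  \<open>W - m\<close> has mean zero, \<open>cis (m * t)\<close> may be subtracted from the second
  factor, and the Lipschitz bound \<open>\<bar>t\<bar> * \<bar>W - m\<bar>\<close> completes a
  square.\<close>

lemma iso_mean_deviation:
  assumes "0 \<le> p" "p \<le> 1"
  shows "norm ((\<Sum>k\<le>n. of_real (iso_prob n p k) * (of_nat k * cis (real k * t))) - of_real (iso_mean n p) * iso_chf n p t)
     \<le> \<bar>t\<bar> * W_var n p"
proof -
  let ?m = "iso_mean n p"
  have z: "(\<Sum>k\<le>n. complex_of_real (iso_prob n p k) * of_real (real k - ?m)) = 0"
  proof -
    have "(\<Sum>k\<le>n. iso_prob n p k * (real k - ?m)) = ?m - (\<Sum>k\<le>n. iso_prob n p k) * ?m"
      by (simp only: right_diff_distrib sum_subtractf expectation_iso sum_distrib_right)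
    then have "(\<Sum>k\<le>n. iso_prob n p k * (real k - ?m)) = 0"
      by (simp add: sum_iso_prob)
    then have "complex_of_real (\<Sum>k\<le>n. iso_prob n p k * (real k - ?m)) = 0"
      by simp
    then show ?thesis
      by (simp only: of_real_sum of_real_mult)
  qed
  have "(\<Sum>k\<le>n. of_real (iso_prob n p k) * (of_nat k * cis (real k * t))) - of_real ?m * iso_chf n p t =
      (\<Sum>k\<le>n. of_real (iso_prob n p k) * (of_real (real k - ?m) * cis (real k * t)))"
    unfolding iso_chf_eq_sum sum_distrib_left sum_subtractf[symmetric]
    by (intro sum.cong refl) (simp add: algebra_simps)
  also have "\<dots> = (\<Sum>k\<le>n. of_real (iso_prob n p k) * (of_real (real k - ?m) * cis (real k * t)))
      - cis (?m * t) * (\<Sum>k\<le>n. of_real (iso_prob n p k) * of_real (real k - ?m))"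
    by (simp only: z mult_zero_right diff_zero)
  also have "\<dots> = (\<Sum>k\<le>n. of_real (iso_prob n p k) * (of_real (real k - ?m) * (cis (real k * t) - cis (?m * t))))"
    unfolding sum_distrib_left sum_subtractf[symmetric]
    by (intro sum.cong refl) (simp add: algebra_simps)
  also have "norm \<dots> \<le> (\<Sum>k\<le>n. iso_prob n p k * (\<bar>t\<bar> * (real k - ?m)\<^sup>2))"
  proof (rule norm_iso_sum_le[OF assms])
    fix k assume "k \<le> n"
    have "cis (real k * t) - cis (?m * t) = cis (?m * t) * (cis ((real k - ?m) * t) - 1)"
      by (simp add: cis_mult algebra_simps)
    then have "norm (cis (real k * t) - cis (?m * t)) \<le> \<bar>(real k - ?m) * t\<bar>"
      using norm_cis_minus_1 by (simp add: norm_mult)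
    then have "norm (of_real (real k - ?m) * (cis (real k * t) - cis (?m * t))) \<le>
        \<bar>real k - ?m\<bar> * \<bar>(real k - ?m) * t\<bar>"
      unfolding norm_mult norm_of_real by (rule mult_left_mono) auto
    also have "\<dots> = \<bar>t\<bar> * (real k - ?m)\<^sup>2"
      by (simp add: abs_mult power2_eq_square)
    finally show "norm (of_real (real k - ?m) * (cis (real k * t) - cis (?m * t))) \<le> \<bar>t\<bar> * (real k - ?m)\<^sup>2" .
  qed
  also have "\<dots> = \<bar>t\<bar> * W_var n p"
    by (simp add: W_var_eq_sum sum_distrib_left mult_ac)
  finally show ?thesis .
qed

text \<open>Let \<open>f0\<close> and \<open>f\<close> belong to \<open>n\<close> and
  \<open>Suc n\<close> vertices. The derivative of \<open>f\<close> is
  \<open>\<i> * m * z * f0\<close>, while the recursion says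
  \<open>f = f0 * (1 + \<i> * t * (Q - p * m'))\<close> to first order. So \<open>z * f0\<close> is
  \<open>(1 + \<i> * t * (1 - Q + p * m')) * f\<close> to first order, and
  \<open>m * (1 - Q + p * m')\<close> is the variance. The second-order terms must stay proportional
  to the variance even after multiplication by \<open>m\<close>.\<close>

lemma iso_chf_ode:
  fixes n :: nat and p t :: real
  assumes p: "0 \<le> p" "p \<le> 1 / 2"
  defines "V \<equiv> W_var (Suc n) p" and "m \<equiv> iso_mean (Suc n) p"
  shows "norm (\<i> * of_real m * (cis t * iso_chf n p t) -
      (\<i> * of_real m - of_real (V * t)) * iso_chf (Suc n) p t) \<le> 9 * V * t\<^sup>2"
proof -
  define w where "w = iso_prob n p"
  define m' where "m' = iso_mean n p"
  define V' where "V' = W_var n p"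
  define Q where "Q = (1 - p) ^ n"
  define z where "z = cis t"
  define e where "e = of_real p * (cis (-t) - 1)"
  define f0 where "f0 = iso_chf n p t"
  define f where "f = iso_chf (Suc n) p t"
  define D where "D = (\<Sum>k\<le>n. of_real (w k) * (z ^ k * ((1 + e) ^ k - 1)))"
  define M where "M = (\<Sum>k\<le>n. of_real (w k) * (of_nat k * z ^ k))"
  have p1: "p \<le> 1"
    using p by simp
  have tt: "\<bar>t\<bar> * (\<bar>t\<bar> * x) = t * (t * x)" for x
    by (simp add: mult.assoc[symmetric])
  have Q: "0 \<le> Q" "Q \<le> 1"
    using p by (auto simp: Q_def power_le_one)
  have m': "0 \<le> m'" "p * m' \<le> 1"
    using p iso_mean_nonneg p_iso_mean_le_1 by (auto simp: m'_def)
  have m: "0 \<le> m" "p * m \<le> 1"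
    using p iso_mean_nonneg p_iso_mean_le_1 by (auto simp: m_def)
  have V': "0 \<le> V'" "V' \<le> 4 * V"
    using p W_var_nonneg W_var_le_Suc by (auto simp: V'_def V_def)
  have V: "V = m * (1 - Q + p * m')"
    by (simp add: V_def m_def Q_def m'_def W_var_Suc)
  have nz: "norm z = 1"
    by (simp add: z_def)
  have ne: "norm e \<le> p * \<bar>t\<bar>"
    using norm_cis_minus_1[of "-t"] p by (auto simp: e_def norm_mult intro!: mult_left_mono)
  have "1 + e = of_real (1 - p) + of_real p * cis (-t)"
    by (simp add: e_def algebra_simps)
  also have "norm \<dots> \<le> norm (complex_of_real (1 - p)) + norm (of_real p * cis (-t))"
    by (rule norm_triangle_ineq)
  also have "\<dots> = 1"
    unfolding norm_mult norm_of_real norm_cis using p by simp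
  finally have n1e: "norm (1 + e) \<le> 1" .
  have z1e: "of_real p + of_real (1 - p) * z = z * (1 + e)"
    by (simp add: e_def z_def algebra_simps cis_mult)
  have f0_sum: "f0 = (\<Sum>k\<le>n. of_real (w k) * z ^ k)"
    by (simp add: f0_def iso_chf_def iso_gf_def z_def w_def)
  have "f = iso_gf n p (z * (1 + e)) + of_real Q * (z - 1) * f0"
    unfolding f_def f0_def iso_chf_def iso_gf_Suc Q_def z1e[symmetric] by (simp add: z_def)
  also have "iso_gf n p (z * (1 + e)) = D + f0"
    unfolding iso_gf_def D_def f0_sum sum.distrib[symmetric] w_def
    by (intro sum.cong refl) (simp only: power_mult_distrib right_diff_distrib mult_1_right diff_add_cancel)
  finally have f_eq: "f = D + f0 + of_real Q * (z - 1) * f0" .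
  have nf0: "norm f0 \<le> 1"
    using norm_iso_chf_le_1[of p n t] p by (simp add: f0_def)
  have nz1: "norm (z - 1) \<le> \<bar>t\<bar>" "norm (z - 1 - \<i> * of_real t) \<le> t\<^sup>2 / 2"
    using norm_cis_minus_1 norm_cis_minus_1_minus by (auto simp: z_def)
  have nD: "norm D \<le> \<bar>t\<bar>"
  proof -
    have "norm D \<le> (\<Sum>k\<le>n. w k * (real k * (p * \<bar>t\<bar>)))"
      unfolding D_def w_def
    proof (rule norm_iso_sum_le[OF p(1) p1])
      fix k
      have "norm ((1 + e) ^ k - 1) \<le> real k * norm e"
        by (rule norm_one_plus_power_le[OF n1e])
      also have "\<dots> \<le> real k * (p * \<bar>t\<bar>)"
        using ne by (intro mult_left_mono) auto
      finally show "norm (z ^ k * ((1 + e) ^ k - 1)) \<le> real k * (p * \<bar>t\<bar>)"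
        by (simp add: norm_mult norm_power nz)
    qed
    also have "\<dots> = (p * m') * \<bar>t\<bar>"
      unfolding m'_def expectation_iso[symmetric] w_def
      by (simp add: sum_distrib_left sum_distrib_right mult_ac)
    also have "\<dots> \<le> 1 * \<bar>t\<bar>"
      using m' by (intro mult_right_mono) auto
    finally show ?thesis
      by simp
  qed
  have nff0: "norm (f - f0) \<le> 2 * \<bar>t\<bar>"
  proof -
    have "norm (of_real Q * (z - 1) * f0) \<le> 1 * \<bar>t\<bar> * 1"
      unfolding norm_mult using Q nz1 nf0 by (intro mult_mono) auto
    then show ?thesis
      using nD norm_triangle_ineq[of D "of_real Q * (z - 1) * f0"] by (simp add: f_eq)
  qed
  have E1: "norm (D + \<i> * of_real (t * p) * M) \<le> t\<^sup>2 / 2 * (p * m' + p\<^sup>2 * (V' + m'\<^sup>2))"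
  proof -
    have "D + \<i> * of_real (t * p) * M =
        (\<Sum>k\<le>n. of_real (w k) * (z ^ k * ((1 + e) ^ k - 1 + of_nat k * (\<i> * of_real (t * p)))))"
      unfolding D_def M_def sum_distrib_left sum.distrib[symmetric]
      by (intro sum.cong refl) (simp add: algebra_simps)
    also have "norm \<dots> \<le> (\<Sum>k\<le>n. w k * ((real k)\<^sup>2 / 2 * (p * t)\<^sup>2 + real k * (p * (t\<^sup>2 / 2))))"
      unfolding w_def
    proof (rule norm_iso_sum_le[OF p(1) p1])
      fix k
      have e': "e + \<i> * of_real (t * p) = of_real p * (cis (-t) - 1 - \<i> * of_real (-t))"
        by (simp add: e_def algebra_simps)
      have "(1 + e) ^ k - 1 + of_nat k * (\<i> * of_real (t * p)) =
          ((1 + e) ^ k - 1 - of_nat k * e) + of_nat k * (e + \<i> * of_real (t * p))"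
        by (simp add: algebra_simps)
      also have "norm \<dots> \<le> (real k)\<^sup>2 / 2 * (norm e)\<^sup>2 + real k * norm (e + \<i> * of_real (t * p))"
        using norm_one_plus_power_le(2)[OF n1e, of k]
        by (intro order.trans[OF norm_triangle_ineq] add_mono) (auto simp: norm_mult)
      also have "norm (e + \<i> * of_real (t * p)) \<le> p * (t\<^sup>2 / 2)"
        unfolding e' norm_mult using norm_cis_minus_1_minus[of "-t"] p
        by (intro mult_mono) auto
      also have "(norm e)\<^sup>2 \<le> (p * t)\<^sup>2"
        using power_mono[OF ne, of 2] by (simp add: power_mult_distrib)
      finally show "norm (z ^ k * ((1 + e) ^ k - 1 + of_nat k * (\<i> * of_real (t * p)))) \<le>
          (real k)\<^sup>2 / 2 * (p * t)\<^sup>2 + real k * (p * (t\<^sup>2 / 2))"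
        by (simp add: norm_mult norm_power nz mult_left_mono)
    qed
    also have "\<dots> = (p * t)\<^sup>2 / 2 * (\<Sum>k\<le>n. w k * (real k)\<^sup>2) + p * (t\<^sup>2 / 2) * (\<Sum>k\<le>n. w k * real k)"
      unfolding sum_distrib_left sum.distrib[symmetric]
      by (intro sum.cong refl) (simp add: algebra_simps)
    also have "\<dots> = (p * t)\<^sup>2 / 2 * (V' + m'\<^sup>2) + p * (t\<^sup>2 / 2) * m'"
      by (simp add: w_def V'_def m'_def second_moment_iso expectation_iso)
    also have "\<dots> = t\<^sup>2 / 2 * (p * m' + p\<^sup>2 * (V' + m'\<^sup>2))"
      by (simp add: power_mult_distrib algebra_simps)
    finally show ?thesis .
  qed
  have E2: "norm (M - of_real m' * f0) \<le> \<bar>t\<bar> * V'"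
    using iso_mean_deviation[OF p(1) p1, of n t]
    by (simp add: M_def m'_def f0_def V'_def w_def z_def Complex.DeMoivre)
  \<comment> \<open>An exact identity that sorts the second-order terms: linearising
    \<open>D\<close>, replacing \<open>M\<close> by \<open>m' * f0\<close>, replacing
    \<open>f0\<close> by \<open>f\<close> in a first-order term (twice), and the Taylor remainder of
    \<open>z\<close>.\<close>
  have "z * f0 - (1 + \<i> * of_real (t * (1 - Q + p * m'))) * f =
      - (D + \<i> * of_real (t * p) * M) + \<i> * of_real (t * p) * (M - of_real m' * f0)
      - \<i> * of_real (t * (p * m')) * (f - f0)
      + (of_real (1 - Q) * ((z - 1 - \<i> * of_real t) * f0) - of_real (1 - Q) * (\<i> * of_real t * (f - f0)))"
    (is "?lhs = - ?a + ?b - ?c + (?d - ?e)")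
    unfolding f_eq by (simp add: algebra_simps)
  then have "norm ?lhs \<le> norm ?a + norm ?b + norm ?c + (norm ?d + norm ?e)"
    using norm_triangle_ineq[of "- ?a + ?b - ?c" "?d - ?e"] norm_triangle_ineq4[of "- ?a + ?b" ?c]
      norm_triangle_ineq[of "- ?a" ?b] norm_triangle_ineq4[of ?d ?e] by (simp only: norm_minus_cancel)
  also have "norm ?b \<le> \<bar>t * p\<bar> * (\<bar>t\<bar> * V')"
    unfolding norm_mult norm_of_real norm_ii mult_1_left by (intro mult_left_mono E2) auto
  also have "norm ?c \<le> \<bar>t * (p * m')\<bar> * (2 * \<bar>t\<bar>)"
    unfolding norm_mult norm_of_real norm_ii mult_1_left by (intro mult_left_mono nff0) auto
  also have "norm ?d \<le> (1 - Q) * (t\<^sup>2 / 2 * 1)"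
    unfolding norm_mult norm_of_real using Q nz1 nf0 by (intro mult_mono) auto
  also have "norm ?e \<le> (1 - Q) * (\<bar>t\<bar> * (2 * \<bar>t\<bar>))"
    unfolding norm_mult norm_of_real norm_ii using Q nff0 by (intro mult_mono) auto
  also note E1
  also have "t\<^sup>2 / 2 * (p * m' + p\<^sup>2 * (V' + m'\<^sup>2)) + \<bar>t * p\<bar> * (\<bar>t\<bar> * V') + \<bar>t * (p * m')\<bar> * (2 * \<bar>t\<bar>) +
      ((1 - Q) * (t\<^sup>2 / 2 * 1) + (1 - Q) * (\<bar>t\<bar> * (2 * \<bar>t\<bar>))) =
      t\<^sup>2 * (5 / 2 * (1 - Q + p * m') + (p\<^sup>2 * (V' + m'\<^sup>2)) / 2 + p * V')"
    using p m' by (simp add: abs_mult power2_eq_square field_simps tt)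
  finally have main: "norm ?lhs \<le> t\<^sup>2 * (5 / 2 * (1 - Q + p * m') + (p\<^sup>2 * (V' + m'\<^sup>2)) / 2 + p * V')"
    by simp
  have V0: "0 \<le> V"
    using V' by simp
  have pmV: "m * (p * V') \<le> 4 * V"
    using mult_right_mono[OF m(2) V'(1)] V'(2) by (simp add: mult_ac)
  have pV: "m * (p\<^sup>2 * V') \<le> 4 * V"
  proof -
    have "m * (p\<^sup>2 * V') = p * (m * (p * V'))"
      by (simp add: power2_eq_square mult_ac)
    also have "\<dots> \<le> 1 * (m * (p * V'))"
      using p m V' by (intro mult_right_mono) auto
    finally show ?thesis
      using pmV by simp
  qed
  have pmm: "m * (p\<^sup>2 * m'\<^sup>2) \<le> V"
  proof -
    have "m * (p\<^sup>2 * m'\<^sup>2) = (m * (p * m')) * (p * m')"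
      by (simp add: power2_eq_square mult_ac)
    also have "\<dots> \<le> (m * (p * m')) * 1"
      using p m m' by (intro mult_left_mono) auto
    also have "\<dots> \<le> V"
      unfolding V mult_1_right using Q m by (intro mult_left_mono) auto
    finally show ?thesis .
  qed
  have "\<i> * of_real m * (z * f0) - (\<i> * of_real m - of_real (V * t)) * f = \<i> * of_real m * ?lhs"
    unfolding V by (simp add: algebra_simps)
  then have "norm (\<i> * of_real m * (z * f0) - (\<i> * of_real m - of_real (V * t)) * f) = m * norm ?lhs"
    using m by (simp add: norm_mult)
  also have "\<dots> \<le> m * (t\<^sup>2 * (5 / 2 * (1 - Q + p * m') + (p\<^sup>2 * (V' + m'\<^sup>2)) / 2 + p * V'))"
    using main m by (intro mult_left_mono) auto
  also have "\<dots> = t\<^sup>2 * (5 / 2 * V + (m * (p\<^sup>2 * V') + m * (p\<^sup>2 * m'\<^sup>2)) / 2 + m * (p * V'))"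
    unfolding V by (simp add: field_simps)
  also have "\<dots> \<le> t\<^sup>2 * (9 * V)"
  proof (rule mult_left_mono)
    \<comment> \<open>The constant is \<open>5 / 2 + (4 + 1) / 2 + 4\<close>, where each 4 comes
      from comparing the variances for \<open>n\<close> and \<open>Suc n\<close>.\<close>
    show "5 / 2 * V + (m * (p\<^sup>2 * V') + m * (p\<^sup>2 * m'\<^sup>2)) / 2 + m * (p * V') \<le> 9 * V"
      using pmV pV pmm V0 by argo
  qed simp
  finally show ?thesis
    by (simp add: z_def f0_def f_def mult_ac)
qed

text \<open>The integrating factor \<open>exp (V s\<^sup>2 / 2 - \<i> m s)\<close> turns both approximate equations into a
  bound on a derivative; it is largest in modulus at the endpoint, where it cancels.\<close>

lemma ode_compare:
  fixes f g f' g' :: "real \<Rightarrow> complex"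
  assumes f: "\<And>s. (f has_vector_derivative f' s) (at s)"
    and g: "\<And>s. (g has_vector_derivative g' s) (at s)"
    and f_ode: "\<And>s. norm (f' s - (\<i> * of_real m - of_real (V * s)) * f s) \<le> A * s\<^sup>2"
    and g_ode: "\<And>s. norm (g' s - (\<i> * of_real m - of_real (V * s)) * g s) \<le> B * s\<^sup>2 + \<bar>s\<bar>"
    and 0: "f 0 = g 0" and V: "V \<ge> 0" "A \<ge> 0" "B \<ge> 0"
  shows "norm (f t - g t) \<le> \<bar>t\<bar> * ((A + B) * t\<^sup>2 + \<bar>t\<bar>)"
proof -
  define E where "E s = exp (of_real (V * s\<^sup>2 / 2) - \<i> * of_real (m * s))" for s
  define H where "H s = (f s - g s) * E s" for s
  define H' where "H' s = (f' s - (\<i> * of_real m - of_real (V * s)) * f s -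
      (g' s - (\<i> * of_real m - of_real (V * s)) * g s)) * E s" for s
  define R where "R = ((A + B) * t\<^sup>2 + \<bar>t\<bar>) * exp (V * t\<^sup>2 / 2)"
  have normE: "norm (E s) = exp (V * s\<^sup>2 / 2)" for s
    by (simp add: E_def)
  have "((\<lambda>s. of_real (V * s\<^sup>2 / 2) - \<i> * of_real (m * s)) has_vector_derivative
      of_real (V * s) - \<i> * of_real m) (at s)" for s
  proof (intro has_vector_derivative_diff)
    show "((\<lambda>s. complex_of_real (V * s\<^sup>2 / 2)) has_vector_derivative of_real (V * s)) (at s)"
      by (rule has_vector_derivative_of_real) (auto intro!: derivative_eq_intros)
    show "((\<lambda>s. \<i> * complex_of_real (m * s)) has_vector_derivative \<i> * of_real m) (at s)"
      by (intro has_vector_derivative_mult_right has_vector_derivative_of_real) (auto intro!: derivative_eq_intros)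
  qed
  from field_vector_diff_chain_at[OF this DERIV_exp]
  have E: "(E has_vector_derivative (of_real (V * s) - \<i> * of_real m) * E s) (at s)" for s
    by (simp only: comp_def E_def[abs_def])
  have H: "(H has_vector_derivative H' s) (at s)" for s
    unfolding H_def[abs_def] H'_def
    by (rule has_vector_derivative_eq_rhs[OF has_vector_derivative_mult[OF has_vector_derivative_diff[OF f g] E]])
       (simp add: algebra_simps)
  have H'_le: "norm (H' s) \<le> R" if "\<bar>s\<bar> \<le> \<bar>t\<bar>" for s
  proof -
    have s2: "s\<^sup>2 \<le> t\<^sup>2"
      using that by (simp add: abs_le_square_iff)
    have "norm (f' s - (\<i> * of_real m - of_real (V * s)) * f s - (g' s - (\<i> * of_real m - of_real (V * s)) * g s))
        \<le> A * s\<^sup>2 + (B * s\<^sup>2 + \<bar>s\<bar>)"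
      by (rule order.trans[OF norm_triangle_ineq4 add_mono[OF f_ode g_ode]])
    also have "\<dots> \<le> A * t\<^sup>2 + (B * t\<^sup>2 + \<bar>t\<bar>)"
      using V s2 that by (intro add_mono mult_left_mono) auto
    finally show ?thesis
      unfolding H'_def R_def norm_mult normE using V s2
      by (intro mult_mono) (auto simp: algebra_simps intro!: mult_left_mono)
  qed
  have "norm (H t - H 0) \<le> R * norm (t - 0)"
  proof (rule differentiable_bound[where S = "{-\<bar>t\<bar>..\<bar>t\<bar>}" and f' = "\<lambda>s h. h *\<^sub>R H' s"])
    fix s assume "s \<in> {-\<bar>t\<bar>..\<bar>t\<bar>}"
    then have s: "\<bar>s\<bar> \<le> \<bar>t\<bar>"
      by auto
    show "(H has_derivative (\<lambda>h. h *\<^sub>R H' s)) (at s within {-\<bar>t\<bar>..\<bar>t\<bar>})"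
      using H[of s] unfolding has_vector_derivative_def by (rule has_derivative_at_withinI)
    show "onorm (\<lambda>h. h *\<^sub>R H' s) \<le> R"
      using H'_le[OF s] onorm_scaleR_left[OF bounded_linear_ident, of "H' s"] by (simp add: onorm_id)
  qed auto
  moreover have "norm (H t - H 0) = norm (f t - g t) * exp (V * t\<^sup>2 / 2)"
    using 0 by (simp add: H_def norm_mult normE)
  ultimately have "norm (f t - g t) * exp (V * t\<^sup>2 / 2) \<le> (\<bar>t\<bar> * ((A + B) * t\<^sup>2 + \<bar>t\<bar>)) * exp (V * t\<^sup>2 / 2)"
    by (simp add: R_def mult_ac)
  then show ?thesis
    by simp
qed

section \<open>Comparison with the translated Poisson law\<close>

definition TP_chf :: "real \<Rightarrow> real \<Rightarrow> real \<Rightarrow> complex" where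
  "TP_chf m V t = (let a = \<lfloor>m - V\<rfloor>; g = m - V - of_int a in
     cis (of_int a * t) * exp (of_real (V + g) * (cis t - 1)))"

lemma iso_chf_near_TP:
  fixes n :: nat and p t :: real
  assumes p: "0 \<le> p" "p \<le> 1 / 2" and V1: "W_var (Suc n) p \<ge> 1"
  defines "V \<equiv> W_var (Suc n) p" and "m \<equiv> iso_mean (Suc n) p"
  shows "norm (iso_chf (Suc n) p t - TP_chf m V t) \<le> t\<^sup>2 + 10 * V * \<bar>t\<bar> ^ 3"
proof -
  define a where "a = real_of_int \<lfloor>m - V\<rfloor>"
  define l where "l = V + (m - V - a)"
  define g where "g t = cis (a * t) * exp (of_real l * (cis t - 1))" for t
  have g: "TP_chf m V = g"
    by (simp add: TP_chf_def g_def Let_def a_def l_def fun_eq_iff)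
  have V1: "V \<ge> 1"
    using V1 by (simp add: V_def)
  have l: "V \<le> l" "l \<le> V + 1" and al: "a + l = m"
    unfolding l_def a_def by linarith+
  have cis_deriv: "((\<lambda>t. cis (c * t)) has_vector_derivative (\<i> * of_real c * cis (c * t))) (at t)" for c t
    using has_derivative_cis[of "\<lambda>x. c * x" "\<lambda>x. c * x" t UNIV]
    by (auto simp: has_vector_derivative_def scaleR_conv_of_real mult_ac intro!: derivative_eq_intros)
  have exp_deriv: "((\<lambda>t. exp (of_real l * (cis t - 1))) has_vector_derivative
      (of_real l * (\<i> * cis t)) * exp (of_real l * (cis t - 1))) (at t)" for t
  proof -
    have "((\<lambda>t. of_real l * (cis t - 1)) has_vector_derivative of_real l * (\<i> * cis t)) (at t)"
      using cis_deriv[of 1 t] by (auto intro!: derivative_eq_intros)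
    from field_vector_diff_chain_at[OF this DERIV_exp] show ?thesis
      by (simp add: comp_def)
  qed
  have g': "(g has_vector_derivative (\<i> * of_real a + of_real l * (\<i> * cis t)) * g t) (at t)" for t
    unfolding g_def[abs_def]
    by (rule has_vector_derivative_eq_rhs[OF has_vector_derivative_mult[OF cis_deriv exp_deriv]])
       (simp add: algebra_simps)
  have norm_g: "norm (g s) \<le> 1" for s
  proof -
    have "norm (g s) = exp (l * (cos s - 1))"
      by (simp add: g_def norm_mult)
    also have "\<dots> \<le> 1"
      using l V1 by (simp add: mult_nonneg_nonpos)
    finally show ?thesis .
  qed
  have g_ode: "norm ((\<i> * of_real a + of_real l * (\<i> * cis s)) * g s - (\<i> * of_real m - of_real (V * s)) * g s)
      \<le> V * s\<^sup>2 + \<bar>s\<bar>" for s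
  proof -
    have "(\<i> * of_real a + of_real l * (\<i> * cis s)) * g s - (\<i> * of_real m - of_real (V * s)) * g s =
        (\<i> * of_real l * (cis s - 1 - \<i> * of_real s) + of_real ((V - l) * s)) * g s"
      unfolding al[symmetric] by (simp add: algebra_simps)
    also have "norm \<dots> \<le> (norm (\<i> * of_real l * (cis s - 1 - \<i> * of_real s)) + norm (complex_of_real ((V - l) * s))) * 1"
      unfolding norm_mult[of _ "g s"] using norm_g by (intro mult_mono norm_triangle_ineq) auto
    also have "norm (\<i> * of_real l * (cis s - 1 - \<i> * of_real s)) \<le> (2 * V) * (s\<^sup>2 / 2)"
    proof -
      have "norm (\<i> * of_real l * (cis s - 1 - \<i> * of_real s)) = l * norm (cis s - 1 - \<i> * of_real s)"
        using l V1 by (simp add: norm_mult)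
      also have "\<dots> \<le> (2 * V) * (s\<^sup>2 / 2)"
        using norm_cis_minus_1_minus[of s] l V1 by (intro mult_mono) auto
      finally show ?thesis .
    qed
    also have "norm (complex_of_real ((V - l) * s)) \<le> 1 * \<bar>s\<bar>"
      unfolding norm_of_real abs_mult using l by (intro mult_right_mono) auto
    finally show ?thesis
      by simp
  qed
  have "norm (iso_chf (Suc n) p t - g t) \<le> \<bar>t\<bar> * ((9 * V + V) * t\<^sup>2 + \<bar>t\<bar>)"
  proof (rule ode_compare[OF iso_chf_has_vector_derivative g' _ g_ode])
    show "norm (\<i> * of_real (iso_mean (Suc n) p) * (cis s * iso_chf n p s) -
        (\<i> * of_real m - of_real (V * s)) * iso_chf (Suc n) p s) \<le> 9 * V * s\<^sup>2" for s
      unfolding V_def m_def by (rule iso_chf_ode[OF p])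
    show "iso_chf (Suc n) p 0 = g 0"
      by (simp add: iso_chf_def g_def)
  qed (use V1 in auto)
  then show ?thesis
    by (simp add: g algebra_simps power2_eq_square power3_eq_cube)
qed

lemma norm_TP_chf_le:
  assumes "V \<ge> 0"
  shows "norm (TP_chf m V t) \<le> exp (- (V * (1 - cos t)))"
proof -
  define l where "l = V + (m - V - of_int \<lfloor>m - V\<rfloor>)"
  have "V \<le> l"
    unfolding l_def by linarith
  then have "V * (1 - cos t) \<le> l * (1 - cos t)"
    by (intro mult_right_mono) auto
  moreover have "norm (TP_chf m V t) = exp (- (l * (1 - cos t)))"
    by (simp add: TP_chf_def Let_def norm_mult l_def algebra_simps)
  ultimately show ?thesis
    by simp
qed

subsection \<open>The Gaussian integral\<close>

lemma normal_density_times_exp: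
  assumes "s > 0"
  shows "normal_density a s u * exp (k * u) = exp (k * a + k\<^sup>2 * s\<^sup>2 / 2) * normal_density (a + k * s\<^sup>2) s u"
proof -
  have "- (u - a)\<^sup>2 / (2 * s\<^sup>2) + k * u = k * a + k\<^sup>2 * s\<^sup>2 / 2 + - (u - (a + k * s\<^sup>2))\<^sup>2 / (2 * s\<^sup>2)"
    using assms by (simp add: field_simps power2_eq_square)
  then show ?thesis
    by (simp add: normal_density_def exp_add[symmetric] mult_ac del: minus_diff_eq)
qed

lemma has_bochner_integral_normal_exp:
  assumes "s > 0"
  shows "has_bochner_integral lborel (\<lambda>u. normal_density a s u * exp (k * u)) (exp (k * a + k\<^sup>2 * s\<^sup>2 / 2))"
proof -
  have "has_bochner_integral lborel (normal_density (a + k * s\<^sup>2) s) 1"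
    using assms by (simp add: has_bochner_integral_iff)
  from has_bochner_integral_mult_right[OF this, of "exp (k * a + k\<^sup>2 * s\<^sup>2 / 2)"] show ?thesis
    unfolding normal_density_times_exp[OF assms] by simp
qed

lemma real_choose_two: "real (k choose 2) = real k * (real k - 1) / 2"
  by (induction k) (simp_all add: numeral_2_eq_2 field_simps)

text \<open>The quadratic coefficient is negative, so \<open>q ^ touch_count n k\<close> has
  exponent \<open>+ k ^ 2 * v / 2\<close> with \<open>v = - ln q\<close>. This is the quadratic term
  of a Gaussian moment generating function with variance \<open>v\<close>.\<close>

lemma real_touch_count:
  "k \<le> n \<Longrightarrow> real (touch_count n k) = real k * (real n - 1 / 2) - (real k)\<^sup>2 / 2"
  by (simp add: touch_count_def real_choose_two of_nat_diff power2_eq_square field_simps)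

text \<open>Formally, \<open>W\<close> is a mixture of binomial distributions with lognormal success
  parameter \<open>exp u\<close>, which may exceed 1.\<close>

lemma fact_gf_gaussian:
  fixes n :: nat and p :: real
  assumes p: "0 < p" "p < 1"
  defines "v \<equiv> - ln (1 - p)"
  shows "has_bochner_integral lborel
    (\<lambda>u. of_real (normal_density (- ((real n - 1 / 2) * v)) (sqrt v) u) * (1 + y * of_real (exp u)) ^ n)
    (fact_gf n (1 - p) y)"
proof -
  define \<rho> where "\<rho> = normal_density (- ((real n - 1 / 2) * v)) (sqrt v)"
  have v: "v > 0"
    using p by (simp add: v_def)
  have q: "1 - p = exp (- v)"
    using p by (simp add: v_def)
  have mom: "has_bochner_integral lborel (\<lambda>u. \<rho> u * exp (real k * u)) ((1 - p) ^ touch_count n k)" if "k \<le> n" for k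
  proof -
    have "(1 - p) ^ touch_count n k = exp (real k * (- ((real n - 1 / 2) * v)) + (real k)\<^sup>2 * (sqrt v)\<^sup>2 / 2)"
      unfolding q exp_of_nat_mult[symmetric] using that v
      by (simp add: real_touch_count algebra_simps)
    then show ?thesis
      using has_bochner_integral_normal_exp[of "sqrt v" "- ((real n - 1 / 2) * v)" "real k"] v
      by (simp add: \<rho>_def)
  qed
  have "has_bochner_integral lborel
     (\<lambda>u. \<Sum>k\<le>n. of_nat (n choose k) * y ^ k * complex_of_real (\<rho> u * exp (real k * u)))
     (\<Sum>k\<le>n. of_nat (n choose k) * y ^ k * of_real ((1 - p) ^ touch_count n k))"
    by (intro has_bochner_integral_sum has_bochner_integral_mult_right has_bochner_integral_of_real mom) auto
  moreover have "(\<Sum>k\<le>n. of_nat (n choose k) * y ^ k * complex_of_real (\<rho> u * exp (real k * u))) =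
      of_real (\<rho> u) * (1 + y * of_real (exp u)) ^ n" for u
    unfolding add.commute[of 1] binomial_ring sum_distrib_left
    by (intro sum.cong refl) (simp add: exp_of_nat_mult power_mult_distrib)
  ultimately show ?thesis
    by (simp add: fact_gf_def \<rho>_def mult_ac)
qed

section \<open>Bounds on the integrand\<close>

text \<open>For \<open>x\<close> between 0 and 1 the norm is that of a Bernoulli characteristic
  function. The identity is algebraic, so it also covers \<open>x > 1\<close>, where the right side
  is at least 1.\<close>

lemma norm_mixture_factor:
  "(norm (1 + (cis t - 1) * of_real x))\<^sup>2 = 1 - 2 * (1 - cos t) * x * (1 - x)"
proof -
  have "(norm (1 + (cis t - 1) * of_real x))\<^sup>2 = (1 + (cos t - 1) * x)\<^sup>2 + (sin t)\<^sup>2 * x\<^sup>2"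
    by (simp add: cmod_power2 power_mult_distrib)
  also have "\<dots> = (1 + (cos t - 1) * x)\<^sup>2 + (1 - (cos t)\<^sup>2) * x\<^sup>2"
    by (simp add: sin_squared_eq)
  also have "\<dots> = 1 - 2 * (1 - cos t) * x * (1 - x)"
    by (simp add: power2_eq_square algebra_simps)
  finally show ?thesis .
qed

lemma power_le_exp_of_square_le:
  assumes "y\<^sup>2 \<le> 1 - 2 * w" "0 \<le> (y :: real)"
  shows "y ^ k \<le> exp (- (real k * w))"
proof -
  have "y\<^sup>2 \<le> 1 + - (2 * w)"
    using assms(1) by simp
  also have "\<dots> \<le> exp (- (2 * w))"
    by (rule exp_ge_add_one_self)
  also have "\<dots> = (exp (- w))\<^sup>2"
    using exp_double[of "- w"] by simp
  finally have "y\<^sup>2 \<le> (exp (- w))\<^sup>2" .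
  then have "y \<le> exp (- w)"
    by (rule power2_le_imp_le) simp
  then have "y ^ k \<le> exp (- w) ^ k"
    using assms(2) by (rule power_mono)
  also have "\<dots> = exp (- (real k * w))"
    using exp_of_nat_mult[of k "- w"] by simp
  finally show ?thesis .
qed

lemma mixture_factor_le_1:
  assumes "0 \<le> x" "x \<le> 1"
  shows "norm (1 + (cis t - 1) * of_real x) \<le> 1"
proof -
  have "0 \<le> 2 * (1 - cos t) * x * (1 - x)"
    using assms by (intro mult_nonneg_nonneg) auto
  then have "(norm (1 + (cis t - 1) * of_real x))\<^sup>2 \<le> 1\<^sup>2"
    unfolding norm_mixture_factor by simp
  then show ?thesis
    by (rule power2_le_imp_le) auto
qed

lemma mixture_factor_power_le:
  assumes "0 \<le> x" "x \<le> 1" "w \<le> x * (1 - x)"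
  shows "norm (1 + (cis t - 1) * of_real x) ^ n \<le> exp (- (real n * ((1 - cos t) * w)))"
proof (rule power_le_exp_of_square_le)
  have "2 * (1 - cos t) * w \<le> 2 * (1 - cos t) * (x * (1 - x))"
    using assms by (intro mult_left_mono) auto
  then show "(norm (1 + (cis t - 1) * of_real x))\<^sup>2 \<le> 1 - 2 * ((1 - cos t) * w)"
    unfolding norm_mixture_factor by (simp only: mult.assoc)
qed auto

text \<open>For a success parameter \<open>1 / x > 1\<close>, the factor \<open>x ^ (2 * n - 1)\<close> comes from reflecting the
  Gaussian density at the origin, see \<open>normal_density_reflect\<close>.\<close>

lemma reflected_mixture_factor:
  fixes x t :: real
  assumes x: "0 < x" "x \<le> 1"
  defines "Y \<equiv> norm (1 + (cis t - 1) * of_real (1 / x)) * x\<^sup>2"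
  shows "Y\<^sup>2 \<le> 1 - ((1 - x)\<^sup>2 + 2 * (1 + cos t) * x\<^sup>2 * (1 - x))"
    and "Y \<le> 2 * x"
proof -
  define c where "c = cos t"
  have c: "0 \<le> 1 + c"
    using cos_ge_minus_one[of t] unfolding c_def by linarith
  have "(1 / x) * (1 - 1 / x) * x\<^sup>2 = x - 1"
    using x by (simp add: power2_eq_square right_diff_distrib left_diff_distrib)
  then have "(1 - 2 * (1 - c) * (1 / x) * (1 - 1 / x)) * x\<^sup>2 = x\<^sup>2 - 2 * (1 - c) * (x - 1)"
    by (simp only: left_diff_distrib mult_1_left mult.assoc)
  then have "Y\<^sup>2 = (x\<^sup>2 - 2 * (1 - c) * (x - 1)) * x\<^sup>2"
    unfolding Y_def power_mult_distrib norm_mixture_factor c_def[symmetric]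
    by (simp only: power2_eq_square mult.assoc[symmetric])
  \<comment> \<open>Regrouped so that \<open>1 + cos t\<close> appears: at \<open>t = pi\<close>
    only \<open>x * (2 - x) = 1 - (1 - x) ^ 2\<close> is left, and its distance from 1 is of second
    order in \<open>1 - x\<close>.\<close>
  also have "\<dots> = (x * (2 - x))\<^sup>2 - 2 * (1 + c) * x\<^sup>2 * (1 - x)"
    by (simp add: power2_eq_square algebra_simps)
  finally have Y: "Y\<^sup>2 = (x * (2 - x))\<^sup>2 - 2 * (1 + c) * x\<^sup>2 * (1 - x)" .
  have eq: "x * (2 - x) = 1 - (1 - x)\<^sup>2"
    by (simp add: power2_eq_square algebra_simps)
  have "(1 - x)\<^sup>2 \<le> 1"
    using x by (simp add: power_le_one)
  then have x2: "0 \<le> x * (2 - x)" "x * (2 - x) \<le> 1"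
    unfolding eq by simp_all
  have "(x * (2 - x))\<^sup>2 \<le> x * (2 - x)"
    using mult_left_mono[OF x2(2) x2(1)] by (simp only: power2_eq_square mult_1_right)
  then show "Y\<^sup>2 \<le> 1 - ((1 - x)\<^sup>2 + 2 * (1 + cos t) * x\<^sup>2 * (1 - x))"
    using Y eq unfolding c_def by linarith
  have "0 \<le> 2 * (1 + c) * x\<^sup>2 * (1 - x)"
    using x c by (intro mult_nonneg_nonneg) auto
  then have "Y\<^sup>2 \<le> (x * (2 - x))\<^sup>2"
    using Y by linarith
  then have "Y \<le> x * (2 - x)"
    using x2(1) by (rule power2_le_imp_le)
  also have "\<dots> \<le> x * 2"
    using x by (intro mult_left_mono) auto
  finally show "Y \<le> 2 * x"
    by simp
qed

text \<open>The available power \<open>x ^ (2 * n - 1)\<close> is one short of turning every factor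
  into \<open>Y\<close>. So one factor appears as \<open>Y / x\<close>, which is at most 2, and only
  \<open>n - 1\<close> factors contribute decay.\<close>

lemma reflected_mixture_power_le:
  fixes x t :: real
  assumes x: "0 < x" "x \<le> 1" and n: "n \<ge> 1"
    and w: "w \<le> (1 - x)\<^sup>2 + 2 * (1 + cos t) * x\<^sup>2 * (1 - x)"
  shows "norm (1 + (cis t - 1) * of_real (1 / x)) ^ n * x ^ (2 * n - 1) \<le> 2 * exp (- (real (n - 1) * (w / 2)))"
proof -
  define Y where "Y = norm (1 + (cis t - 1) * of_real (1 / x)) * x\<^sup>2"
  note Y = reflected_mixture_factor[OF x, of t, folded Y_def]
  have Y0: "0 \<le> Y"
    using x by (simp add: Y_def)
  obtain k where k: "n = Suc k"
    using n by (cases n) auto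
  have "norm (1 + (cis t - 1) * of_real (1 / x)) ^ n * x ^ (2 * n - 1) = Y ^ k * (Y / x)"
  proof -
    have "x ^ (2 * n - 1) = (x\<^sup>2) ^ k * x"
      unfolding power_mult[symmetric] k by simp
    moreover have "Y / x = norm (1 + (cis t - 1) * of_real (1 / x)) * x"
      using x by (simp add: Y_def power2_eq_square)
    ultimately show ?thesis
      by (simp only: k Y_def power_mult_distrib power_Suc mult_ac)
  qed
  also have "\<dots> \<le> exp (- (real k * (w / 2))) * 2"
  proof (intro mult_mono power_le_exp_of_square_le)
    show "Y\<^sup>2 \<le> 1 - 2 * (w / 2)"
      using Y(1) w by simp
    show "Y / x \<le> 2"
      using Y(2) x by (simp add: field_simps)
  qed (use Y0 x in auto)
  finally show ?thesis
    by (simp add: k)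
qed

lemma normal_density_reflect:
  assumes "v > 0"
  shows "normal_density (- (c * v)) (sqrt v) u = normal_density (c * v) (sqrt v) u * exp (- (2 * c * u))"
proof -
  have "- (u - - (c * v))\<^sup>2 / (2 * (sqrt v)\<^sup>2) = - (u - c * v)\<^sup>2 / (2 * (sqrt v)\<^sup>2) + - (2 * c * u)"
    using assms by (simp add: field_simps power2_eq_square)
  then show ?thesis
    unfolding normal_density_def by (simp only: exp_add mult.assoc)
qed

text \<open>The integral is split at \<open>u = 0\<close>, and the positive half is rewritten with
  the reflected density centred at \<open>m\<close>. Within distance \<open>d\<close> of the centres
  the integrand decays as in \<open>B1\<close> or \<open>B2\<close>. Elsewhere it is at most 1 or 2
  times the density, and Chebyshev's inequality gives
  \<open>v / d ^ 2 + 2 * v / d ^ 2\<close>.\<close>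

lemma norm_iso_chf_le:
  fixes n :: nat and p t :: real
  assumes p: "0 < p" "p < 1" and n: "n \<ge> 1"
  defines "v \<equiv> - ln (1 - p)"
  defines "m \<equiv> (real n - 1 / 2) * v"
  defines "d \<equiv> min (m / 2) 1"
  defines "B1 \<equiv> exp (- (real n * ((1 - cos t) * (exp (-1 - m) * (1 - exp (- m / 2))))))"
  defines "B2 \<equiv> 2 * exp (- (real (n - 1) * (((1 - exp (- m / 2))\<^sup>2 +
                    2 * (1 + cos t) * (exp (-1 - m))\<^sup>2 * (1 - exp (- m / 2))) / 2)))"
  shows "norm (iso_chf n p t) \<le> B1 + B2 + 3 * v / d\<^sup>2"
proof -
  define \<rho> where "\<rho> = normal_density (- m) (sqrt v)"
  define \<rho>' where "\<rho>' = normal_density m (sqrt v)"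
  define F where "F u = norm (1 + (cis t - 1) * of_real (exp u)) ^ n" for u
  have v: "v > 0"
    using p by (simp add: v_def)
  have m: "m > 0"
    using v n by (simp add: m_def)
  have d: "d > 0" "d \<le> 1" "d \<le> m / 2"
    using m by (auto simp: d_def)
  have c: "0 \<le> 1 + cos t"
    using cos_ge_minus_one[of t] by linarith
  have \<rho>_nonneg: "0 \<le> \<rho> u" "0 \<le> \<rho>' u" for u
    by (simp_all add: \<rho>_def \<rho>'_def)
  have B: "0 \<le> B1" "0 \<le> B2"
    by (simp_all add: B1_def B2_def)
  \<comment> \<open>The window lies in the interval from \<open>m / 2\<close> to
    \<open>m + 1\<close>: \<open>d \<le> m / 2\<close> keeps the parameter away from 1, and
    \<open>d \<le> 1\<close> limits the loss in \<open>exp (- a)\<close> to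
    \<open>exp (- 1)\<close>.\<close>
  have window: "exp (-1 - m) \<le> exp (- a)" "1 - exp (- m / 2) \<le> 1 - exp (- a)" if "\<bar>a - m\<bar> \<le> d" for a
    using that d by auto
  have e0: "0 \<le> 1 - exp (- m / 2)"
    using m by simp
  have bound: "F u * \<rho> u \<le> (\<rho> u * B1 + \<rho> u * (u + m)\<^sup>2 / d\<^sup>2) + (\<rho>' u * B2 + 2 * (\<rho>' u * (u - m)\<^sup>2) / d\<^sup>2)" for u
  proof (cases "u \<le> 0")
    case True
    have "F u \<le> B1 + (u + m)\<^sup>2 / d\<^sup>2"
    proof (cases "\<bar>u + m\<bar> \<le> d")
      case near: True
      have w: "\<bar>-u - m\<bar> \<le> d"
        using near by linarith
      have "exp (-1 - m) * (1 - exp (- m / 2)) \<le> exp u * (1 - exp u)"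
        using window[OF w] e0 by (intro mult_mono) auto
      then have "F u \<le> B1"
        unfolding F_def B1_def using True by (intro mixture_factor_power_le) auto
      then show ?thesis
        by (simp add: add_increasing2)
    next
      case False
      have "d\<^sup>2 \<le> (u + m)\<^sup>2"
        using False d by (simp add: abs_le_square_iff[symmetric])
      then have "1 \<le> (u + m)\<^sup>2 / d\<^sup>2"
        using d by simp
      moreover have "F u \<le> 1"
        unfolding F_def using True by (intro power_le_one mixture_factor_le_1) auto
      ultimately show ?thesis
        using B by linarith
    qed
    then have "F u * \<rho> u \<le> (B1 + (u + m)\<^sup>2 / d\<^sup>2) * \<rho> u"
      using \<rho>_nonneg by (intro mult_right_mono)
    moreover have "0 \<le> \<rho>' u * B2 + 2 * (\<rho>' u * (u - m)\<^sup>2) / d\<^sup>2"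
      using \<rho>_nonneg B by simp
    ultimately show ?thesis
      by (simp add: algebra_simps)
  next
    case False
    define x where "x = exp (- u)"
    have x: "0 < x" "x \<le> 1" "exp u = 1 / x"
      using False by (auto simp: x_def exp_minus field_simps)
    define H where "H = norm (1 + (cis t - 1) * of_real (1 / x)) ^ n * x ^ (2 * n - 1)"
    have "\<rho> u = \<rho>' u * exp (- (2 * (real n - 1 / 2) * u))"
      unfolding \<rho>_def \<rho>'_def m_def by (rule normal_density_reflect[OF v])
    also have "exp (- (2 * (real n - 1 / 2) * u)) = x ^ (2 * n - 1)"
      using n unfolding x_def by (simp add: exp_of_nat_mult[symmetric] of_nat_diff algebra_simps)
    finally have F\<rho>: "F u * \<rho> u = H * \<rho>' u"
      by (simp add: F_def H_def x mult_ac)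
    have "H \<le> B2 + 2 * (u - m)\<^sup>2 / d\<^sup>2"
    proof (cases "\<bar>u - m\<bar> \<le> d")
      case near: True
      have "(1 - exp (- m / 2))\<^sup>2 + 2 * (1 + cos t) * (exp (-1 - m))\<^sup>2 * (1 - exp (- m / 2)) \<le>
         (1 - x)\<^sup>2 + 2 * (1 + cos t) * x\<^sup>2 * (1 - x)"
        using window[OF near] e0 c x unfolding x_def[symmetric]
        by (intro add_mono mult_mono power_mono mult_nonneg_nonneg) auto
      then have "H \<le> B2"
        unfolding H_def B2_def by (intro reflected_mixture_power_le x n)
      then show ?thesis
        by (simp add: add_increasing2)
    next
      case False
      have "d\<^sup>2 \<le> (u - m)\<^sup>2"
        using False d by (simp add: abs_le_square_iff[symmetric])
      then have "1 \<le> (u - m)\<^sup>2 / d\<^sup>2"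
        using d by simp
      \<comment> \<open>Taking the decay rate to be 0 gives the uniform bound 2.\<close>
      moreover have "H \<le> 2 * exp (- (real (n - 1) * (0 / 2)))"
        unfolding H_def using x c n by (intro reflected_mixture_power_le) auto
      ultimately show ?thesis
        using B by auto
    qed
    then have "F u * \<rho> u \<le> (B2 + 2 * (u - m)\<^sup>2 / d\<^sup>2) * \<rho>' u"
      unfolding F\<rho> using \<rho>_nonneg by (intro mult_right_mono)
    moreover have "0 \<le> \<rho> u * B1 + \<rho> u * (u + m)\<^sup>2 / d\<^sup>2"
      using \<rho>_nonneg B by simp
    ultimately show ?thesis
      by (simp add: algebra_simps)
  qed
  have moments: "has_bochner_integral lborel (\<lambda>u. normal_density a (sqrt v) u) 1"
      "has_bochner_integral lborel (\<lambda>u. normal_density a (sqrt v) u * (u - a)\<^sup>2) v" for a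
    using normal_moment_even[of "sqrt v" a 0] normal_moment_even[of "sqrt v" a 1] v
    by (simp_all add: fact_numeral)
  have rhs: "has_bochner_integral lborel
    (\<lambda>u. (\<rho> u * B1 + \<rho> u * (u + m)\<^sup>2 / d\<^sup>2) + (\<rho>' u * B2 + 2 * (\<rho>' u * (u - m)\<^sup>2) / d\<^sup>2))
    ((1 * B1 + v / d\<^sup>2) + (1 * B2 + 2 * v / d\<^sup>2))"
    unfolding \<rho>_def \<rho>'_def
    using moments(2)[of "- m"]
    by (intro has_bochner_integral_add has_bochner_integral_mult_left has_bochner_integral_mult_right
          has_bochner_integral_divide moments) simp
  have lhs: "has_bochner_integral lborel (\<lambda>u. of_real (\<rho> u) * (1 + (cis t - 1) * of_real (exp u)) ^ n) (iso_chf n p t)"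
    unfolding iso_chf_def iso_gf_alt \<rho>_def m_def v_def by (rule fact_gf_gaussian[OF p])
  have "norm (iso_chf n p t) = norm (\<integral>u. of_real (\<rho> u) * (1 + (cis t - 1) * of_real (exp u)) ^ n \<partial>lborel)"
    using lhs by (simp add: has_bochner_integral_iff)
  also have "\<dots> \<le> (\<integral>u. norm (of_real (\<rho> u) * (1 + (cis t - 1) * of_real (exp u)) ^ n) \<partial>lborel)"
    by (rule integral_norm_bound)
  also have "\<dots> \<le> (\<integral>u. (\<rho> u * B1 + \<rho> u * (u + m)\<^sup>2 / d\<^sup>2) + (\<rho>' u * B2 + 2 * (\<rho>' u * (u - m)\<^sup>2) / d\<^sup>2) \<partial>lborel)"
  proof (rule integral_mono)
    fix u
    show "norm (of_real (\<rho> u) * (1 + (cis t - 1) * of_real (exp u)) ^ n) \<le>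
        (\<rho> u * B1 + \<rho> u * (u + m)\<^sup>2 / d\<^sup>2) + (\<rho>' u * B2 + 2 * (\<rho>' u * (u - m)\<^sup>2) / d\<^sup>2)"
      using bound[of u] \<rho>_nonneg(1)[of u] unfolding F_def norm_mult norm_power by (simp add: mult.commute)
  qed (use lhs rhs in \<open>auto simp: has_bochner_integral_iff\<close>)
  also have "\<dots> = (1 * B1 + v / d\<^sup>2) + (1 * B2 + 2 * v / d\<^sup>2)"
    using rhs by (simp add: has_bochner_integral_iff)
  also have "\<dots> = B1 + B2 + 3 * v / d\<^sup>2"
    by (simp add: algebra_simps add_divide_distrib[symmetric])
  finally show ?thesis .
qed

subsection \<open>Decay in terms of the variance\<close>

lemma times_exp_minus_le: "x * exp (- x) \<le> 1 - exp (- x)" for x :: real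
proof -
  have "(1 + x) * exp (- x) \<le> exp x * exp (- x)"
    by (intro mult_right_mono exp_ge_add_one_self) auto
  also have "\<dots> = 1"
    by (simp add: mult_exp_exp)
  finally show ?thesis
    by (simp add: distrib_right)
qed

lemma minus_ln_one_minus:
  assumes "0 < p" "p \<le> 1 / 2"
  shows "p \<le> - ln (1 - p)" "exp (- ln (1 - p)) \<le> (2 :: real)"
proof -
  show "p \<le> - ln (1 - p)"
    using ln_le_minus_one[of "1 - p"] assms by simp
  have "exp (- ln (1 - p)) = 1 / (1 - p)"
    using assms by (simp add: exp_minus inverse_eq_divide)
  also have "\<dots> \<le> 2"
    using assms by (simp add: field_simps)
  finally show "exp (- ln (1 - p)) \<le> 2" .
qed

text \<open>Up to constants the bracket is the decay exponent of the first peak, so this converts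
  that exponent into the variance. With \<open>x = exp (- m / 2)\<close>, the isolation probability
  is at most \<open>2 * x ^ 2\<close>, and both parts of the second factor of the variance are
  multiples of \<open>1 - x\<close>; the constant is \<open>2 * (2 + 8)\<close>.\<close>

lemma W_var_le:
  fixes n :: nat and p :: real
  assumes p: "0 < p" "p \<le> 1 / 2" and n: "n \<ge> 1"
  defines "v \<equiv> - ln (1 - p)"
  defines "m \<equiv> (real n - 1 / 2) * v"
  shows "W_var n p \<le> 20 * (real n * (exp (- m) * (1 - exp (- m / 2))))"
proof -
  obtain k where k: "n = Suc k"
    using n by (cases n) auto
  define x where "x = exp (- m / 2)"
  define Q where "Q = (1 - p) ^ k"
  have v: "v > 0" "p \<le> v" "exp v \<le> 2"
    using minus_ln_one_minus[OF p] p by (auto simp: v_def)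
  have q: "1 - p = exp (- v)"
    using p by (simp add: v_def)
  have m: "m = (real k + 1 / 2) * v" "m > 0"
    using v n by (auto simp: m_def k)
  have x: "0 < x" "x < 1" "exp (- m) = x\<^sup>2"
    using m(2) by (auto simp: x_def power2_eq_square mult_exp_exp)
  have Q_eq: "Q = exp (- (real k * v))"
    unfolding Q_def q exp_of_nat_mult[symmetric] by simp
  have Q0: "0 < Q"
    by (simp add: Q_eq)
  have Q_le: "Q \<le> 2 * x\<^sup>2"
  proof -
    have "Q = exp (v / 2) * exp (- m)"
      unfolding Q_eq m(1) mult_exp_exp by (simp add: algebra_simps)
    also have "\<dots> \<le> exp v * exp (- m)"
      using v by (intro mult_right_mono) auto
    also have "\<dots> \<le> 2 * exp (- m)"
      using v by (intro mult_right_mono) auto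
    finally show ?thesis
      by (simp add: x)
  qed
  have Q_ge: "1 - Q \<le> 2 * (1 - x)"
  proof -
    have "x\<^sup>2 \<le> Q"
      unfolding Q_eq x(3)[symmetric] m(1) using v by (simp add: algebra_simps)
    moreover have "1 - x\<^sup>2 = (1 - x) * (1 + x)"
      by (simp add: power2_eq_square algebra_simps)
    moreover have "(1 - x) * (1 + x) \<le> (1 - x) * 2"
      using x by (intro mult_left_mono) auto
    ultimately show ?thesis
      by linarith
  qed
  have pm: "p * iso_mean k p \<le> 8 * (1 - x)"
  proof (cases k)
    case 0
    then show ?thesis
      using x by simp
  next
    case (Suc j)
    have "(1 - p) ^ j = Q * exp v"
      unfolding Q_def Suc q by (simp add: mult_exp_exp exp_of_nat_mult[symmetric] algebra_simps)
    also have "\<dots> \<le> (2 * x\<^sup>2) * 2"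
      using Q_le v Q0 by (intro mult_mono) auto
    finally have j: "(1 - p) ^ j \<le> 4 * x\<^sup>2"
      by simp
    have "p * iso_mean k p = (real k * p) * (1 - p) ^ j"
      by (simp add: iso_mean_def Suc)
    also have "\<dots> \<le> (real k * v) * (4 * x\<^sup>2)"
      using j v p by (intro mult_mono) auto
    also have "\<dots> \<le> m * (4 * x\<^sup>2)"
      using v by (intro mult_right_mono) (auto simp: m(1))
    also have "\<dots> = 8 * ((m / 2 * x) * x)"
      by (simp add: power2_eq_square)
    also have "\<dots> \<le> 8 * ((1 - x) * 1)"
      using times_exp_minus_le[of "m / 2"] x m(2) by (intro mult_mono) (auto simp: x_def)
    finally show ?thesis
      by simp
  qed
  have "W_var n p = real n * Q * (1 - Q + p * iso_mean k p)"
    by (simp add: k W_var_Suc iso_mean_Suc Q_def)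
  also have "\<dots> \<le> real n * (2 * x\<^sup>2) * (10 * (1 - x))"
  proof (intro mult_mono)
    show "0 \<le> 1 - Q + p * iso_mean k p"
      using p iso_mean_nonneg[of p k] power_le_one[of "1 - p" k] unfolding Q_def
      by (intro add_nonneg_nonneg mult_nonneg_nonneg) auto
    show "1 - Q + p * iso_mean k p \<le> 10 * (1 - x)"
      using Q_ge pm by simp
  qed (use Q_le Q0 x in auto)
  finally show ?thesis
    by (simp add: x(3)) (simp add: x_def algebra_simps)
qed

text \<open>Either \<open>d = m / 2\<close> or \<open>d = 1\<close>, so the error is at most
  \<open>12 * (v / m ^ 2) + 3 * v\<close>. The first part is controlled by
  \<open>V \<le> 10 * n * m\<close>, the second by \<open>V \<le> 20 * n * exp (- m)\<close>,
  together with \<open>v \<le> 2 * m / n\<close>. The constant is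
  \<open>12 * 20 + 3 * 54\<close>.\<close>

lemma window_error_le:
  fixes n :: nat and p :: real
  assumes p: "0 < p" "p \<le> 1 / 2" and n: "n \<ge> 1" and V1: "W_var n p \<ge> 1"
  defines "v \<equiv> - ln (1 - p)"
  defines "m \<equiv> (real n - 1 / 2) * v"
  shows "3 * v / (min (m / 2) 1)\<^sup>2 \<le> 402 * W_var n p powr (- 3 / 4)"
proof -
  define V where "V = W_var n p"
  have V: "V \<ge> 1"
    using V1 by (simp add: V_def)
  have v: "v > 0"
    using p by (simp add: v_def)
  have n1: "real n \<ge> 1"
    using n by simp
  have m: "m > 0" "m \<ge> real n / 2 * v"
    using v n1 unfolding m_def by (auto intro!: mult_right_mono)
  have V_le: "V \<le> 20 * (real n * (exp (- m) * (1 - exp (- m / 2))))"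
    unfolding V_def m_def v_def by (rule W_var_le[OF p n])
  have "1 / (min (m / 2) 1)\<^sup>2 \<le> 4 / m\<^sup>2 + 1"
    using m by (auto simp: min_def power_divide)
  then have "3 * v * (1 / (min (m / 2) 1)\<^sup>2) \<le> 3 * v * (4 / m\<^sup>2 + 1)"
    using v by (intro mult_left_mono) auto
  then have step: "3 * v / (min (m / 2) 1)\<^sup>2 \<le> 12 * (v / m\<^sup>2) + 3 * v"
    by (simp add: algebra_simps)
  have powr_le: "V powr (-1) \<le> V powr (- 3 / 4)"
    using V by (intro powr_mono) auto
  have first: "v / m\<^sup>2 \<le> 20 * V powr (- 3 / 4)"
  proof -
    have "1 - exp (- m / 2) \<le> m / 2"
      using exp_ge_add_one_self[of "- m / 2"] by linarith
    then have "exp (- m) * (1 - exp (- m / 2)) \<le> 1 * (m / 2)"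
      using m by (intro mult_mono) auto
    then have "20 * (real n * (exp (- m) * (1 - exp (- m / 2)))) \<le> 20 * (real n * (1 * (m / 2)))"
      by (intro mult_left_mono) auto
    then have "V \<le> 10 * real n * m"
      using V_le by (simp add: mult_ac)
    have "v / m\<^sup>2 \<le> (2 * m / real n) / m\<^sup>2"
      using m n1 by (intro divide_right_mono) (auto simp: field_simps)
    also have "\<dots> = 20 / (10 * real n * m)"
      using m n1 by (simp add: power2_eq_square field_simps)
    also have "\<dots> \<le> 20 / V"
      using \<open>V \<le> 10 * real n * m\<close> V m n1 by (intro divide_left_mono mult_pos_pos) auto
    also have "\<dots> = 20 * V powr (-1)"
      using V by (simp add: powr_minus divide_inverse)
    finally show ?thesis
      using powr_le by linarith
  qed
  have second: "v \<le> 54 * V powr (- 3 / 4)"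
  proof -
    have "exp (- m) * (1 - exp (- m / 2)) \<le> exp (- m) * 1"
      by (intro mult_left_mono) auto
    then have "20 * (real n * (exp (- m) * (1 - exp (- m / 2)))) \<le> 20 * (real n * (exp (- m) * 1))"
      by (intro mult_left_mono) auto
    then have "V \<le> 20 * real n * exp (- m)"
      using V_le by linarith
    then have "V powr (3 / 4) \<le> (20 * real n * exp (- m)) powr (3 / 4)"
      using V by (intro powr_mono2) auto
    also have "\<dots> = (20 * real n) powr (3 / 4) * exp (- (3 / 4 * m))"
      using n1 by (simp add: powr_mult exp_powr_real algebra_simps)
    also have "\<dots> \<le> (20 * real n) powr 1 * exp (- (3 / 4 * m))"
      using n1 by (intro mult_right_mono powr_mono) auto
    finally have P: "V powr (3 / 4) \<le> 20 * real n * exp (- (3 / 4 * m))"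
      using n1 by simp
    have "v * V powr (3 / 4) \<le> (2 * m / real n) * (20 * real n * exp (- (3 / 4 * m)))"
      using P m n1 v by (intro mult_mono) (auto simp: field_simps)
    also have "\<dots> = 160 / 3 * ((3 / 4 * m) * exp (- (3 / 4 * m)))"
      using n1 by (simp add: field_simps)
    also have "\<dots> \<le> 160 / 3 * (1 - exp (- (3 / 4 * m)))"
      by (intro mult_left_mono times_exp_minus_le) auto
    also have "\<dots> \<le> 160 / 3 * 1"
      by (intro mult_left_mono) auto
    finally have "v * V powr (3 / 4) \<le> 54"
      by simp
    then have "v * V powr (3 / 4) * V powr (- 3 / 4) \<le> 54 * V powr (- 3 / 4)"
      by (intro mult_right_mono) auto
    then show ?thesis
      using V by (simp add: mult.assoc powr_add[symmetric])
  qed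
  show ?thesis
    using step first second unfolding V_def by linarith
qed

text \<open>The contribution of the mirror peak, \<open>B2\<close> in
  \<open>norm_iso_chf_le\<close>. It is kept apart because its size depends on the regime.\<close>

definition decay_error :: "nat \<Rightarrow> real \<Rightarrow> real \<Rightarrow> real" where
  "decay_error n m t = 2 * exp (- (real (n - 1) * (((1 - exp (- m / 2))\<^sup>2 +
                    2 * (1 + cos t) * (exp (-1 - m))\<^sup>2 * (1 - exp (- m / 2))) / 2)))"

lemma exp_minus_1_ge: "1 / 3 \<le> exp (- 1 :: real)"
  using exp_le by (simp add: exp_minus field_simps)

text \<open>The denominator 60 is the 20 from \<open>W_var_le\<close> times 3, the latter for the
  loss of \<open>exp (- 1)\<close> at the edge of the window.\<close>

lemma iso_chf_decay:
  fixes n :: nat and p t :: real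
  assumes p: "0 < p" "p \<le> 1 / 2" and n: "n \<ge> 1" and V1: "W_var n p \<ge> 1"
  defines "v \<equiv> - ln (1 - p)"
  defines "m \<equiv> (real n - 1 / 2) * v"
  shows "norm (iso_chf n p t) \<le>
    exp (- (W_var n p * (1 - cos t) / 60)) + decay_error n m t + 402 * W_var n p powr (- 3 / 4)"
proof -
  define A where "A = real n * (exp (- m) * (1 - exp (- m / 2)))"
  have V_le: "W_var n p \<le> 20 * A"
    unfolding A_def m_def v_def by (rule W_var_le[OF p n])
  have "1 / 3 * A \<le> exp (- 1) * A"
    using V_le V1 by (intro mult_right_mono exp_minus_1_ge) auto
  then have "W_var n p / 60 \<le> exp (- 1) * A"
    using V_le by linarith
  then have "(1 - cos t) * (W_var n p / 60) \<le> (1 - cos t) * (exp (- 1) * A)"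
    by (intro mult_left_mono) auto
  moreover have "exp (-1 - m) = exp (- 1) * exp (- m)"
    by (simp add: mult_exp_exp)
  ultimately have "W_var n p * (1 - cos t) / 60 \<le> real n * ((1 - cos t) * (exp (-1 - m) * (1 - exp (- m / 2))))"
    by (simp add: A_def mult_ac)
  then have "exp (- (real n * ((1 - cos t) * (exp (-1 - m) * (1 - exp (- m / 2)))))) \<le> exp (- (W_var n p * (1 - cos t) / 60))"
    by simp
  moreover have "p < 1"
    using p by simp
  ultimately show ?thesis
    using norm_iso_chf_le[OF p(1) \<open>p < 1\<close> n, of t] window_error_le[OF p n V1]
    unfolding decay_error_def m_def v_def by linarith
qed

text \<open>When \<open>m\<close> is bounded below, the mirror peak stays away from
  \<open>u = 0\<close>, and the part without \<open>cos t\<close> alone is exponentially small in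
  \<open>n\<close>, uniformly in \<open>t\<close>.\<close>

lemma decay_error_le_const:
  assumes n: "n \<ge> 2" and m: "0 \<le> c" "c \<le> m"
  shows "decay_error n m t \<le> 2 * exp (- (real n * ((1 - exp (- c / 2))\<^sup>2 / 4)))"
proof -
  define y where "y = 1 - exp (- m / 2)"
  have y: "0 \<le> 1 - exp (- c / 2)" "1 - exp (- c / 2) \<le> y" "0 \<le> y"
    using m by (auto simp: y_def)
  have ct: "0 \<le> 1 + cos t"
    using cos_ge_minus_one[of t] by linarith
  have "real n / 2 * ((1 - exp (- c / 2))\<^sup>2 / 2) \<le>
      real (n - 1) * ((y\<^sup>2 + 2 * (1 + cos t) * (exp (-1 - m))\<^sup>2 * y) / 2)"
  proof (rule mult_mono)
    have "0 \<le> 2 * (1 + cos t) * (exp (-1 - m))\<^sup>2 * y"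
      using y ct by (intro mult_nonneg_nonneg) auto
    moreover have "(1 - exp (- c / 2))\<^sup>2 \<le> y\<^sup>2"
      using y by (intro power_mono) auto
    ultimately show "(1 - exp (- c / 2))\<^sup>2 / 2 \<le> (y\<^sup>2 + 2 * (1 + cos t) * (exp (-1 - m))\<^sup>2 * y) / 2"
      by argo
  qed (use n in auto)
  then show ?thesis
    unfolding decay_error_def y_def by simp
qed

text \<open>Both parts of the exponent matter here. The square of \<open>1 - exp (- m / 2)\<close>
  is of order \<open>(n * p) ^ 2\<close> and yields \<open>n ^ 3 * p ^ 2\<close>; the part with
  \<open>1 + cos t\<close> is again comparable to the variance. The denominators are
  \<open>4 * 8 ^ 2\<close> and \<open>2 * 20 * 27\<close>, where 27 bounds
  \<open>exp 3\<close>.\<close>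

lemma decay_error_le_small:
  fixes n :: nat and p t :: real
  assumes p: "0 < p" "p \<le> 1 / 2" and n: "n \<ge> 2"
  defines "v \<equiv> - ln (1 - p)"
  defines "m \<equiv> (real n - 1 / 2) * v"
  assumes m1: "m \<le> 1"
  shows "decay_error n m t \<le> 2 * exp (- (real n ^ 3 * p\<^sup>2 / 256)) * exp (- (W_var n p * (1 + cos t) / 1080))"
proof -
  define y where "y = 1 - exp (- m / 2)"
  have v: "v > 0" "p \<le> v"
    using minus_ln_one_minus[OF p] p by (auto simp: v_def)
  have n2: "real n \<ge> 2" "n \<ge> 1"
    using n by auto
  have m: "m > 0" "m \<ge> real n * p / 2"
  proof -
    show "m > 0"
      using v n2 by (simp add: m_def)
    have "(real n / 2) * p \<le> m"
      unfolding m_def using v n2 p by (intro mult_mono) auto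
    then show "m \<ge> real n * p / 2"
      by simp
  qed
  have ct: "0 \<le> 1 + cos t"
    using cos_ge_minus_one[of t] by linarith
  have y: "m / 4 \<le> y"
  proof -
    have "m / 2 * exp (- (m / 2)) \<le> y"
      using times_exp_minus_le[of "m / 2"] by (simp add: y_def)
    moreover have "1 / 2 \<le> exp (- (m / 2))"
      using exp_ge_add_one_self[of "- (m / 2)"] m1 by linarith
    then have "m / 2 * (1 / 2) \<le> m / 2 * exp (- (m / 2))"
      using m by (intro mult_left_mono) auto
    ultimately show ?thesis
      by linarith
  qed
  have first: "real n ^ 3 * p\<^sup>2 / 256 \<le> real n / 4 * y\<^sup>2"
  proof -
    have "(real n * p / 8)\<^sup>2 \<le> y\<^sup>2"
      using y m p n2 by (intro power_mono) auto
    then have "real n / 4 * (real n * p / 8)\<^sup>2 \<le> real n / 4 * y\<^sup>2"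
      by (intro mult_left_mono) auto
    then show ?thesis
      by (simp add: power2_eq_square power3_eq_cube)
  qed
  have e3: "1 / 27 * exp (- m) \<le> (exp (-1 - m))\<^sup>2"
  proof -
    have "1 / 27 \<le> exp (- 1 :: real) ^ 3"
      using power_mono[OF exp_minus_1_ge, of 3] by (simp add: power_divide)
    also have "\<dots> = exp (- 2) * exp (- 1)"
      by (simp add: mult_exp_exp exp_of_nat_mult[symmetric])
    also have "\<dots> \<le> exp (- 2) * exp (- m)"
      using m1 by (intro mult_left_mono) auto
    finally have "1 / 27 * exp (- m) \<le> exp (- 2) * exp (- m) * exp (- m)"
      by (intro mult_right_mono) auto
    also have "exp (- 2) * exp (- m) * exp (- m) = (exp (-1 - m))\<^sup>2"
      unfolding power2_eq_square mult_exp_exp by simp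
    finally show ?thesis .
  qed
  have second: "W_var n p * (1 + cos t) / 1080 \<le> real n / 2 * ((1 + cos t) * (exp (-1 - m))\<^sup>2 * y)"
  proof -
    have "W_var n p \<le> 20 * (real n * (exp (- m) * y))"
      unfolding y_def m_def v_def by (rule W_var_le[OF p n2(2)])
    then have "W_var n p * (1 + cos t) \<le> 20 * (real n * (exp (- m) * y)) * (1 + cos t)"
      using ct by (intro mult_right_mono)
    then have "W_var n p * (1 + cos t) / 1080 \<le> 20 * (real n * (exp (- m) * y)) * (1 + cos t) / 1080"
      by (rule divide_right_mono) simp
    also have "\<dots> = real n / 2 * ((1 + cos t) * (1 / 27 * exp (- m)) * y)"
    proof -
      have "20 * (real n * (e * y)) * c / 1080 = real n / 2 * (c * (1 / 27 * e) * y)" for c e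
        by simp
      then show ?thesis .
    qed
    also have "\<dots> \<le> real n / 2 * ((1 + cos t) * (exp (-1 - m))\<^sup>2 * y)"
      using e3 ct y m by (intro mult_left_mono mult_right_mono) auto
    finally show ?thesis .
  qed
  have split: "real n / 2 * ((a + 2 * b * e * y) / 2) = real n / 4 * a + real n / 2 * (b * e * y)" for a b e
    by (simp add: add_divide_distrib distrib_left)
  have "real n ^ 3 * p\<^sup>2 / 256 + W_var n p * (1 + cos t) / 1080 \<le>
      real n / 2 * ((y\<^sup>2 + 2 * (1 + cos t) * (exp (-1 - m))\<^sup>2 * y) / 2)"
    unfolding split using first second by (rule add_mono)
  also have "\<dots> \<le> real (n - 1) * ((y\<^sup>2 + 2 * (1 + cos t) * (exp (-1 - m))\<^sup>2 * y) / 2)"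
    using n y m ct by (intro mult_right_mono) auto
  finally have "decay_error n m t \<le> 2 * exp (- (real n ^ 3 * p\<^sup>2 / 256 + W_var n p * (1 + cos t) / 1080))"
    unfolding decay_error_def y_def by (intro mult_left_mono) (simp_all only: exp_le_cancel_iff neg_le_iff_le zero_le_numeral)
  then show ?thesis
    by (simp add: mult_exp_exp mult.assoc)
qed

subsection \<open>Fourier inversion\<close>

lemma one_minus_cos_ge:
  assumes "\<bar>t\<bar> \<le> pi"
  shows "t\<^sup>2 / 12 \<le> 1 - cos t"
proof -
  have taylor: "cos x \<le> 1 - x\<^sup>2 / 2 + x ^ 4 / 24" if x: "0 < x" for x :: real
  proof -
    obtain s where s: "cos x = (\<Sum>m<4. cos_coeff m * x ^ m) + cos (s + 1 / 2 * real 4 * pi) / fact 4 * x ^ 4"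
      using Maclaurin_cos_expansion2[of x 4, OF x zero_less_numeral] by blast
    have "cos (s + 1 / 2 * real 4 * pi) / fact 4 * x ^ 4 \<le> 1 / fact 4 * x ^ 4"
      by (rule mult_right_mono[OF divide_right_mono[OF cos_le_one]]) simp_all
    moreover have "(\<Sum>m<4. cos_coeff m * x ^ m) = 1 - x\<^sup>2 / 2"
    proof -
      have "cos_coeff 0 = 1" "cos_coeff (Suc 0) = 0" "cos_coeff (Suc (Suc 0)) = - 1 / 2" "cos_coeff (Suc (Suc (Suc 0))) = 0"
        by (simp_all add: cos_coeff_def)
      moreover have "{..<4 :: nat} = {0, Suc 0, Suc (Suc 0), Suc (Suc (Suc 0))}"
        by auto
      ultimately show ?thesis
        by (simp add: power2_eq_square)
    qed
    moreover have "1 / fact 4 * x ^ 4 = x ^ 4 / 24"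
      by (simp add: fact_numeral)
    ultimately show ?thesis
      using s by linarith
  qed
  have "x\<^sup>2 / 12 \<le> 1 - cos x" if x: "0 < x" "x \<le> pi" for x
  proof (cases "x \<le> 2")
    case True
    have "x\<^sup>2 \<le> 2\<^sup>2"
      using True x by (intro power_mono) auto
    then have "x\<^sup>2 * x\<^sup>2 \<le> 4 * x\<^sup>2"
      by (intro mult_right_mono) auto
    moreover have "x ^ 4 = x\<^sup>2 * x\<^sup>2"
      by (simp add: power2_eq_square power4_eq_xxxx)
    ultimately show ?thesis
      using taylor[OF x(1)] zero_le_power2[of x] by linarith
  next
    case False
    \<comment> \<open>The constant 12 comes from here: \<open>1 - cos x\<close> is at least
      \<open>4 / 3\<close>, while \<open>x ^ 2\<close> is estimated only by 16.\<close>
    have "cos x \<le> cos 2"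
      using False x by (intro cos_monotone_0_pi_le) auto
    then have "4 / 3 \<le> 1 - cos x"
      using taylor[of 2] by simp
    moreover have "x\<^sup>2 \<le> 4\<^sup>2"
      using x pi_less_4 by (intro power_mono) auto
    ultimately show ?thesis
      by simp
  qed
  from this[of "\<bar>t\<bar>"] show ?thesis
    using assms by (cases "t = 0") simp_all
qed

section \<open>Lorentz profiles as integrable majorants\<close>

lemma lorentz_integrable: "V > 0 \<Longrightarrow> (\<lambda>t. 1 / (1 + V * (t - a)\<^sup>2)) integrable_on {b..c}" for a b c V :: real
  by (intro integrable_continuous_real continuous_intros)
     (metis add_pos_nonneg less_numeral_extra(1) mult_nonneg_nonneg order_less_imp_le order_less_irrefl zero_le_power2)

text \<open>The primitive is an arctangent, so every finite interval admits the same bound; each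
  peak of width \<open>1 / sqrt V\<close> thus contributes a factor
  \<open>1 / sqrt V\<close>.\<close>

lemma lorentz_integral_le:
  fixes V a b c :: real
  assumes V: "V > 0" and "b \<le> c"
  shows "integral {b..c} (\<lambda>t. 1 / (1 + V * (t - a)\<^sup>2)) \<le> pi / sqrt V"
proof -
  have "((\<lambda>t. 1 / (1 + V * (t - a)\<^sup>2)) has_integral
     arctan (sqrt V * (c - a)) / sqrt V - arctan (sqrt V * (b - a)) / sqrt V) {b..c}"
  proof (rule fundamental_theorem_of_calculus[OF \<open>b \<le> c\<close>])
    fix t
    have "((\<lambda>t. arctan (sqrt V * (t - a)) / sqrt V) has_real_derivative 1 / (1 + V * (t - a)\<^sup>2)) (at t within {b..c})"
      using V by (auto intro!: derivative_eq_intros simp: power_mult_distrib divide_inverse)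
    then show "((\<lambda>t. arctan (sqrt V * (t - a)) / sqrt V) has_vector_derivative 1 / (1 + V * (t - a)\<^sup>2)) (at t within {b..c})"
      by (simp add: has_real_derivative_iff_has_vector_derivative)
  qed
  then have "integral {b..c} (\<lambda>t. 1 / (1 + V * (t - a)\<^sup>2)) =
      (arctan (sqrt V * (c - a)) - arctan (sqrt V * (b - a))) / sqrt V"
    by (simp add: integral_unique diff_divide_distrib)
  also have "\<dots> \<le> pi / sqrt V"
    using arctan_ubound[of "sqrt V * (c - a)"] arctan_lbound[of "sqrt V * (b - a)"] V
    by (intro divide_right_mono) auto
  finally show ?thesis .
qed

lemma norm_integral_le_lorentz:
  fixes f :: "real \<Rightarrow> complex"
  assumes f: "continuous_on {-pi..pi} f" and V: "V > 0" and AB: "A \<ge> 0" "B \<ge> 0"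
    and le: "\<And>t. \<bar>t\<bar> \<le> pi \<Longrightarrow> norm (f t) \<le>
      A * (1 / (1 + V * (t - 0)\<^sup>2)) + B * (1 / (1 + V * (t - pi)\<^sup>2) + 1 / (1 + V * (t - (- pi))\<^sup>2)) + R"
  shows "norm (integral {-pi..pi} f) \<le> (A + 2 * B) * (pi / sqrt V) + 2 * pi * R"
proof -
  let ?L = "\<lambda>a t. 1 / (1 + V * (t - a)\<^sup>2)"
  note int = lorentz_integrable[OF V, of _ "- pi" pi]
  have "norm (integral {-pi..pi} f) \<le>
      integral {-pi..pi} (\<lambda>t. A * ?L 0 t + B * (?L pi t + ?L (- pi) t) + R)"
  proof (rule integral_norm_bound_integral)
    show "f integrable_on {- pi..pi}"
      by (rule integrable_continuous_real[OF f])
    show "(\<lambda>t. A * ?L 0 t + B * (?L pi t + ?L (- pi) t) + R) integrable_on {-pi..pi}"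
      by (intro integrable_add integrable_on_mult_right int integrable_const_ivl)
  qed (use le in auto)
  also have "\<dots> = A * integral {-pi..pi} (?L 0) + B * (integral {-pi..pi} (?L pi) + integral {-pi..pi} (?L (- pi))) + 2 * pi * R"
    by (simp only: integral_add integrable_add integrable_on_mult_right int integrable_const_ivl integral_mult_right)
       simp
  also have "\<dots> \<le> A * (pi / sqrt V) + B * (pi / sqrt V + pi / sqrt V) + 2 * pi * R"
    using AB V by (intro add_mono mult_left_mono lorentz_integral_le) auto
  finally show ?thesis
    by (simp add: algebra_simps)
qed

section \<open>Fourier coefficients of the two laws\<close>

lemma integral_cis:
  "((\<lambda>t. cis (of_int k * t)) has_integral (if k = 0 then 2 * of_real pi else 0)) {-pi..pi}"
proof (cases "k = 0")
  case True
  have "((\<lambda>t. 1 :: complex) has_integral (pi - (- pi)) *\<^sub>R 1) {-pi..pi}"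
    using has_integral_const_real[of "1 :: complex" "- pi" pi] by simp
  then show ?thesis
    using True by (simp add: scaleR_conv_of_real)
next
  case False
  have "((\<lambda>t. cis (of_int k * t)) has_integral
     cis (of_int k * pi) / (\<i> * of_int k) - cis (of_int k * (- pi)) / (\<i> * of_int k)) {-pi..pi}"
  proof (rule fundamental_theorem_of_calculus)
    fix t
    have "((\<lambda>t. cis (of_int k * t)) has_derivative (\<lambda>h. (of_int k * h) *\<^sub>R (\<i> * cis (of_int k * t)))) (at t within {-pi..pi})"
      by (rule has_derivative_cis) (auto intro!: derivative_eq_intros)
    then have "((\<lambda>t. cis (of_int k * t)) has_vector_derivative (\<i> * of_int k * cis (of_int k * t))) (at t within {-pi..pi})"
      by (simp add: has_vector_derivative_def scaleR_conv_of_real mult_ac)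
    then have "((\<lambda>t. cis (of_int k * t) / (\<i> * of_int k)) has_vector_derivative
        (\<i> * of_int k * cis (of_int k * t)) / (\<i> * of_int k)) (at t within {-pi..pi})"
      by (rule has_vector_derivative_divide)
    then show "((\<lambda>t. cis (of_int k * t) / (\<i> * of_int k)) has_vector_derivative cis (of_int k * t)) (at t within {-pi..pi})"
      using False by simp
  qed simp
  moreover have "cis (of_int k * pi) = cis (of_int k * (- pi))"
    by (simp add: complex_eq_iff sin_integer_2pi) (metis Ints_of_int mult.commute sin_times_pi_eq_0)
  ultimately show ?thesis
    using False by simp
qed

text \<open>The masses dominate the terms uniformly in \<open>t\<close>, so the series may be
  integrated termwise. The same statement serves the finitely supported \<open>W\<close> and the
  Poisson law, and a negative \<open>j\<close> gets coefficient 0.\<close>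

lemma fourier_coefficient:
  fixes c :: "nat \<Rightarrow> real" and f :: "real \<Rightarrow> complex"
  assumes c: "\<And>k. 0 \<le> c k" "summable c"
    and f: "\<And>t. f t = (\<Sum>k. of_real (c k) * cis (real k * t))"
  shows "((\<lambda>t. cis (- (of_int j * t)) * f t) has_integral
      2 * of_real pi * of_real (if 0 \<le> j then c (nat j) else 0)) {-pi..pi}"
proof -
  define g where "g k t = of_real (c k) * cis (real k * t) * cis (- (of_int j * t))" for k t
  have ng: "norm (g k t) \<le> c k" for k t
    using c by (simp add: g_def norm_mult)
  have g_int: "(g k has_integral of_real (c k) * (if int k = j then 2 * of_real pi else 0)) {-pi..pi}" for k
  proof -
    have "((\<lambda>t. of_real (c k) * cis (of_int (int k - j) * t)) has_integral
        of_real (c k) * (if int k - j = 0 then 2 * of_real pi else 0)) {-pi..pi}"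
      by (intro has_integral_mult_right integral_cis)
    moreover have "(\<lambda>t. of_real (c k) * cis (of_int (int k - j) * t)) = g k"
      by (auto simp: fun_eq_iff g_def cis_mult left_diff_distrib mult.assoc)
    ultimately show ?thesis
      by simp
  qed
  have u: "uniform_limit {-pi..pi} (\<lambda>n t. \<Sum>k<n. g k t) (\<lambda>t. \<Sum>k. g k t) sequentially"
    by (rule Weierstrass_m_test[OF _ c(2)]) (rule ng)
  have cont: "continuous_on {-pi..pi} (\<lambda>t. \<Sum>k<n. g k t)" for n
    unfolding g_def by (intro continuous_intros)
  obtain I J where I: "\<And>n. ((\<lambda>t. \<Sum>k<n. g k t) has_integral I n) {-pi..pi}"
    and J: "((\<lambda>t. \<Sum>k. g k t) has_integral J) {-pi..pi}" and lim: "I \<longlonglongrightarrow> J"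
    using uniform_limit_integral[OF u cont] by auto
  have "I n = (\<Sum>k<n. of_real (c k) * (if int k = j then 2 * of_real pi else 0))" for n
    by (rule has_integral_unique[OF I]) (intro has_integral_sum g_int finite_lessThan)
  then have I_eq: "I n = 2 * of_real pi * of_real (if 0 \<le> j then c (nat j) else 0)" if "n > nat j" for n
  proof -
    have "(\<Sum>k<n. of_real (c k) * (if int k = j then 2 * of_real pi else 0)) =
        (\<Sum>k<n. if k = nat j then (if 0 \<le> j then 2 * of_real pi * complex_of_real (c (nat j)) else 0) else 0)"
      by (intro sum.cong refl) auto
    then show ?thesis
      using that \<open>\<And>n. I n = _ n\<close> by simp
  qed
  have "I \<longlonglongrightarrow> 2 * of_real pi * of_real (if 0 \<le> j then c (nat j) else 0)"
    by (rule tendsto_eventually) (use I_eq in \<open>auto simp: eventually_sequentially intro!: exI[of _ "Suc (nat j)"]\<close>)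
  then have "J = 2 * of_real pi * of_real (if 0 \<le> j then c (nat j) else 0)"
    using lim LIMSEQ_unique by blast
  moreover have "(\<Sum>k. g k t) = cis (- (of_int j * t)) * f t" for t
  proof -
    have "summable (\<lambda>k. of_real (c k) * cis (real k * t))"
      by (rule summable_comparison_test'[OF c(2), of 0]) (use c in \<open>simp add: norm_mult\<close>)
    from suminf_mult2[OF this, of "cis (- (of_int j * t))"] show ?thesis
      by (simp add: g_def f mult.commute)
  qed
  ultimately show ?thesis
    using J by simp
qed

lemma iso_prob_eq_0: "k > n \<Longrightarrow> iso_prob n p k = 0"
  unfolding iso_prob_alt using num_isolated_le[of n]
  by (intro sum.neutral ballI) (auto simp: not_less[symmetric] simp del: not_less)

lemma W_pmf_fourier:
  assumes "0 \<le> p" "p \<le> 1"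
  shows "((\<lambda>t. cis (- (of_int j * t)) * iso_chf n p t) has_integral 2 * of_real pi * of_real (W_pmf n p j)) {-pi..pi}"
proof -
  have fin: "summable (iso_prob n p)"
    by (rule summable_finite[of "{..n}"]) (auto simp: iso_prob_eq_0)
  have "((\<lambda>t. cis (- (of_int j * t)) * iso_chf n p t) has_integral
      2 * of_real pi * of_real (if 0 \<le> j then iso_prob n p (nat j) else 0)) {-pi..pi}"
  proof (rule fourier_coefficient[OF _ fin])
    fix t
    have "(\<Sum>k. of_real (iso_prob n p k) * cis (real k * t)) = (\<Sum>k\<le>n. of_real (iso_prob n p k) * cis (real k * t))"
      by (rule suminf_finite) (auto simp: iso_prob_eq_0)
    then show "iso_chf n p t = (\<Sum>k. of_real (iso_prob n p k) * cis (real k * t))"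
      by (simp add: iso_chf_eq_sum)
  qed (use assms iso_prob_nonneg in auto)
  moreover have "(if 0 \<le> j then iso_prob n p (nat j) else 0) = W_pmf n p j"
    by (auto simp: iso_prob_def W_pmf_def intro!: sum.neutral[symmetric])
  ultimately show ?thesis
    by simp
qed

lemma W_cdf_diff: "W_cdf n p (j + 1) - W_cdf n p j = W_pmf n p (j + 1)"
  unfolding W_cdf_def W_pmf_def sum_subtractf[symmetric]
  by (intro sum.cong refl) auto

definition poisson_mass :: "real \<Rightarrow> nat \<Rightarrow> real" where
  "poisson_mass l k = exp (- l) * l ^ k / fact k"

lemma poisson_mass_sums: "poisson_mass l sums 1"
proof -
  have "(\<lambda>k. exp (- l) * (l ^ k /\<^sub>R fact k)) sums (exp (- l) * exp l)"
    by (intro sums_mult exp_converges)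
  then show ?thesis
    by (simp add: poisson_mass_def[abs_def] divide_inverse mult_ac mult_exp_exp scaleR_conv_of_real)
qed

lemma poisson_chf: "exp (of_real l * (cis t - 1)) = (\<Sum>k. of_real (poisson_mass l k) * cis (real k * t))"
proof -
  have "(\<lambda>k. of_real (exp (- l)) * ((of_real l * cis t) ^ k /\<^sub>R fact k)) sums (of_real (exp (- l)) * exp (of_real l * cis t))"
    by (intro sums_mult exp_converges)
  moreover have "of_real (exp (- l)) * ((of_real l * cis t) ^ k /\<^sub>R fact k) = of_real (poisson_mass l k) * cis (real k * t)" for k
    by (simp add: poisson_mass_def power_mult_distrib Complex.DeMoivre scaleR_conv_of_real divide_inverse)
  moreover have "of_real (exp (- l)) * exp (of_real l * cis t) = exp (of_real l * (cis t - 1))"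
    by (simp add: exp_of_real[symmetric] mult_exp_exp algebra_simps)
  ultimately show ?thesis
    by (simp add: sums_iff)
qed

definition TP_pmf :: "real \<Rightarrow> real \<Rightarrow> int \<Rightarrow> real" where
  "TP_pmf m V j = (let a = \<lfloor>m - V\<rfloor>; g = m - V - of_int a in
     if 0 \<le> j - a then poisson_mass (V + g) (nat (j - a)) else 0)"

lemma TP_pmf_fourier:
  assumes "V \<ge> 0"
  shows "((\<lambda>t. cis (- (of_int j * t)) * TP_chf m V t) has_integral 2 * of_real pi * of_real (TP_pmf m V j)) {-pi..pi}"
proof -
  define a where "a = \<lfloor>m - V\<rfloor>"
  define l where "l = V + (m - V - of_int a)"
  have l: "l \<ge> 0"
    using assms unfolding l_def a_def by linarith
  have "((\<lambda>t. cis (- (of_int (j - a) * t)) * exp (of_real l * (cis t - 1))) has_integral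
      2 * of_real pi * of_real (if 0 \<le> j - a then poisson_mass l (nat (j - a)) else 0)) {-pi..pi}"
    by (rule fourier_coefficient[OF _ sums_summable[OF poisson_mass_sums] poisson_chf])
       (use l in \<open>simp add: poisson_mass_def\<close>)
  moreover have "cis (- (of_int (j - a) * t)) * exp (of_real l * (cis t - 1)) = cis (- (of_int j * t)) * TP_chf m V t" for t
  proof -
    have "cis (- (of_int (j - a) * t)) = cis (- (of_int j * t)) * cis (of_int a * t)"
      by (simp add: cis_mult algebra_simps)
    then show ?thesis
      by (simp add: TP_chf_def Let_def a_def l_def)
  qed
  moreover have "TP_pmf m V j = (if 0 \<le> j - a then poisson_mass l (nat (j - a)) else 0)"
    unfolding TP_pmf_def Let_def a_def[symmetric] l_def[symmetric] ..
  ultimately show ?thesis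
    by (simp only:)
qed

lemma TP_cdf_diff: "TP_cdf m V (j + 1) - TP_cdf m V j = TP_pmf m V (j + 1)"
proof -
  define a where "a = \<lfloor>m - V\<rfloor>"
  have "poisson_cdf l (i + 1) - poisson_cdf l i = (if 0 \<le> i + 1 then poisson_mass l (nat (i + 1)) else 0)" for l i
  proof (cases "0 \<le> i")
    case True
    then have "nat (i + 1) = Suc (nat i)"
      by simp
    then show ?thesis
      using True by (simp add: poisson_cdf_def poisson_mass_def)
  next
    case False
    then show ?thesis
      by (cases "i = -1") (auto simp: poisson_cdf_def poisson_mass_def)
  qed
  from this[of _ "j - a"] show ?thesis
    by (simp add: TP_cdf_def TP_pmf_def Let_def a_def[symmetric] algebra_simps)
qed

subsection \<open>Differences of probability masses\<close>

text \<open>The error \<open>R\<close> is removed before the geometric mean is taken. In the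
  application \<open>A\<close> is of order \<open>V\<close> for \<open>t\<close> of order 1, so the
  root of \<open>A * R\<close> would be far larger than \<open>R\<close>.\<close>

lemma le_geometric_mean_plus:
  fixes x A B E R :: real
  assumes "x \<le> A" "x \<le> B + R" "0 \<le> A" "0 \<le> B" "0 \<le> R" "0 \<le> E" "A * B \<le> E\<^sup>2"
  shows "x \<le> E + R"
proof (cases "x \<le> R")
  case False
  have "(x - R) * (x - R) \<le> A * B"
    using assms False by (intro mult_mono) auto
  then have "(x - R)\<^sup>2 \<le> E\<^sup>2"
    using assms(7) by (simp add: power2_eq_square)
  then have "x - R \<le> E"
    using assms(6) by (rule power2_le_imp_le)
  then show ?thesis
    by simp
qed (use assms in auto)

lemma exp_minus_le_lorentz:
  fixes c z :: real
  assumes "c \<ge> 1" "z \<ge> 0"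
  shows "exp (- (z / c)) \<le> c * (1 / (1 + z))"
proof -
  have "(1 + z) * exp (- (z / c)) \<le> (c * (1 + z / c)) * exp (- (z / c))"
    using assms by (intro mult_right_mono) (auto simp: field_simps)
  also have "\<dots> \<le> (c * exp (z / c)) * exp (- (z / c))"
    using assms exp_ge_add_one_self[of "z / c"] by (intro mult_right_mono mult_left_mono) auto
  also have "\<dots> = c"
    by (simp add: mult.assoc mult_exp_exp)
  finally show ?thesis
    using assms by (simp add: field_simps)
qed

text \<open>\<open>1 + cos t\<close> is \<open>1 - cos u\<close> for \<open>u\<close> the distance
  to \<open>pi\<close> or to \<open>- pi\<close>. On the circle this is one point, but on the
  interval of integration it gives two half peaks.\<close>

lemma exp_minus_one_plus_cos_le:
  assumes "\<bar>t\<bar> \<le> pi" "V > 0" "c \<ge> 1"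
  shows "exp (- (V * (1 + cos t) / c)) \<le>
    12 * c * (1 / (1 + V * (t - pi)\<^sup>2) + 1 / (1 + V * (t - (- pi))\<^sup>2))"
proof -
  have *: "exp (- (V * (1 + cos t) / c)) \<le> 12 * c * (1 / (1 + V * u\<^sup>2))"
    if "\<bar>u\<bar> \<le> pi" "1 - cos u = 1 + cos t" for u
  proof -
    have "V * (u\<^sup>2 / 12) \<le> V * (1 + cos t)"
      using one_minus_cos_ge[OF that(1)] that(2) assms by (intro mult_left_mono) auto
    then have "V * (u\<^sup>2 / 12) / c \<le> V * (1 + cos t) / c"
      using assms by (intro divide_right_mono) auto
    then have "exp (- (V * (1 + cos t) / c)) \<le> exp (- (V * u\<^sup>2 / (12 * c)))"
      by (simp add: mult.commute)
    also have "\<dots> \<le> 12 * c * (1 / (1 + V * u\<^sup>2))"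
      using assms by (intro exp_minus_le_lorentz) auto
    finally show ?thesis .
  qed
  have nonneg: "0 \<le> 12 * c * (1 / (1 + V * u\<^sup>2))" for u
    using assms by simp
  show ?thesis
  proof (cases "0 \<le> t")
    case True
    then have "exp (- (V * (1 + cos t) / c)) \<le> 12 * c * (1 / (1 + V * (t - pi)\<^sup>2))"
      using assms by (intro *) auto
    then show ?thesis
      using nonneg[of "t - (- pi)"] unfolding distrib_left by linarith
  next
    case False
    then have "exp (- (V * (1 + cos t) / c)) \<le> 12 * c * (1 / (1 + V * (t - (- pi))\<^sup>2))"
      using assms by (intro *) auto
    then show ?thesis
      using nonneg[of "t - pi"] unfolding distrib_left by linarith
  qed
qed

lemma powr_V_identities:
  fixes V :: real
  assumes "V \<ge> 1"
  shows "V powr (- 1 / 4) / sqrt V = V powr (- 3 / 4)"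
    and "1 / V \<le> V powr (- 3 / 4)"
    and "(V powr (- 1 / 4))\<^sup>2 = 1 / sqrt V"
proof -
  have s: "sqrt V = V powr (1 / 2)"
    using assms by (simp add: powr_half_sqrt)
  show "V powr (- 1 / 4) / sqrt V = V powr (- 3 / 4)"
    unfolding s powr_diff[symmetric] by simp
  have "V powr (-1) \<le> V powr (- 3 / 4)"
    using assms by (intro powr_mono) auto
  moreover have "V powr (-1) = 1 / V"
    using assms powr_minus_divide[of V 1] by simp
  ultimately show "1 / V \<le> V powr (- 3 / 4)"
    by simp
  have "(V powr (- 1 / 4))\<^sup>2 = V powr (- 1 / 4 + - 1 / 4)"
    unfolding power2_eq_square powr_add ..
  also have "\<dots> = V powr (- (1 / 2))"
    by simp
  also have "\<dots> = 1 / sqrt V"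
    unfolding powr_minus_divide s ..
  finally show "(V powr (- 1 / 4))\<^sup>2 = 1 / sqrt V" .
qed

text \<open>Its square is \<open>81 * 2880 ^ 4\<close>, which covers the
  \<open>22 * 3 * 2880 ^ 4\<close> arising in \<open>near_product_le\<close>.\<close>

definition near_const :: real where
  "near_const = 9 * 2880\<^sup>2"

text \<open>In the scale \<open>y = sqrt V * \<bar>t\<bar>\<close> the first factor is
  \<open>1 / sqrt V\<close> times a quantity of order \<open>s ^ 2\<close>, where
  \<open>s = 1 + y ^ 2\<close>, and the exponential beats any power of \<open>s\<close>.\<close>

lemma near_product_le:
  fixes V t :: real
  assumes V: "V \<ge> 1"
  shows "(t\<^sup>2 + 10 * V * \<bar>t\<bar> ^ 3) * (2 * exp (- (V * t\<^sup>2 / 720))) \<le>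
    (near_const * V powr (- 1 / 4) * (1 / (1 + V * t\<^sup>2)))\<^sup>2"
proof -
  define y where "y = sqrt V * \<bar>t\<bar>"
  define s where "s = 1 + y\<^sup>2"
  have y: "0 \<le> y" "y\<^sup>2 = V * t\<^sup>2"
    using V by (auto simp: y_def power_mult_distrib)
  have s: "1 \<le> s"
    by (simp add: s_def)
  have sV: "1 \<le> sqrt V" "sqrt V * sqrt V = V"
    using V by auto
  have y_le: "y \<le> s" "y\<^sup>2 \<le> s"
  proof -
    have "0 \<le> (y - 1)\<^sup>2"
      by simp
    then have "2 * y \<le> 1 + y\<^sup>2"
      by (simp add: power2_eq_square algebra_simps)
    then show "y \<le> s"
      using y by (simp add: s_def)
  qed (simp add: s_def)
  have A1: "sqrt V * t\<^sup>2 \<le> s\<^sup>2"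
  proof -
    have "sqrt V * t\<^sup>2 \<le> V * t\<^sup>2"
      using mult_left_mono[OF sV(1), of "sqrt V"] sV V by (intro mult_right_mono) auto
    also have "\<dots> \<le> s * 1"
      using y_le y by simp
    also have "\<dots> \<le> s * s"
      using s by (intro mult_left_mono) auto
    finally show ?thesis
      by (simp add: power2_eq_square)
  qed
  have A2: "sqrt V * (V * \<bar>t\<bar> ^ 3) \<le> s\<^sup>2"
  proof -
    have "sqrt V * (V * \<bar>t\<bar> ^ 3) = y * (V * t\<^sup>2)"
    proof -
      have "\<bar>t\<bar> ^ 3 = \<bar>t\<bar> * \<bar>t\<bar>\<^sup>2"
        by (simp only: power2_eq_square power3_eq_cube mult.assoc)
      then show ?thesis
        by (simp add: y_def)
    qed
    also have "\<dots> = y * y\<^sup>2"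
      by (simp only: y(2))
    also have "\<dots> \<le> s * s"
      using y_le y s by (intro mult_mono zero_le_power2) auto
    finally show ?thesis
      by (simp add: power2_eq_square)
  qed
  have "sqrt V * (t\<^sup>2 + 10 * V * \<bar>t\<bar> ^ 3) = sqrt V * t\<^sup>2 + 10 * (sqrt V * (V * \<bar>t\<bar> ^ 3))"
    by (simp add: algebra_simps)
  also have "\<dots> \<le> 11 * s\<^sup>2"
    using A1 A2 by simp
  finally have A: "t\<^sup>2 + 10 * V * \<bar>t\<bar> ^ 3 \<le> 11 * s\<^sup>2 / sqrt V"
    using sV by (simp add: field_simps)
  \<comment> \<open>Two powers of \<open>s\<close> come from the first factor and two from the
    squared Lorentz profile; 2880 is \<open>4 * 720\<close>, so that a fourth power of the
    exponential inequality restores the rate \<open>1 / 720\<close>.\<close>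
  have E: "exp (- (V * t\<^sup>2 / 720)) * s ^ 4 \<le> 3 * 2880 ^ 4"
  proof -
    have "s / 2880 \<le> exp (s / 2880)"
      using exp_ge_add_one_self[of "s / 2880"] by linarith
    then have "(s / 2880) ^ 4 \<le> exp (s / 2880) ^ 4"
      using s by (intro power_mono) auto
    also have "exp (s / 2880) ^ 4 = exp (s / 720)"
      by (simp add: exp_of_nat_mult[symmetric])
    finally have "s ^ 4 \<le> 2880 ^ 4 * exp (s / 720)"
      by (simp add: power_divide)
    then have "exp (- (V * t\<^sup>2 / 720)) * s ^ 4 \<le> exp (- (V * t\<^sup>2 / 720)) * (2880 ^ 4 * exp (s / 720))"
      by (intro mult_left_mono) auto
    also have "\<dots> = 2880 ^ 4 * exp (1 / 720)"
      by (simp add: mult_exp_exp s_def y(2) add_divide_distrib)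
    also have "exp (1 / 720) \<le> (3 :: real)"
      using exp_le exp_le_cancel_iff[of "1 / 720" 1] by linarith
    finally show ?thesis
      by simp
  qed
  have "(t\<^sup>2 + 10 * V * \<bar>t\<bar> ^ 3) * (2 * exp (- (V * t\<^sup>2 / 720))) * s\<^sup>2 \<le>
      (11 * s\<^sup>2 / sqrt V) * (2 * exp (- (V * t\<^sup>2 / 720))) * s\<^sup>2"
    using A by (intro mult_right_mono) auto
  also have "\<dots> = 22 / sqrt V * (exp (- (V * t\<^sup>2 / 720)) * s ^ 4)"
    by (simp add: power2_eq_square power4_eq_xxxx)
  also have "\<dots> \<le> 22 / sqrt V * (3 * 2880 ^ 4)"
    using E sV by (intro mult_left_mono) auto
  also have "\<dots> \<le> near_const\<^sup>2 * (1 / sqrt V)"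
    using sV unfolding near_const_def by (simp add: divide_right_mono)
  also have "\<dots> = (near_const * V powr (- 1 / 4))\<^sup>2"
    by (simp only: powr_V_identities(3)[OF V] power_mult_distrib)
  finally have "(t\<^sup>2 + 10 * V * \<bar>t\<bar> ^ 3) * (2 * exp (- (V * t\<^sup>2 / 720))) \<le> (near_const * V powr (- 1 / 4))\<^sup>2 / s\<^sup>2"
    using s by (simp add: pos_le_divide_eq)
  moreover have "x\<^sup>2 / s\<^sup>2 = (x * (1 / s))\<^sup>2" for x
    by (simp add: power_divide)
  moreover have "s = 1 + V * t\<^sup>2"
    by (simp only: s_def y(2))
  ultimately show ?thesis
    by (simp only:)
qed

text \<open>The rate \<open>1 / 720\<close> combines the decay rate \<open>1 / 60\<close> with
  \<open>1 - cos t \<ge> t ^ 2 / 12\<close>. The translated Poisson law decays at least as fast,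
  hence the factor 2 before the exponential.\<close>

lemma chf_diff_le:
  fixes n :: nat and p t :: real
  assumes p: "0 < p" "p \<le> 1 / 2" and n: "n \<ge> 1" and V1: "W_var n p \<ge> 1" and t: "\<bar>t\<bar> \<le> pi"
  defines "V \<equiv> W_var n p" and "m \<equiv> (real n - 1 / 2) * (- ln (1 - p))"
  shows "norm (iso_chf n p t - TP_chf (iso_mean n p) V t) \<le>
    near_const * V powr (- 1 / 4) * (1 / (1 + V * (t - 0)\<^sup>2)) + (decay_error n m t + 402 * V powr (- 3 / 4))"
proof (rule le_geometric_mean_plus)
  obtain k where k: "n = Suc k"
    using n by (cases n) auto
  have V1: "V \<ge> 1"
    using V1 by (simp add: V_def)
  show "norm (iso_chf n p t - TP_chf (iso_mean n p) V t) \<le> t\<^sup>2 + 10 * V * \<bar>t\<bar> ^ 3"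
    using iso_chf_near_TP[of p k t] p V1 by (simp add: k V_def)
  have exp_le: "exp (- (V * (1 - cos t) / 60)) \<le> exp (- (V * t\<^sup>2 / 720))"
    using mult_left_mono[OF one_minus_cos_ge[OF t], of V] V1 by simp
  have "norm (TP_chf (iso_mean n p) V t) \<le> exp (- (V * (1 - cos t)))"
    using V1 by (intro norm_TP_chf_le) auto
  also have "\<dots> \<le> exp (- (V * (1 - cos t) / 60))"
    using mult_nonneg_nonneg[of V "1 - cos t"] V1 by simp
  finally have TP: "norm (TP_chf (iso_mean n p) V t) \<le> exp (- (V * t\<^sup>2 / 720))"
    using exp_le by linarith
  have "norm (iso_chf n p t) \<le> exp (- (V * (1 - cos t) / 60)) + decay_error n m t + 402 * V powr (- 3 / 4)"
    unfolding V_def m_def using V1 by (intro iso_chf_decay p n) (simp add: V_def)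
  then show "norm (iso_chf n p t - TP_chf (iso_mean n p) V t) \<le>
      2 * exp (- (V * t\<^sup>2 / 720)) + (decay_error n m t + 402 * V powr (- 3 / 4))"
    using norm_triangle_ineq4[of "iso_chf n p t" "TP_chf (iso_mean n p) V t"] TP exp_le by linarith
  show "(t\<^sup>2 + 10 * V * \<bar>t\<bar> ^ 3) * (2 * exp (- (V * t\<^sup>2 / 720))) \<le>
      (near_const * V powr (- 1 / 4) * (1 / (1 + V * (t - 0)\<^sup>2)))\<^sup>2"
    using near_product_le[OF V1, of t] by simp
qed (use assms in \<open>auto simp: decay_error_def near_const_def\<close>)

lemma continuous_on_iso_chf: "continuous_on A (iso_chf n p)"
  unfolding iso_chf_eq_sum[abs_def] by (intro continuous_intros)

lemma continuous_on_TP_chf: "continuous_on A (TP_chf m V)"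
  unfolding TP_chf_def[abs_def] Let_def by (intro continuous_intros)

lemma pmf_diff_integral:
  assumes "0 \<le> p" "p \<le> 1" "V \<ge> 0"
  shows "((\<lambda>t. cis (- (of_int j * t)) * (iso_chf n p t - TP_chf m V t)) has_integral
     2 * of_real pi * of_real (W_pmf n p j - TP_pmf m V j)) {-pi..pi}"
  using has_integral_diff[OF W_pmf_fourier[OF assms(1,2)] TP_pmf_fourier[OF assms(3)]]
  by (simp add: algebra_simps)

text \<open>The two shapes of the mirror term are covered by \<open>B\<close> and \<open>R\<close>:
  uniformly small in dense graphs (\<open>B = 0\<close>), concentrated at \<open>pi\<close> and
  \<open>- pi\<close> in sparse ones (\<open>R = 0\<close>), where integration gains
  \<open>1 / sqrt V\<close>.\<close>

lemma pmf_diff_le: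
  fixes n :: nat and p :: real and j :: int
  assumes p: "0 < p" "p \<le> 1 / 2" and n: "n \<ge> 1" and V1: "W_var n p \<ge> 1"
  defines "V \<equiv> W_var n p" and "m \<equiv> (real n - 1 / 2) * (- ln (1 - p))"
  assumes B: "B \<ge> 0"
    and decay: "\<And>t. \<bar>t\<bar> \<le> pi \<Longrightarrow> decay_error n m t \<le>
        B * (1 / (1 + V * (t - pi)\<^sup>2) + 1 / (1 + V * (t - (- pi))\<^sup>2)) + R"
  shows "\<bar>W_pmf n p j - TP_pmf (iso_mean n p) V j\<bar> \<le> (near_const + 402) * V powr (- 3 / 4) + B / sqrt V + R"
proof -
  define f where "f t = cis (- (of_int j * t)) * (iso_chf n p t - TP_chf (iso_mean n p) V t)" for t
  define A where "A = near_const * V powr (- 1 / 4)"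
  have V1: "V \<ge> 1"
    using V1 by (simp add: V_def)
  have "norm (integral {-pi..pi} f) \<le> (A + 2 * B) * (pi / sqrt V) + 2 * pi * (R + 402 * V powr (- 3 / 4))"
  proof (rule norm_integral_le_lorentz)
    show "continuous_on {- pi..pi} f"
      unfolding f_def by (intro continuous_intros continuous_on_iso_chf continuous_on_TP_chf)
    fix t :: real assume t: "\<bar>t\<bar> \<le> pi"
    have "norm (f t) \<le> A * (1 / (1 + V * (t - 0)\<^sup>2)) + (decay_error n m t + 402 * V powr (- 3 / 4))"
      using chf_diff_le[OF p n _ t] V1 by (simp add: f_def norm_mult A_def V_def m_def)
    then show "norm (f t) \<le> A * (1 / (1 + V * (t - 0)\<^sup>2)) +
        B * (1 / (1 + V * (t - pi)\<^sup>2) + 1 / (1 + V * (t - (- pi))\<^sup>2)) + (R + 402 * V powr (- 3 / 4))"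
      using decay[OF t] by linarith
  qed (use V1 B in \<open>auto simp: A_def near_const_def\<close>)
  moreover have "norm (integral {-pi..pi} f) = 2 * pi * \<bar>W_pmf n p j - TP_pmf (iso_mean n p) V j\<bar>"
  proof -
    have "(f has_integral 2 * of_real pi * of_real (W_pmf n p j - TP_pmf (iso_mean n p) V j)) {-pi..pi}"
      unfolding f_def using p V1 by (intro pmf_diff_integral) auto
    then show ?thesis
      by (simp only: integral_unique norm_mult norm_of_real) simp
  qed
  moreover have "(A + 2 * B) * (pi / sqrt V) + 2 * pi * (R + 402 * V powr (- 3 / 4)) =
      2 * pi * (near_const / 2 * (V powr (- 1 / 4) / sqrt V) + B / sqrt V + (R + 402 * V powr (- 3 / 4)))"
    by (simp add: A_def algebra_simps add_divide_distrib)
  ultimately have "\<bar>W_pmf n p j - TP_pmf (iso_mean n p) V j\<bar> \<le>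
      near_const / 2 * (V powr (- 1 / 4) / sqrt V) + B / sqrt V + (R + 402 * V powr (- 3 / 4))"
    by (simp only: mult_le_cancel_left_pos pi_gt_zero zero_less_numeral mult_pos_pos)
  also have "\<dots> = (near_const / 2 + 402) * V powr (- 3 / 4) + B / sqrt V + R"
    by (simp only: powr_V_identities[OF V1]) (simp add: algebra_simps)
  also have "(near_const / 2 + 402) * V powr (- 3 / 4) \<le> (near_const + 402) * V powr (- 3 / 4)"
    by (intro mult_right_mono) (auto simp: near_const_def)
  finally show ?thesis
    by simp
qed

text \<open>Averaging two neighbouring masses multiplies the integrand by \<open>(1 + cis t) / 2\<close>, which vanishes
  at \<open>t = pi\<close> and \<open>t = - pi\<close>, where the characteristic function of \<open>W\<close> need not be small.\<close>

lemma pmf_pair_diff_le: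
  fixes n :: nat and p :: real and j :: int
  assumes p: "0 < p" "p \<le> 1 / 2" and n: "n \<ge> 1" and V1: "W_var n p \<ge> 1"
  defines "V \<equiv> W_var n p" and "m \<equiv> (real n - 1 / 2) * (- ln (1 - p))"
  assumes decay: "\<And>t. decay_error n m t \<le> 2 * exp (- (V * (1 + cos t) / 1080))"
  defines "D \<equiv> \<lambda>j. W_pmf n p j - TP_pmf (iso_mean n p) V j"
  shows "\<bar>D (j + 1) + D j\<bar> / 2 \<le> (near_const + 402 + 4320 * 25920) * V powr (- 3 / 4)"
proof -
  define F where "F t = iso_chf n p t - TP_chf (iso_mean n p) V t" for t
  define f where "f t = cis (- (of_int (j + 1) * t)) * F t + cis (- (of_int j * t)) * F t" for t
  define A where "A = near_const * V powr (- 1 / 4)"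
  define B :: real where "B = 4 * 2160 * 25920 / sqrt V"
  have V1: "V \<ge> 1"
    using V1 by (simp add: V_def)
  have "norm (integral {-pi..pi} f) \<le> (2 * A + 2 * B) * (pi / sqrt V) + 2 * pi * (2 * 402 * V powr (- 3 / 4))"
  proof (rule norm_integral_le_lorentz)
    show "continuous_on {- pi..pi} f"
      unfolding f_def F_def by (intro continuous_intros continuous_on_iso_chf continuous_on_TP_chf)
    fix t :: real assume t: "\<bar>t\<bar> \<le> pi"
    define s where "s = 1 + cos t"
    define L where "L = 1 / (1 + V * (t - pi)\<^sup>2) + 1 / (1 + V * (t - (- pi))\<^sup>2)"
    define P where "P = near_const * V powr (- 1 / 4) * (1 / (1 + V * (t - 0)\<^sup>2)) + 402 * V powr (- 3 / 4)"
    have s: "0 \<le> s"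
      using cos_ge_minus_one[of t] unfolding s_def by linarith
    have P: "0 \<le> P"
      using V1 by (simp add: P_def near_const_def)
    have F: "norm (F t) \<le> P + decay_error n m t"
      using chf_diff_le[OF p n _ t] V1 by (simp add: F_def P_def V_def m_def)
    have "norm (1 + cis t) \<le> 2 * sqrt s"
    proof -
      have "(norm (1 + cis t))\<^sup>2 = (1 + cos t)\<^sup>2 + (sin t)\<^sup>2"
        by (simp add: cmod_power2)
      also have "\<dots> = 2 * s"
        unfolding sin_squared_eq s_def by (simp add: power2_eq_square algebra_simps)
      also have "\<dots> \<le> (2 * sqrt s)\<^sup>2"
        using s by (simp add: power_mult_distrib)
      finally show ?thesis
        by (rule power2_le_imp_le) (use s in simp)
    qed
    moreover have "norm (1 + cis t) \<le> 2"
      using norm_triangle_ineq[of 1 "cis t"] by simp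
    moreover have "f t = cis (- (of_int (j + 1) * t)) * (1 + cis t) * F t"
      by (simp add: f_def cis_mult algebra_simps)
    then have "norm (f t) = norm (1 + cis t) * norm (F t)"
      by (simp add: norm_mult)
    ultimately have f: "norm (f t) \<le> 2 * P + 2 * sqrt s * decay_error n m t"
    proof -
      have "norm (1 + cis t) * norm (F t) \<le> norm (1 + cis t) * (P + decay_error n m t)"
        using F by (intro mult_left_mono) auto
      also have "\<dots> = norm (1 + cis t) * P + norm (1 + cis t) * decay_error n m t"
        by (rule distrib_left)
      also have "\<dots> \<le> 2 * P + 2 * sqrt s * decay_error n m t"
        using \<open>norm (1 + cis t) \<le> 2\<close> \<open>norm (1 + cis t) \<le> 2 * sqrt s\<close> P
        by (intro add_mono mult_right_mono) (auto simp: decay_error_def)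
      finally show ?thesis
        using \<open>norm (f t) = _\<close> by simp
    qed
    \<comment> \<open>Half of the exponent is spent on absorbing \<open>sqrt s\<close>, which leaves
      a factor \<open>1 / sqrt V\<close>. Integrating the remaining half gives a second one, hence
      \<open>1 / V\<close> in total.\<close>
    have "sqrt (V * s) \<le> 2160 * exp (V * s / 2160)"
    proof -
      have "(1 + V * s)\<^sup>2 \<ge> V * s"
        using V1 s by (simp add: power2_eq_square algebra_simps)
      then have "sqrt (V * s) \<le> 1 + V * s"
        using V1 s by (intro real_le_lsqrt) auto
      also have "\<dots> \<le> 2160 * (1 + V * s / 2160)"
        by simp
      also have "\<dots> \<le> 2160 * exp (V * s / 2160)"
        by (intro mult_left_mono exp_ge_add_one_self) auto
      finally show ?thesis .
    qed
    then have "sqrt s \<le> 2160 / sqrt V * exp (V * s / 2160)"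
      using V1 by (simp add: real_sqrt_mult field_simps)
    then have "sqrt s * exp (- (V * s / 1080)) \<le> 2160 / sqrt V * exp (V * s / 2160) * exp (- (V * s / 1080))"
      by (intro mult_right_mono) auto
    also have "\<dots> = 2160 / sqrt V * exp (- (V * s / 2160))"
      by (simp add: mult.assoc mult_exp_exp)
    also have "\<dots> \<le> 2160 / sqrt V * (12 * 2160 * L)"
      using V1 t unfolding s_def L_def by (intro mult_left_mono exp_minus_one_plus_cos_le) auto
    finally have "2 * sqrt s * (2 * exp (- (V * s / 1080))) \<le> B * L"
      by (simp add: B_def)
    moreover have "2 * sqrt s * decay_error n m t \<le> 2 * sqrt s * (2 * exp (- (V * s / 1080)))"
      using decay[of t] s unfolding s_def by (intro mult_left_mono) auto
    ultimately have "norm (f t) \<le> 2 * P + B * L"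
      using f by linarith
    then show "norm (f t) \<le> 2 * A * (1 / (1 + V * (t - 0)\<^sup>2)) +
        B * (1 / (1 + V * (t - pi)\<^sup>2) + 1 / (1 + V * (t - (- pi))\<^sup>2)) + 2 * 402 * V powr (- 3 / 4)"
      unfolding L_def P_def A_def by (simp add: algebra_simps)
  qed (use V1 in \<open>auto simp: A_def B_def near_const_def\<close>)
  moreover have "norm (integral {-pi..pi} f) = 2 * pi * \<bar>D (j + 1) + D j\<bar>"
  proof -
    have "(f has_integral 2 * of_real pi * of_real (D (j + 1)) + 2 * of_real pi * of_real (D j)) {-pi..pi}"
      unfolding f_def F_def D_def using p V1 by (intro has_integral_add pmf_diff_integral) auto
    then have "integral {-pi..pi} f = of_real (2 * pi * (D (j + 1) + D j))"
      by (simp add: integral_unique algebra_simps)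
    then show ?thesis
      by (simp only: norm_of_real abs_mult) simp
  qed
  moreover have "(2 * A + 2 * B) * (pi / sqrt V) + 2 * pi * (2 * 402 * V powr (- 3 / 4)) =
      2 * pi * (near_const * (V powr (- 1 / 4) / sqrt V) + 2 * (4320 * 25920) * (1 / (sqrt V * sqrt V)) + 2 * 402 * V powr (- 3 / 4))"
    by (simp add: A_def B_def algebra_simps add_divide_distrib)
  ultimately have "\<bar>D (j + 1) + D j\<bar> \<le>
      near_const * (V powr (- 1 / 4) / sqrt V) + 2 * (4320 * 25920) * (1 / (sqrt V * sqrt V)) + 2 * 402 * V powr (- 3 / 4)"
    by (simp only: mult_le_cancel_left_pos pi_gt_zero zero_less_numeral mult_pos_pos)
  also have "\<dots> = near_const * V powr (- 3 / 4) + 2 * (4320 * 25920) * (1 / V) + 2 * 402 * V powr (- 3 / 4)"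
    using V1 by (simp only: powr_V_identities[OF V1]) simp
  also have "\<dots> \<le> 2 * (near_const * V powr (- 3 / 4)) + 2 * (4320 * 25920) * V powr (- 3 / 4) + 2 * 402 * V powr (- 3 / 4)"
    using powr_V_identities(2)[OF V1] by (intro add_mono mult_left_mono) (auto simp: near_const_def)
  finally show ?thesis
    by (simp add: algebra_simps)
qed

section \<open>From mass differences to the local distances\<close>

text \<open>The absolute value is what the Landau symbols require. Nonnegativity of the supremum is
  read off at \<open>j = 0\<close>, and for that the family must be known to be bounded
  above.\<close>

lemma d_loc_m_le:
  assumes "\<And>j. \<bar>Delta (smooth_cdf k F) j - Delta (smooth_cdf k G) j\<bar> \<le> B"
  shows "\<bar>d_loc_m k F G\<bar> \<le> B"
proof -
  let ?f = "\<lambda>j. \<bar>Delta (smooth_cdf k F) j - Delta (smooth_cdf k G) j\<bar>"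
  have "d_loc_m k F G \<le> B"
    unfolding d_loc_m_def by (rule cSUP_least) (use assms in auto)
  moreover have "bdd_above (range ?f)"
    using assms by (intro bdd_aboveI2)
  then have "?f 0 \<le> d_loc_m k F G"
    unfolding d_loc_m_def by (intro cSUP_upper) auto
  ultimately show ?thesis
    by linarith
qed

lemma d_loc_1_le:
  assumes "\<And>j. \<bar>W_pmf n p j - TP_pmf m V j\<bar> \<le> B"
  shows "\<bar>d_loc (W_cdf n p) (TP_cdf m V)\<bar> \<le> B"
proof (rule d_loc_m_le)
  fix j
  have "Delta (smooth_cdf 1 F) j = F (j + 1) - F j" for F
    by (simp add: Delta_def smooth_cdf_def)
  then show "\<bar>Delta (smooth_cdf 1 (W_cdf n p)) j - Delta (smooth_cdf 1 (TP_cdf m V)) j\<bar> \<le> B"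
    using assms[of "j + 1"] by (simp add: W_cdf_diff TP_cdf_diff)
qed

lemma d_loc_2_le:
  assumes "\<And>j. \<bar>(W_pmf n p (j + 1) - TP_pmf m V (j + 1)) + (W_pmf n p j - TP_pmf m V j)\<bar> / 2 \<le> B"
  shows "\<bar>d_loc_m 2 (W_cdf n p) (TP_cdf m V)\<bar> \<le> B"
proof (rule d_loc_m_le)
  fix j
  have "{..<2 :: nat} = {0, 1}"
    by auto
  then have "smooth_cdf 2 F i = (F i + F (i - 1)) / 2" for F i
    by (simp add: smooth_cdf_def)
  then have *: "Delta (smooth_cdf 2 F) j = ((F (j + 1) - F j) + (F j - F (j - 1))) / 2" for F
    by (simp add: Delta_def diff_divide_distrib add_divide_distrib)
  have "W_cdf n p j - W_cdf n p (j - 1) = W_pmf n p j" "TP_cdf m V j - TP_cdf m V (j - 1) = TP_pmf m V j"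
    using W_cdf_diff[of n p "j - 1"] TP_cdf_diff[of m V "j - 1"] by simp_all
  then have "Delta (smooth_cdf 2 (W_cdf n p)) j - Delta (smooth_cdf 2 (TP_cdf m V)) j =
      ((W_pmf n p (j + 1) - TP_pmf m V (j + 1)) + (W_pmf n p j - TP_pmf m V j)) / 2"
    unfolding * W_cdf_diff TP_cdf_diff by (simp add: diff_divide_distrib add_divide_distrib)
  then show "\<bar>Delta (smooth_cdf 2 (W_cdf n p)) j - Delta (smooth_cdf 2 (TP_cdf m V)) j\<bar> \<le> B"
    using assms[of j] by simp
qed

subsection \<open>The dense and the sparse regime\<close>

lemma W_var_eq: "n \<ge> 1 \<Longrightarrow> W_var n p =
    real n * (1 - p) ^ (n - 1) * (1 - (1 - p) ^ (n - 1) + p * iso_mean (n - 1) p)"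
  by (cases n) (simp_all add: W_var_Suc iso_mean_Suc)

lemma W_var_le_linear:
  assumes "0 \<le> p" "p \<le> 1" "n \<ge> 1"
  shows "W_var n p \<le> 2 * (real n * (1 - p) ^ (n - 1))"
proof -
  have "0 \<le> (1 - p) ^ (n - 1)"
    using assms by simp
  then have "W_var n p \<le> real n * (1 - p) ^ (n - 1) * 2"
    unfolding W_var_eq[OF assms(3)] using p_iso_mean_le_1[OF assms(1,2), of "n - 1"]
    by (intro mult_left_mono) auto
  then show ?thesis
    by simp
qed

lemma dense_variance_bounds:
  assumes p: "0 \<le> p" "p \<le> 1 / 2" and n: "n \<ge> 2" and np: "c \<le> real n * p" "real n * p \<le> ln (real n)" and c: "c \<ge> 0"
  shows "W_var n p \<le> 6 * (real n * exp (- (real n * p)))"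
    and "exp (- 8) * (1 - exp (- (c / 2))) * (real n * exp (- (real n * p))) \<le> W_var n p"
proof -
  define Q where "Q = (1 - p) ^ (n - 1)"
  have n1: "real (n - 1) = real n - 1"
    using n by simp
  have Q0: "0 \<le> Q"
    using p by (simp add: Q_def)
  have "1 - p \<le> exp (- p)"
    using exp_ge_add_one_self[of "- p"] by simp
  then have "Q \<le> exp (- p) ^ (n - 1)"
    unfolding Q_def using p by (intro power_mono) auto
  also have "\<dots> = exp (- (real (n - 1) * p))"
    by (simp only: exp_of_nat_mult[symmetric]) simp
  finally have Q_le: "Q \<le> exp (- (real (n - 1) * p))" .
  also have "\<dots> = exp p * exp (- (real n * p))"
    unfolding n1 mult_exp_exp by (simp add: algebra_simps)
  also have "\<dots> \<le> 3 * exp (- (real n * p))"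
  proof (rule mult_right_mono)
    have "exp p \<le> exp 1"
      using p by simp
    then show "exp p \<le> 3"
      using exp_le by linarith
  qed simp
  finally have "real n * Q \<le> real n * (3 * exp (- (real n * p)))"
    by (intro mult_left_mono) auto
  then show "W_var n p \<le> 6 * (real n * exp (- (real n * p)))"
    using W_var_le_linear[of p n] p n unfolding Q_def[symmetric] by linarith
  have Q_ge: "exp (- 8) * exp (- (real n * p)) \<le> Q"
  proof -
    have "exp (- p - 2 * p\<^sup>2) \<le> 1 - p"
    proof -
      have "- p - 2 * p\<^sup>2 \<le> ln (1 - p)"
        using p by (intro ln_one_minus_pos_lower_bound)
      then have "exp (- p - 2 * p\<^sup>2) \<le> exp (ln (1 - p))"
        by simp
      then show ?thesis
        using p by simp
    qed
    then have "exp (- p - 2 * p\<^sup>2) ^ (n - 1) \<le> Q"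
      unfolding Q_def by (intro power_mono) auto
    moreover have "exp (- p - 2 * p\<^sup>2) ^ (n - 1) = exp (real (n - 1) * (- p - 2 * p\<^sup>2))"
      by (rule exp_of_nat_mult[symmetric])
    \<comment> \<open>The condition \<open>n * p \<le> ln n\<close> enters here:
      \<open>ln n \<le> 2 * sqrt n\<close> makes \<open>n * p ^ 2\<close> at most 4, so the
      quadratic term of \<open>ln (1 - p)\<close> costs at most \<open>2 * 4\<close>.\<close>
    moreover have "- 8 - real n * p \<le> real (n - 1) * (- p - 2 * p\<^sup>2)"
    proof -
      have "ln (real n) = 2 * ln (sqrt (real n))"
        using n by (simp add: ln_sqrt)
      also have "\<dots> \<le> 2 * sqrt (real n)"
        using ln_le_minus_one[of "sqrt (real n)"] n by simp
      finally have "(real n * p)\<^sup>2 \<le> (2 * sqrt (real n))\<^sup>2"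
        using np p by (intro power_mono) auto
      also have "(2 * sqrt (real n))\<^sup>2 = real n * 4"
        by (simp add: power_mult_distrib)
      finally have "real n * (real n * p\<^sup>2) \<le> real n * 4"
        by (simp add: power_mult_distrib power2_eq_square mult_ac)
      then have "real n * p\<^sup>2 \<le> 4"
        using n by simp
      then have "real (n - 1) * (p + 2 * p\<^sup>2) \<le> real n * p + 8"
        using p mult_right_mono[of "real (n - 1)" "real n" "p + 2 * p\<^sup>2"] by (simp add: distrib_left)
      then show ?thesis
        by (simp add: algebra_simps)
    qed
    then have "exp (- 8 - real n * p) \<le> exp (real (n - 1) * (- p - 2 * p\<^sup>2))"
      by simp
    moreover have "exp (- 8) * exp (- (real n * p)) = exp (- 8 - real n * p)"
      by (simp add: mult_exp_exp)
    ultimately show ?thesis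
      by linarith
  qed
  have one_minus_Q: "1 - exp (- (c / 2)) \<le> 1 - Q"
  proof -
    have "real n / 2 * p \<le> real (n - 1) * p"
      using n p by (intro mult_right_mono) auto
    then have "exp (- (real (n - 1) * p)) \<le> exp (- (c / 2))"
      using np by simp
    then show ?thesis
      using Q_le by linarith
  qed
  have "exp (- 8) * (1 - exp (- (c / 2))) * (real n * exp (- (real n * p))) =
      real n * (exp (- 8) * exp (- (real n * p))) * (1 - exp (- (c / 2)))"
    by simp
  also have "\<dots> \<le> real n * Q * (1 - Q + p * iso_mean (n - 1) p)"
  proof -
    have "0 \<le> p * iso_mean (n - 1) p"
      using p iso_mean_nonneg by (intro mult_nonneg_nonneg) auto
    then have "1 - exp (- (c / 2)) \<le> 1 - Q + p * iso_mean (n - 1) p"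
      using one_minus_Q by linarith
    then show ?thesis
      using Q_ge Q0 c by (intro mult_mono mult_left_mono) auto
  qed
  also have "\<dots> = W_var n p"
    using W_var_eq[of n p] n by (simp add: Q_def)
  finally show "exp (- 8) * (1 - exp (- (c / 2))) * (real n * exp (- (real n * p))) \<le> W_var n p" .
qed

lemma sparse_variance_bounds:
  assumes p: "0 \<le> p" "p \<le> 1" and n: "n \<ge> 2" and np: "real n * p \<le> 1 / 2"
  shows "W_var n p \<le> 2 * ((real n)\<^sup>2 * p)" and "(real n)\<^sup>2 * p / 8 \<le> W_var n p"
proof -
  define Q where "Q = (1 - p) ^ (n - 1)"
  have V: "W_var n p = real n * Q * (1 - Q + p * iso_mean (n - 1) p)"
    using W_var_eq[of n p] n by (simp add: Q_def)
  have Q: "0 \<le> Q" "Q \<le> 1"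
    using p by (auto simp: Q_def power_le_one)
  have "1 + real (n - 1) * (- p) \<le> (1 + - p) ^ (n - 1)"
    using p by (intro Bernoulli_inequality) auto
  then have Q1: "1 - Q \<le> real (n - 1) * p"
    by (simp add: Q_def)
  have le_n: "real (n - 1) * p \<le> real n * p"
    using p by (intro mult_right_mono) auto
  have Q2: "1 / 2 \<le> Q"
    using Q1 le_n np by linarith
  have m0: "0 \<le> p * iso_mean (n - 1) p"
    using p iso_mean_nonneg by (intro mult_nonneg_nonneg) auto
  have mean_le: "iso_mean (n - 1) p \<le> real n"
  proof -
    have "real (n - 1) * (1 - p) ^ (n - 1 - 1) \<le> real n * 1"
      using p by (intro mult_mono power_le_one) auto
    then show ?thesis
      by (simp add: iso_mean_def)
  qed
  have "W_var n p \<le> real n * 1 * (real n * p + p * real n)"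
    unfolding V using Q Q1 le_n m0 mean_le p by (intro mult_mono add_mono mult_left_mono) auto
  then show "W_var n p \<le> 2 * ((real n)\<^sup>2 * p)"
    by (simp add: power2_eq_square mult_ac)
  have mean_ge: "real n / 4 \<le> iso_mean (n - 1) p"
  proof -
    have "Q \<le> (1 - p) ^ (n - 1 - 1)"
      unfolding Q_def using p by (intro power_decreasing) auto
    then have "real n / 2 * (1 / 2) \<le> real (n - 1) * (1 - p) ^ (n - 1 - 1)"
      using Q2 n by (intro mult_mono) auto
    then show ?thesis
      by (simp add: iso_mean_def)
  qed
  \<comment> \<open>The term \<open>p * iso_mean (n - 1) p\<close> alone has the right order, so
    \<open>1 - Q\<close> is bounded below by 0.\<close>
  have "real n * (1 / 2) * (0 + p * (real n / 4)) \<le> W_var n p"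
    unfolding V using Q Q2 mean_ge p m0 by (intro mult_mono add_mono mult_left_mono) auto
  then show "(real n)\<^sup>2 * p / 8 \<le> W_var n p"
    by (simp add: power2_eq_square mult_ac)
qed

text \<open>As \<open>m \<ge> c / 2\<close>, the mirror peak is \<open>exp (- (n * d))\<close> up to
  a factor 2. Because \<open>V \<le> 6 * n\<close>, the crude estimate by \<open>1 / (n * d)\<close>
  already gives order \<open>1 / V\<close>.\<close>

lemma d_loc_dense_le:
  fixes n :: nat and p c :: real
  assumes p: "0 < p" "p \<le> 1 / 2" and n: "n \<ge> 2" and c: "c > 0" "c \<le> real n * p"
    and V1: "W_var n p \<ge> 1" and V_le: "W_var n p \<le> 6 * real n"
  defines "d \<equiv> (1 - exp (- c / 4))\<^sup>2 / 4"
  shows "\<bar>d_loc (W_cdf n p) (TP_cdf (W_mean n p) (W_var n p))\<bar> \<le>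
    (near_const + 402 + 12 / d) * W_var n p powr (- 3 / 4)"
proof (rule d_loc_1_le)
  fix j
  define V where "V = W_var n p"
  define m where "m = (real n - 1 / 2) * (- ln (1 - p))"
  have V1: "V \<ge> 1"
    using V1 by (simp add: V_def)
  have d: "d > 0"
    using c by (simp add: d_def)
  have m: "c / 2 \<le> m"
  proof -
    have "real n / 2 * p \<le> m"
      unfolding m_def using minus_ln_one_minus[OF p] n p by (intro mult_mono) auto
    then show ?thesis
      using c by simp
  qed
  have n1: "n \<ge> 1"
    using n by simp
  have "2 * exp (- (real n * d)) \<le> 12 / d * V powr (- 3 / 4)"
  proof -
    have "real n * d \<le> exp (real n * d)"
      using exp_ge_add_one_self[of "real n * d"] by linarith
    then have "1 / exp (real n * d) \<le> 1 / (real n * d)"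
      using d n by (intro divide_left_mono mult_pos_pos) auto
    then have "exp (- (real n * d)) \<le> 1 / (real n * d)"
      by (simp add: exp_minus inverse_eq_divide)
    also have "\<dots> = 6 / d * (1 / (6 * real n))"
      by simp
    also have "\<dots> \<le> 6 / d * (1 / V)"
      using V_le V1 d n by (intro mult_left_mono divide_left_mono) (auto simp: V_def)
    also have "\<dots> \<le> 6 / d * V powr (- 3 / 4)"
      using powr_V_identities(2)[OF V1] d by (intro mult_left_mono) auto
    finally show ?thesis
      by simp
  qed
  moreover have "\<bar>W_pmf n p j - TP_pmf (iso_mean n p) (W_var n p) j\<bar> \<le>
      (near_const + 402) * W_var n p powr (- 3 / 4) + 0 / sqrt (W_var n p) + 2 * exp (- (real n * d))"
  proof (rule pmf_diff_le[OF p n1])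
    fix t
    show "decay_error n ((real n - 1 / 2) * - ln (1 - p)) t \<le>
        0 * (1 / (1 + W_var n p * (t - pi)\<^sup>2) + 1 / (1 + W_var n p * (t - - pi)\<^sup>2)) + 2 * exp (- (real n * d))"
      using decay_error_le_const[OF n _ m, of t] c unfolding m_def d_def by simp
  qed (use V1 in \<open>auto simp: V_def\<close>)
  ultimately show "\<bar>W_pmf n p j - TP_pmf (W_mean n p) (W_var n p) j\<bar> \<le>
      (near_const + 402 + 12 / d) * W_var n p powr (- 3 / 4)"
    by (simp add: W_mean_eq V_def distrib_right)
qed

lemma sparse_offset_le_1:
  assumes "0 < p" "p \<le> 1 / 2" "real n * p \<le> 1 / 4" "n \<ge> 1"
  shows "(real n - 1 / 2) * (- ln (1 - p)) \<le> 1"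
proof -
  have "- p - 2 * p\<^sup>2 \<le> ln (1 - p)"
    using assms by (intro ln_one_minus_pos_lower_bound) auto
  moreover have "p * p \<le> p * (1 / 2)"
    using assms by (intro mult_left_mono) auto
  ultimately have "- ln (1 - p) \<le> 2 * p"
    by (simp add: power2_eq_square)
  moreover have "0 \<le> - ln (1 - p)"
    using assms by simp
  ultimately have "(real n - 1 / 2) * (- ln (1 - p)) \<le> real n * (2 * p)"
    using assms by (intro mult_mono) auto
  then show ?thesis
    using assms by simp
qed

text \<open>Let \<open>q = n * p powr (3 / 4)\<close>, so
  \<open>q ^ 4 = (n ^ 2 * p) * (n * p) ^ 2\<close>. Since \<open>n * p\<close> is at most 1,
  \<open>q\<close> is at most \<open>2 * V powr (1 / 4)\<close> and \<open>V powr (- 3 / 4)\<close>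
  is absorbed in \<open>T\<close>. Since \<open>n ^ 2 * p\<close> is at least 1,
  \<open>q ^ 2 \<le> n ^ 3 * p ^ 2\<close>, so \<open>K * q\<close> is bounded and the parity term
  \<open>K / sqrt V\<close> is absorbed as well.\<close>

lemma d_loc_sparse_le:
  fixes n :: nat and p :: real
  assumes p: "0 < p" "p \<le> 1 / 2" and n: "n \<ge> 2" and np: "real n * p \<le> 1 / 4"
    and np1: "(real n)\<^sup>2 * p \<ge> 1" and V1: "W_var n p \<ge> 1"
  defines "T \<equiv> 1 / (sqrt (W_var n p) * (real n * p powr (3 / 4)))"
  shows "\<bar>d_loc (W_cdf n p) (TP_cdf (W_mean n p) (W_var n p))\<bar> \<le>
    (2 * (near_const + 402) + 25920 * 256) * T"
proof (rule d_loc_1_le)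
  fix j
  define V where "V = W_var n p"
  define m where "m = (real n - 1 / 2) * (- ln (1 - p))"
  define K where "K = exp (- (real n ^ 3 * p\<^sup>2 / 256))"
  define q where "q = real n * p powr (3 / 4)"
  have V1: "V \<ge> 1"
    using V1 by (simp add: V_def)
  have n1: "n \<ge> 1"
    using n by simp
  have m1: "m \<le> 1"
    unfolding m_def using p np n1 by (intro sparse_offset_le_1) auto
  have q: "q > 0"
    using p n by (simp add: q_def)
  have T: "T = 1 / (sqrt V * q)"
    by (simp add: T_def V_def q_def)
  have q4: "q ^ 4 = ((real n)\<^sup>2 * p) * (real n * p)\<^sup>2"
  proof -
    have "(p powr (3 / 4)) ^ 4 = p ^ 3"
      using p powr_realpow[of p 3] by (simp add: powr_power)
    then have "q ^ 4 = real n ^ 4 * p ^ 3"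
      unfolding q_def by (simp only: power_mult_distrib)
    then show ?thesis
      by (simp only: power_mult_distrib power2_eq_square power3_eq_cube power4_eq_xxxx mult_ac)
  qed
  have first: "V powr (- 3 / 4) \<le> 2 * T"
  proof -
    have "(real n * p)\<^sup>2 \<le> 1"
      using np p by (intro power_le_one) auto
    then have "q ^ 4 \<le> ((real n)\<^sup>2 * p) * 1"
      unfolding q4 using p by (intro mult_left_mono) auto
    also have "\<dots> \<le> 8 * V"
      using sparse_variance_bounds(2)[of p n] p n np unfolding V_def by simp
    also have "\<dots> \<le> (2 * V powr (1 / 4)) ^ 4"
      using V1 by (simp add: power_mult_distrib powr_power)
    finally have "q ^ 4 \<le> (2 * V powr (1 / 4)) ^ 4" .
    moreover have "q ^ 4 \<le> (2 * V powr (1 / 4)) ^ 4 \<longleftrightarrow> q \<le> 2 * V powr (1 / 4)"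
      using q by (intro power_mono_iff) auto
    ultimately have "q \<le> 2 * V powr (1 / 4)"
      by blast
    then have "V powr (- 3 / 4) * q \<le> V powr (- 3 / 4) * (2 * V powr (1 / 4))"
      by (intro mult_left_mono) auto
    also have "\<dots> = 2 * V powr (- (1 / 2))"
      by (simp add: powr_add[symmetric])
    also have "\<dots> = 2 / sqrt V"
      using V1 by (simp add: powr_minus_divide powr_half_sqrt)
    finally show ?thesis
      unfolding T using q V1 by (simp add: field_simps)
  qed
  have second: "K / sqrt V \<le> 256 * T"
  proof -
    define y where "y = real n ^ 3 * p\<^sup>2"
    have y: "0 \<le> y"
      by (simp add: y_def)
    have "q ^ 4 * 1 \<le> q ^ 4 * ((real n)\<^sup>2 * p)"
      using np1 by (intro mult_left_mono) auto
    also have "\<dots> = y\<^sup>2"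
      unfolding q4 y_def by (simp only: power_mult_distrib power2_eq_square power3_eq_cube mult_ac)
    finally have "(q\<^sup>2)\<^sup>2 \<le> y\<^sup>2"
      by simp
    then have "q\<^sup>2 \<le> y"
      using y by (rule power2_le_imp_le)
    also have "\<dots> \<le> (1 + y)\<^sup>2"
      using y by (simp add: power2_eq_square algebra_simps)
    finally have "q \<le> 1 + y"
      by (rule power2_le_imp_le) (use y in simp)
    also have "\<dots> \<le> 256 * (1 + y / 256)"
      by simp
    also have "\<dots> \<le> 256 * exp (y / 256)"
      by (intro mult_left_mono exp_ge_add_one_self) auto
    finally have "K * q \<le> K * (256 * exp (y / 256))"
      by (intro mult_left_mono) (auto simp: K_def)
    also have "\<dots> = 256"
      by (simp add: K_def y_def mult_exp_exp)
    finally show ?thesis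
      unfolding T using q V1 by (simp add: field_simps)
  qed
  have "\<bar>W_pmf n p j - TP_pmf (iso_mean n p) (W_var n p) j\<bar> \<le>
      (near_const + 402) * W_var n p powr (- 3 / 4) + 25920 * K / sqrt (W_var n p) + 0"
  proof (rule pmf_diff_le[OF p n1])
    fix t :: real assume t: "\<bar>t\<bar> \<le> pi"
    let ?L = "1 / (1 + W_var n p * (t - pi)\<^sup>2) + 1 / (1 + W_var n p * (t - - pi)\<^sup>2)"
    have "decay_error n m t \<le> 2 * K * exp (- (W_var n p * (1 + cos t) / 1080))"
      using decay_error_le_small[OF p n, of t] m1 unfolding m_def K_def by simp
    also have "\<dots> \<le> 2 * K * (12 * 1080 * ?L)"
      using V1 t by (intro mult_left_mono exp_minus_one_plus_cos_le) (auto simp: V_def K_def)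
    also have "\<dots> = 25920 * K * ?L + 0"
    proof -
      have "2 * K * (12 * 1080 * L) = 25920 * K * L + 0" for L
        by simp
      then show ?thesis .
    qed
    finally show "decay_error n ((real n - 1 / 2) * - ln (1 - p)) t \<le> 25920 * K * ?L + 0"
      unfolding m_def .
  qed (use V1 in \<open>auto simp: V_def K_def\<close>)
  also have "\<dots> = (near_const + 402) * V powr (- 3 / 4) + 25920 * (K / sqrt V)"
    by (simp add: V_def)
  also have "\<dots> \<le> (near_const + 402) * (2 * T) + 25920 * (256 * T)"
    using first second by (intro add_mono mult_left_mono) (auto simp: near_const_def)
  finally show "\<bar>W_pmf n p j - TP_pmf (W_mean n p) (W_var n p) j\<bar> \<le>
      (2 * (near_const + 402) + 25920 * 256) * T"
    by (simp add: W_mean_eq algebra_simps)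
qed

lemma d_loc_2_sparse_le:
  fixes n :: nat and p :: real
  assumes p: "0 < p" "p \<le> 1 / 2" and n: "n \<ge> 2" and np: "real n * p \<le> 1 / 4" and V1: "W_var n p \<ge> 1"
  shows "\<bar>d_loc_m 2 (W_cdf n p) (TP_cdf (W_mean n p) (W_var n p))\<bar> \<le>
    (near_const + 402 + 4320 * 25920) * W_var n p powr (- 3 / 4)"
proof (rule d_loc_2_le)
  fix j
  have n1: "n \<ge> 1"
    using n by simp
  have m1: "(real n - 1 / 2) * (- ln (1 - p)) \<le> 1"
    using p np n1 by (intro sparse_offset_le_1) auto
  show "\<bar>(W_pmf n p (j + 1) - TP_pmf (W_mean n p) (W_var n p) (j + 1)) +
      (W_pmf n p j - TP_pmf (W_mean n p) (W_var n p) j)\<bar> / 2 \<le>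
      (near_const + 402 + 4320 * 25920) * W_var n p powr (- 3 / 4)"
    unfolding W_mean_eq
  proof (rule pmf_pair_diff_le[OF p n1 V1])
    fix t
    \<comment> \<open>The factor in \<open>n ^ 3 * p ^ 2\<close> may be close to 1 and is dropped;
      averaging neighbouring masses compensates for it.\<close>
    have "2 * exp (- (real n ^ 3 * p\<^sup>2 / 256)) * exp (- (W_var n p * (1 + cos t) / 1080)) \<le>
        2 * 1 * exp (- (W_var n p * (1 + cos t) / 1080))"
      by (intro mult_right_mono mult_left_mono) auto
    from order.trans[OF decay_error_le_small[OF p n m1] this] show "decay_error n ((real n - 1 / 2) * - ln (1 - p)) t \<le> 2 * exp (- (W_var n p * (1 + cos t) / 1080))"
      by simp
  qed
qed

section \<open>The asymptotic statement\<close>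

lemma filterlim_at_top_lower_bound:
  assumes "filterlim f at_top F \<or> (\<exists>c>0. (f \<longlongrightarrow> c) F)"
  shows "\<exists>c>0. \<forall>\<^sub>F x in F. c \<le> (f x :: real)"
  using assms
proof
  assume "filterlim f at_top F"
  then show ?thesis
    by (intro exI[of _ 1]) (auto simp: filterlim_at_top)
next
  assume "\<exists>c>0. (f \<longlongrightarrow> c) F"
  then obtain c where c: "c > 0" "(f \<longlongrightarrow> c) F"
    by blast
  then have "\<forall>\<^sub>F x in F. c / 2 < f x"
    by (intro order_tendstoD(1)) auto
  then show ?thesis
    using c by (intro exI[of _ "c / 2"]) (auto elim: eventually_mono)
qed

theorem theorem12:
  fixes p :: "nat \<Rightarrow> real"
  assumes p_prob: "\<And>n. 0 \<le> p n \<and> p n \<le> 1"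
  shows
  "(filterlim (\<lambda>n. ln (real n) - real n * p n) at_top sequentially \<and>
     (filterlim (\<lambda>n. real n * p n) at_top sequentially \<or>
      (\<exists>c>0. (\<lambda>n. real n * p n) \<longlonglongrightarrow> c))
   \<longrightarrow>
     (\<lambda>n. W_var n (p n)) \<in> \<Theta>(\<lambda>n. real n * exp (- (real n * p n))) \<and>
     (\<lambda>n. d_loc (W_cdf n (p n)) (TP_cdf (W_mean n (p n)) (W_var n (p n))))
        \<in> O(\<lambda>n. W_var n (p n) powr (-3/4)))
  \<and>
   ((\<lambda>n. real n * p n) \<longlonglongrightarrow> 0 \<and>
     filterlim (\<lambda>n. (real n)^2 * p n) at_top sequentially
   \<longrightarrow>
     (\<lambda>n. W_var n (p n)) \<in> \<Theta>(\<lambda>n. (real n)^2 * p n) \<and>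
     (\<lambda>n. d_loc (W_cdf n (p n)) (TP_cdf (W_mean n (p n)) (W_var n (p n))))
        \<in> O(\<lambda>n. 1 / (sqrt (W_var n (p n)) * (real n * p n powr (3/4)))) \<and>
     (\<lambda>n. d_loc_m 2 (W_cdf n (p n)) (TP_cdf (W_mean n (p n)) (W_var n (p n))))
        \<in> O(\<lambda>n. W_var n (p n) powr (-3/4)))"
proof (intro conjI[where Q = "_ \<longrightarrow> _"] impI)
  assume A: "filterlim (\<lambda>n. ln (real n) - real n * p n) at_top sequentially \<and>
     (filterlim (\<lambda>n. real n * p n) at_top sequentially \<or> (\<exists>c>0. (\<lambda>n. real n * p n) \<longlonglongrightarrow> c))"
  then obtain c where c: "c > 0" "\<forall>\<^sub>F n in sequentially. c \<le> real n * p n"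
    using filterlim_at_top_lower_bound by blast
  define x where "x n = real n * exp (- (real n * p n))" for n
  define e where "e = exp (- 8) * (1 - exp (- (c / 2)))"
  have e: "e > 0"
    using c by (simp add: e_def)
  have "filterlim (\<lambda>n. ln (real n) - real n * p n) at_top sequentially"
    using A by blast
  \<comment> \<open>The threshold \<open>ln (1 / e)\<close> makes the lower variance bound
    \<open>e * x n\<close> at least 1; the threshold 0 gives
    \<open>n * p \<le> ln n\<close>.\<close>
  then have ev_ln: "\<forall>\<^sub>F n in sequentially. ln (1 / e) \<le> ln (real n) - real n * p n"
    and ev_le: "\<forall>\<^sub>F n in sequentially. 0 \<le> ln (real n) - real n * p n"
    unfolding filterlim_at_top by blast+
  have good: "\<forall>\<^sub>F n in sequentially. n \<ge> 2 \<and> 0 < p n \<and> p n \<le> 1 / 2 \<and> c \<le> real n * p n \<and>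
      W_var n (p n) \<le> 6 * x n \<and> e * x n \<le> W_var n (p n) \<and> W_var n (p n) \<ge> 1 \<and> W_var n (p n) \<le> 6 * real n"
    using c(2) ev_ln ev_le eventually_ge_at_top[of 2]
  proof eventually_elim
    case (elim n)
    have n: "real n > 0"
      using elim by simp
    have p0: "0 < p n"
      using elim c p_prob[of n] by (cases "p n = 0") auto
    have p2: "p n \<le> 1 / 2"
    proof -
      \<comment> \<open>Splitting off \<open>ln 2\<close> yields \<open>ln n \<le> n / 2\<close>,
        and hence \<open>p \<le> 1 / 2\<close> from \<open>n * p \<le> ln n\<close>.\<close>
      have "ln (real n) = ln (real n / 2) + ln 2"
        using n by (simp add: ln_div)
      also have "\<dots> \<le> (real n / 2 - 1) + (2 - 1)"
        using n by (intro add_mono ln_le_minus_one) auto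
      finally have "real n * p n \<le> real n * (1 / 2)"
        using elim by linarith
      then show ?thesis
        by (rule mult_left_le_imp_le) (rule n)
    qed
    have b: "W_var n (p n) \<le> 6 * x n" "e * x n \<le> W_var n (p n)"
      unfolding x_def e_def using dense_variance_bounds[of "p n" n c] p0 p2 elim c(1) by simp_all
    have "1 / e = exp (ln (1 / e))"
      using e by simp
    also have "\<dots> \<le> exp (ln (real n) - real n * p n)"
      using elim by simp
    also have "\<dots> = x n"
      using n by (simp add: x_def exp_diff exp_minus divide_inverse)
    finally have "1 \<le> e * x n"
      using e by (simp add: field_simps)
    moreover have "x n \<le> real n * 1"
      unfolding x_def using p0 by (intro mult_left_mono) auto
    ultimately show ?case
      using b p0 p2 elim by linarith
  qed
  have "(\<lambda>n. W_var n (p n)) \<in> O(x)"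
    by (rule bigoI[where c = 6], rule eventually_mono[OF good]) auto
  moreover have "x \<in> O(\<lambda>n. W_var n (p n))"
    by (rule bigoI[where c = "1 / e"], rule eventually_mono[OF good]) (use e in \<open>auto simp: field_simps x_def\<close>)
  ultimately have "(\<lambda>n. W_var n (p n)) \<in> \<Theta>(x)"
    by (intro bigthetaI) (simp_all add: bigomega_iff_bigo)
  moreover have "(\<lambda>n. d_loc (W_cdf n (p n)) (TP_cdf (W_mean n (p n)) (W_var n (p n)))) \<in> O(\<lambda>n. W_var n (p n) powr (-3/4))"
  proof (rule bigoI)
    show "\<forall>\<^sub>F n in sequentially. norm (d_loc (W_cdf n (p n)) (TP_cdf (W_mean n (p n)) (W_var n (p n)))) \<le>
       (near_const + 402 + 12 / ((1 - exp (- c / 4))\<^sup>2 / 4)) * norm (W_var n (p n) powr (-3/4))"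
      using good
    proof eventually_elim
      case (elim n)
      then have "\<bar>d_loc (W_cdf n (p n)) (TP_cdf (W_mean n (p n)) (W_var n (p n)))\<bar> \<le>
          (near_const + 402 + 12 / ((1 - exp (- c / 4))\<^sup>2 / 4)) * W_var n (p n) powr (- 3 / 4)"
        using c by (intro d_loc_dense_le) auto
      then show ?case
        by simp
    qed
  qed
  ultimately show "(\<lambda>n. W_var n (p n)) \<in> \<Theta>(\<lambda>n. real n * exp (- (real n * p n))) \<and>
     (\<lambda>n. d_loc (W_cdf n (p n)) (TP_cdf (W_mean n (p n)) (W_var n (p n)))) \<in> O(\<lambda>n. W_var n (p n) powr (-3/4))"
    unfolding x_def by blast
next
  assume A: "(\<lambda>n. real n * p n) \<longlonglongrightarrow> 0 \<and> filterlim (\<lambda>n. (real n)^2 * p n) at_top sequentially"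
  have ev1: "\<forall>\<^sub>F n in sequentially. real n * p n < 1 / 4"
    using A by (intro order_tendstoD(2)[of _ 0]) auto
  \<comment> \<open>The threshold 8 turns the lower bound \<open>n ^ 2 * p / 8\<close> for the
    variance into 1.\<close>
  have ev2: "\<forall>\<^sub>F n in sequentially. 8 \<le> (real n)\<^sup>2 * p n"
    using A by (auto simp: filterlim_at_top)
  have good: "\<forall>\<^sub>F n in sequentially. n \<ge> 2 \<and> 0 < p n \<and> p n \<le> 1 / 2 \<and> real n * p n \<le> 1 / 4 \<and>
      1 \<le> (real n)\<^sup>2 * p n \<and> W_var n (p n) \<le> 2 * ((real n)\<^sup>2 * p n) \<and> (real n)\<^sup>2 * p n / 8 \<le> W_var n (p n) \<and>
      W_var n (p n) \<ge> 1"
    using ev1 ev2 eventually_ge_at_top[of 2]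
  proof eventually_elim
    case (elim n)
    have p0: "0 < p n"
      using elim p_prob[of n] by (cases "p n = 0") auto
    have "1 * p n \<le> real n * p n"
      using elim p0 by (intro mult_right_mono) auto
    then have p2: "p n \<le> 1 / 2"
      using elim by simp
    have "W_var n (p n) \<le> 2 * ((real n)\<^sup>2 * p n)" "(real n)\<^sup>2 * p n / 8 \<le> W_var n (p n)"
      using sparse_variance_bounds[of "p n" n] p0 p2 elim by simp_all
    then show ?case
      using p0 p2 elim by simp
  qed
  have "(\<lambda>n. W_var n (p n)) \<in> O(\<lambda>n. (real n)\<^sup>2 * p n)"
    by (rule bigoI[where c = 2], rule eventually_mono[OF good]) auto
  moreover have "(\<lambda>n. (real n)\<^sup>2 * p n) \<in> O(\<lambda>n. W_var n (p n))"
    by (rule bigoI[where c = 8], rule eventually_mono[OF good]) auto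
  ultimately have "(\<lambda>n. W_var n (p n)) \<in> \<Theta>(\<lambda>n. (real n)\<^sup>2 * p n)"
    by (intro bigthetaI) (simp_all add: bigomega_iff_bigo)
  moreover have "(\<lambda>n. d_loc (W_cdf n (p n)) (TP_cdf (W_mean n (p n)) (W_var n (p n))))
      \<in> O(\<lambda>n. 1 / (sqrt (W_var n (p n)) * (real n * p n powr (3/4))))"
  proof (rule bigoI)
    show "\<forall>\<^sub>F n in sequentially. norm (d_loc (W_cdf n (p n)) (TP_cdf (W_mean n (p n)) (W_var n (p n)))) \<le>
       (2 * (near_const + 402) + 25920 * 256) * norm (1 / (sqrt (W_var n (p n)) * (real n * p n powr (3/4))))"
      using good
    proof eventually_elim
      case (elim n)
      then have "\<bar>d_loc (W_cdf n (p n)) (TP_cdf (W_mean n (p n)) (W_var n (p n)))\<bar> \<le>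
          (2 * (near_const + 402) + 25920 * 256) * (1 / (sqrt (W_var n (p n)) * (real n * p n powr (3 / 4))))"
        by (intro d_loc_sparse_le) auto
      moreover have "norm (1 / (sqrt (W_var n (p n)) * (real n * p n powr (3/4)))) =
          1 / (sqrt (W_var n (p n)) * (real n * p n powr (3/4)))"
        using elim by (simp add: abs_mult)
      ultimately show ?case
        by simp
    qed
  qed
  moreover have "(\<lambda>n. d_loc_m 2 (W_cdf n (p n)) (TP_cdf (W_mean n (p n)) (W_var n (p n))))
      \<in> O(\<lambda>n. W_var n (p n) powr (-3/4))"
  proof (rule bigoI)
    show "\<forall>\<^sub>F n in sequentially. norm (d_loc_m 2 (W_cdf n (p n)) (TP_cdf (W_mean n (p n)) (W_var n (p n)))) \<le>
       (near_const + 402 + 4320 * 25920) * norm (W_var n (p n) powr (-3/4))"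
      using good
    proof eventually_elim
      case (elim n)
      then have "\<bar>d_loc_m 2 (W_cdf n (p n)) (TP_cdf (W_mean n (p n)) (W_var n (p n)))\<bar> \<le>
          (near_const + 402 + 4320 * 25920) * W_var n (p n) powr (- 3 / 4)"
        by (intro d_loc_2_sparse_le) auto
      then show ?case
        by simp
    qed
  qed
  ultimately show "(\<lambda>n. W_var n (p n)) \<in> \<Theta>(\<lambda>n. (real n)^2 * p n) \<and>
     (\<lambda>n. d_loc (W_cdf n (p n)) (TP_cdf (W_mean n (p n)) (W_var n (p n))))
        \<in> O(\<lambda>n. 1 / (sqrt (W_var n (p n)) * (real n * p n powr (3/4)))) \<and>
     (\<lambda>n. d_loc_m 2 (W_cdf n (p n)) (TP_cdf (W_mean n (p n)) (W_var n (p n))))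
        \<in> O(\<lambda>n. W_var n (p n) powr (-3/4))"
    by blast
qed

end
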